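(* Let $H\in\{\text{house},\text{hammer},\text{diamond}\}$, let $\mathcal{C}$ be the class of $(\text{bull},H)$-free graphs, let $\mathcal{G}$ be a hereditary class of graphs, and let $\mathcal{H}$ be the class of triangle-free graphs. Then every graph in $\mathcal{G}\cap\mathcal{C}$ is perfectly divisible if and only if every graph in $\mathcal{G}\cap\mathcal{H}$ is perfectly divisible.
   Context: Graphs are finite and simple. A bull is a triangle with two disjoint pendant edges. A house is the complement of $P_5$. A hammer is obtained by identifying an end vertex of a $P_3$ with a vertex of a triangle. A diamond is $K_4$ minus an edge. A class is hereditary if closed under isomorphism and induced subgraphs. A graph is perfect if $\chi(H)=\omega(H)$ for all induced subgraphs $H$. $G$ is perfectly divisible if for every induced subgraph $H$ of $G$, $V(H)$ can be partitioned into $A,B$ with $H[A]$ perfect and $\omega(H[B])<\omega(H)$. *)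

theory Defs
  imports Main
begin

text \<open>
  A graph is a pair of a vertex set and a set of two-element edges.  The predicate
  \<open>simple_graph\<close> selects the finite simple graphs.  The null graph is admitted; in
  particular the parts of a partition may be empty, and both the clique number and the
  chromatic number of the null graph are 0.
\<close>

type_synonym 'a graph = "'a set \<times> 'a set set"

abbreviation verts :: "'a graph \<Rightarrow> 'a set" where
  "verts G \<equiv> fst G"

abbreviation edges :: "'a graph \<Rightarrow> 'a set set" where
  "edges G \<equiv> snd G"

definition simple_graph :: "'a graph \<Rightarrow> bool" where
  "simple_graph G \<longleftrightarrow>
     finite (verts G) \<and>
     edges G \<subseteq> {{u, v} | u v. u \<in> verts G \<and> v \<in> verts G \<and> u \<noteq> v}"

definition induce :: "'a graph \<Rightarrow> 'a set \<Rightarrow> 'a graph" where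
  "induce G S = (S, {e \<in> edges G. e \<subseteq> S})"

definition induced_subgraph :: "'a graph \<Rightarrow> 'a graph \<Rightarrow> bool" where
  "induced_subgraph H G \<longleftrightarrow> (\<exists>S \<subseteq> verts G. H = induce G S)"

definition graph_iso :: "'a graph \<Rightarrow> 'b graph \<Rightarrow> bool" where
  "graph_iso G H \<longleftrightarrow>
     (\<exists>f. bij_betw f (verts G) (verts H) \<and>
          (\<forall>u \<in> verts G. \<forall>v \<in> verts G. {u, v} \<in> edges G \<longleftrightarrow> {f u, f v} \<in> edges H))"

definition free_of :: "'b graph \<Rightarrow> 'a graph \<Rightarrow> bool" where
  "free_of F G \<longleftrightarrow> \<not> (\<exists>H. induced_subgraph H G \<and> graph_iso F H)"

definition complement_graph :: "'a graph \<Rightarrow> 'a graph" where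
  "complement_graph G =
     (verts G, {{u, v} | u v. u \<in> verts G \<and> v \<in> verts G \<and> u \<noteq> v \<and> {u, v} \<notin> edges G})"

definition path_graph :: "nat \<Rightarrow> nat graph" where
  "path_graph n = ({..<n}, {{i, Suc i} | i. Suc i < n})"

definition complete_graph :: "nat \<Rightarrow> nat graph" where
  "complete_graph n = ({..<n}, {{i, j} | i j. i < n \<and> j < n \<and> i \<noteq> j})"

abbreviation triangle :: "nat graph" where
  "triangle \<equiv> complete_graph 3"

text \<open>In both the bull and the hammer, the triangle is on the vertices 0, 1, 2.\<close>

definition bull :: "nat graph" where
  "bull = ({0, 1, 2, 3, 4}, {{0, 1}, {0, 2}, {1, 2}, {0, 3}, {1, 4}})"

definition house :: "nat graph" where
  "house = complement_graph (path_graph 5)"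

definition hammer :: "nat graph" where
  "hammer = ({0, 1, 2, 3, 4}, {{0, 1}, {0, 2}, {1, 2}, {2, 3}, {3, 4}})"

definition diamond :: "nat graph" where
  "diamond = (verts (complete_graph 4), edges (complete_graph 4) - {{0, 1}})"

definition is_clique :: "'a graph \<Rightarrow> 'a set \<Rightarrow> bool" where
  "is_clique G K \<longleftrightarrow> K \<subseteq> verts G \<and> (\<forall>u \<in> K. \<forall>v \<in> K. u \<noteq> v \<longrightarrow> {u, v} \<in> edges G)"

definition clique_number :: "'a graph \<Rightarrow> nat" where
  "clique_number G = Max {card K | K. is_clique G K}"

definition proper_coloring :: "'a graph \<Rightarrow> nat \<Rightarrow> ('a \<Rightarrow> nat) \<Rightarrow> bool" where
  "proper_coloring G k c \<longleftrightarrow>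
     (\<forall>v \<in> verts G. c v < k) \<and>
     (\<forall>u \<in> verts G. \<forall>v \<in> verts G. {u, v} \<in> edges G \<longrightarrow> c u \<noteq> c v)"

definition chromatic_number :: "'a graph \<Rightarrow> nat" where
  "chromatic_number G = (LEAST k. \<exists>c. proper_coloring G k c)"

definition perfect :: "'a graph \<Rightarrow> bool" where
  "perfect G \<longleftrightarrow> (\<forall>H. induced_subgraph H G \<longrightarrow> chromatic_number H = clique_number H)"

text \<open>
  The induced subgraph \<open>H\<close> below has to be non-null: no part of the null graph has clique
  number less than 0, so otherwise no graph at all would be perfectly divisible.
\<close>

definition perfectly_divisible :: "'a graph \<Rightarrow> bool" where
  "perfectly_divisible G \<longleftrightarrow>
     (\<forall>H. induced_subgraph H G \<and> verts H \<noteq> {} \<longrightarrow>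
        (\<exists>A B. A \<union> B = verts H \<and> A \<inter> B = {} \<and>
               perfect (induce H A) \<and> clique_number (induce H B) < clique_number H))"

text \<open>A class of graphs is a set of finite simple graphs with vertices in a type \<open>'a\<close>.\<close>

definition hereditary :: "'a graph set \<Rightarrow> bool" where
  "hereditary \<G> \<longleftrightarrow>
     (\<forall>G \<in> \<G>. simple_graph G) \<and>
     (\<forall>G \<in> \<G>. \<forall>H. simple_graph H \<and> graph_iso G H \<longrightarrow> H \<in> \<G>) \<and>
     (\<forall>G \<in> \<G>. \<forall>H. induced_subgraph H G \<longrightarrow> H \<in> \<G>)"

end

theory Submission
  imports Defs
begin

text \<open>
  Call a set \<open>P\<close> of vertices a transversal if it induces a perfect graph and meets every
  inclusion-maximal clique.  If every non-empty induced subgraph has a transversal, the graph is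
  perfectly divisible.  A triangle-free perfectly divisible graph has one (the perfect part of a
  partition together with the isolated vertices), a graph without stable triples has one (a
  vertex and its non-neighbours), and simplicial vertices may be added.  The existence of
  transversals is preserved by substitution, because a maximal clique of the composed graph is
  composed of maximal cliques of the two factors, and because perfection is preserved by the
  replication lemma.  It therefore suffices that a prime (bull, \<open>H\<close>)-free graph cannot contain
  both a triangle and a stable triple, unless \<open>H\<close> is the diamond and there is a simplicial vertex.

  House: triangles force all neighbourhoods to be connected.  Then there are no induced \<open>P\<^sub>5\<close> and
  no \<open>C\<^sub>5\<close>, so the complement satisfies the same hypotheses, and the chain structure
  between the neighbours and the non-neighbours of a vertex gives a contradiction.
  Hammer: in the complement, which is banner-free, a vertex with a stable triple in its
  neighbourhood has a stable neighbourhood, so the graph is claw-free or tiny; an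
  induced \<open>P\<^sub>5\<close> exists and its middle vertex lies in no triangle.
  Diamond: around a maximal clique \<open>K\<close> the graph is the product of \<open>K\<close> and an edge.
\<close>

section \<open>Connectivity and homogeneous sets\<close>

text \<open>Perfect divisibility controls maximum cliques only. Under substitution a maximum clique
  of the composed graph need not project to a maximum clique of the quotient, merely to a maximal
  one; hence the detour through the stronger property of meeting all maximal cliques. For a
  triangle-free graph with an edge the two properties differ only at isolated vertices, and adding
  these keeps a graph perfect.

  The house and hammer arguments exploit primeness in one recurring way. To exclude a configuration,
  take a component, in the graph or in its complement, of a set of vertices with prescribed
  adjacency to a few fixed vertices. If it has two elements and is not everything, some outside
  vertex distinguishes the ends of one of its edges (or nonedges). By maximality of the component
  this vertex violates the prescription, and the possible violations are refuted by a bull, a house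
  or a banner.\<close>

definition conn :: "('a \<Rightarrow> 'a \<Rightarrow> bool) \<Rightarrow> 'a set \<Rightarrow> bool" where
  "conn E S \<longleftrightarrow> (\<forall>T\<subseteq>S. T \<noteq> {} \<and> T \<noteq> S \<longrightarrow> (\<exists>a\<in>T. \<exists>b\<in>S - T. E a b))"

text \<open>Primeness in the sense of modular decomposition: a proper module has at most one
  element. Graphs with at most two vertices are prime vacuously, which is why
  \<open>prime_conn\<close> asks for three vertices.\<close>

definition prime_graph :: "'a set \<Rightarrow> ('a \<Rightarrow> 'a \<Rightarrow> bool) \<Rightarrow> bool" where
  "prime_graph V E \<longleftrightarrow> (\<forall>X\<subseteq>V. (\<exists>x\<in>X. \<exists>y\<in>X. x \<noteq> y) \<and> X \<noteq> V \<longrightarrow>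
     (\<exists>u\<in>V - X. \<exists>a\<in>X. \<exists>b\<in>X. E u a \<and> \<not> E u b))"

definition co :: "'a set \<Rightarrow> ('a \<Rightarrow> 'a \<Rightarrow> bool) \<Rightarrow> 'a \<Rightarrow> 'a \<Rightarrow> bool" where
  "co V E x y \<longleftrightarrow> x \<in> V \<and> y \<in> V \<and> x \<noteq> y \<and> \<not> E x y"

text \<open>In the following patterns any two of the named vertices are adjacent or distinguished by a
  third one, so that distinctness need not be required.\<close>

definition bull_free :: "('a \<Rightarrow> 'a \<Rightarrow> bool) \<Rightarrow> bool" where
  "bull_free E \<longleftrightarrow> \<not> (\<exists>a b c d e. E a b \<and> E a c \<and> E b c \<and> E a d \<and> E b e \<and>
     \<not> E b d \<and> \<not> E c d \<and> \<not> E a e \<and> \<not> E c e \<and> \<not> E d e)"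

definition house_free :: "('a \<Rightarrow> 'a \<Rightarrow> bool) \<Rightarrow> bool" where
  "house_free E \<longleftrightarrow> \<not> (\<exists>p q r s t. E p q \<and> E q r \<and> E r s \<and> E s p \<and> E t p \<and> E t q \<and>
     \<not> E p r \<and> \<not> E q s \<and> \<not> E t r \<and> \<not> E t s)"

lemma bull_freeD:
  "bull_free E \<Longrightarrow> E a b \<Longrightarrow> E a c \<Longrightarrow> E b c \<Longrightarrow> E a d \<Longrightarrow> E b e \<Longrightarrow>
   \<not> E b d \<Longrightarrow> \<not> E c d \<Longrightarrow> \<not> E a e \<Longrightarrow> \<not> E c e
     \<Longrightarrow> \<not> E d e \<Longrightarrow> False"
  unfolding bull_free_def by blast

lemma house_freeD:
  "house_free E \<Longrightarrow> E p q \<Longrightarrow> E q r \<Longrightarrow> E r s \<Longrightarrow> E s p \<Longrightarrow> E t p \<Longrightarrow> E t q \<Longrightarrow>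
   \<not> E p r \<Longrightarrow> \<not> E q s \<Longrightarrow> \<not> E t r \<Longrightarrow> \<not> E t s
     \<Longrightarrow> False"
  unfolding house_free_def by blast

lemma conn_cutD:
  assumes "conn E S" "T \<subseteq> S" "T \<noteq> {}" "T \<noteq> S"
  obtains a b where "a \<in> T" "b \<in> S" "b \<notin> T" "E a b"
  using assms unfolding conn_def by blast

lemma conn_pred_edge:
  assumes "conn E W" "p \<in> W" "q \<in> W" "Q p" "\<not> Q q"
  obtains a b where "a \<in> W" "b \<in> W" "E a b" "Q a" "\<not> Q b"
proof (rule conn_cutD[OF assms(1), of "{x \<in> W. Q x}"])
  show "{x \<in> W. Q x} \<noteq> W" using assms by blast
qed (use assms that in auto)

lemma conn_singleton: "conn E {x}"
  unfolding conn_def by blast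

locale finite_graph =
  fixes V :: "'a set" and E :: "'a \<Rightarrow> 'a \<Rightarrow> bool"
  assumes fin: "finite V"
    and E_in: "E x y \<Longrightarrow> x \<in> V"
    and E_sym: "E x y \<Longrightarrow> E y x"
    and E_irr [simp]: "\<not> E x x"
begin

lemma E_comm: "E x y \<longleftrightarrow> E y x"
  using E_sym by blast

lemma E_in2: "E x y \<Longrightarrow> y \<in> V"
  using E_sym E_in by blast

definition N :: "'a \<Rightarrow> 'a set" where "N y = {x. E y x}"

definition M :: "'a \<Rightarrow> 'a set" where "M y = {x \<in> V. x \<noteq> y \<and> \<not> E y x}"

lemma in_N [simp]: "x \<in> N y \<longleftrightarrow> E y x"
  by (simp add: N_def)

lemma in_M: "x \<in> M y \<longleftrightarrow> x \<in> V \<and> x \<noteq> y \<and> \<not> E y x"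
  by (simp add: M_def)

lemma finite_graph_co: "finite_graph V (co V E)"
  using fin E_comm by unfold_locales (auto simp: co_def)

lemma conn_insert:
  assumes "conn E S" "s \<in> S" "E s w"
  shows "conn E (insert w S)"
  unfolding conn_def
proof (intro allI impI, elim conjE)
  fix T assume T: "T \<subseteq> insert w S" "T \<noteq> {}" "T \<noteq> insert w S"
  show "\<exists>a\<in>T. \<exists>b\<in>insert w S - T. E a b"
  proof (cases "T \<inter> S = {} \<or> S \<subseteq> T")
    case True
    then have "(w \<in> T \<and> s \<notin> T) \<or> (s \<in> T \<and> w \<notin> T)" using T assms(2) by
      auto
    then show ?thesis using assms(2,3) E_sym[OF assms(3)] by auto
  next
    case False
    then obtain a b where "a \<in> T \<inter> S" "b \<in> S" "b \<notin> T \<inter> S" "E a b"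
      using conn_cutD[OF assms(1), of "T \<inter> S"] by blast
    then show ?thesis by blast
  qed
qed

lemma conn_pair: "E a b \<Longrightarrow> conn E {a, b}"
  using conn_insert[OF conn_singleton, of b b a] E_sym by simp

lemma component:
  assumes "conn E S" "S \<subseteq> A" "A \<subseteq> V" "S \<noteq> {}"
  obtains W where "S \<subseteq> W" "W \<subseteq> A" "conn E W"
    "\<And>w x. w \<in> A \<Longrightarrow> w \<notin> W \<Longrightarrow> x \<in> W \<Longrightarrow> \<not> E x w"
proof -
  let ?F = "{W. S \<subseteq> W \<and> W \<subseteq> A \<and> conn E W}"
  have "finite ?F" by (rule finite_subset[of _ "Pow A"]) (use assms(3) fin finite_subset in auto)
  moreover have "S \<in> ?F" using assms by blast
  ultimately obtain W where W: "W \<in> ?F"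
    "\<And>W'. W' \<in> ?F \<Longrightarrow> W \<subseteq> W' \<Longrightarrow> W = W'"
    using finite_has_maximal[of ?F] by fastforce
  have "\<not> E x w" if "w \<in> A" "w \<notin> W" "x \<in> W" for w x
  proof
    assume "E x w"
    then have "insert w W \<in> ?F" using W(1) that conn_insert by auto
    then show False using W(2) that by blast
  qed
  then show ?thesis using that W(1) by blast
qed

text \<open>Primeness provides \<open>u\<close> seeing one element of \<open>W\<close> and missing
  another; as \<open>W\<close> is connected, adjacency to \<open>u\<close> switches along an edge of
  \<open>W\<close>.\<close>

lemma prime_mixed:
  assumes "prime_graph V E" "conn E W" "W \<subseteq> V" "W \<noteq> V" "p \<in> W" "q \<in> W"
    "p \<noteq> q"
  obtains u a b where "u \<in> V" "u \<notin> W" "a \<in> W" "b \<in> W" "E a b" "E u a" "\<not> E u b"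
proof -
  obtain u a b where "u \<in> V - W" "a \<in> W" "b \<in> W" "E u a" "\<not> E u b"
    using assms unfolding prime_graph_def by meson
  then show ?thesis using conn_pred_edge[OF assms(2), of a b "E u"] that by blast
qed

lemma prime_co:
  assumes "prime_graph V E"
  shows "prime_graph V (co V E)"
  unfolding prime_graph_def
proof (intro allI impI)
  fix X assume X: "X \<subseteq> V" "(\<exists>x\<in>X. \<exists>y\<in>X. x \<noteq> y) \<and> X \<noteq> V"
  then obtain u a b where h: "u \<in> V - X" "a \<in> X" "b \<in> X" "E u a" "\<not> E u b"
    using assms unfolding prime_graph_def by meson
  then have "co V E u b" "\<not> co V E u a" using X(1) by (auto simp: co_def)
  then show "\<exists>u\<in>V - X. \<exists>a\<in>X. \<exists>b\<in>X. co V E u a \<and> \<not> co V E u b"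
    using h by blast
qed

text \<open>Both sides of a cut without crossing edges are homogeneous, hence have at most one
  element each, which three vertices exclude.\<close>

lemma prime_conn:
  assumes "prime_graph V E" "x \<in> V" "y \<in> V" "z \<in> V" "x \<noteq> y" "x \<noteq> z" "y \<noteq> z"
  shows "conn E V"
proof (rule ccontr)
  assume "\<not> conn E V"
  then obtain T where T: "T \<subseteq> V" "T \<noteq> {}" "T \<noteq> V" and no:
    "\<And>a b. a \<in> T \<Longrightarrow> b \<in> V - T \<Longrightarrow> \<not> E a b"
    unfolding conn_def by blast
  have hom: "\<not> (\<exists>x\<in>X. \<exists>y\<in>X. x \<noteq> y)" if "X = T \<or> X = V - T" for X
  proof
    assume "\<exists>x\<in>X. \<exists>y\<in>X. x \<noteq> y"
    moreover have "X \<subseteq> V" "X \<noteq> V" using that T by auto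
    ultimately obtain u a where "u \<in> V - X" "a \<in> X" "E u a"
      using assms(1) unfolding prime_graph_def by meson
    then show False using that no E_sym by blast
  qed
  show False using hom[of T] hom[of "V - T"] assms(2-) by blast
qed

end

locale prime_bull_free = finite_graph +
  assumes prime: "prime_graph V E"
    and bull: "bull_free E"
begin

text \<open>Otherwise the component of \<open>P\<close> in the set of those vertices that are not centres of \<open>P\<close> but
  adjacent to all centres would be homogeneous.\<close>

lemma no_center:
  assumes conn: "conn E P" and coconn: "conn (co V E) P" and two: "p \<in> P" "q \<in> P" "p \<noteq> q"
    and hom: "\<And>d z p q. \<forall>p\<in>P. E d p \<Longrightarrow> \<not> E z d \<Longrightarrow> p \<in> P \<Longrightarrow> q \<in> P \<Longrightarrow> E z p \<Longrightarrow> E z q"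
    and d0: "\<forall>p\<in>P. E d0 p"
  shows False
proof -
  define D where "D = {d. \<forall>p\<in>P. E d p}"
  define A where "A = {x \<in> V. x \<notin> D \<and> (\<forall>d\<in>D. E d x)}"
  have "P \<subseteq> A" using d0 E_in2 E_irr unfolding A_def D_def by blast
  moreover have "A \<subseteq> V" by (auto simp: A_def)
  ultimately obtain W where W: "P \<subseteq> W" "W \<subseteq> A" "conn E W"
    and comp: "\<And>w x. w \<in> A \<Longrightarrow> w \<notin> W \<Longrightarrow> x \<in> W \<Longrightarrow> \<not> E x w"
    using component[OF conn] two by blast
  have "d0 \<in> D" using d0 by (simp add: D_def)
  then have "d0 \<notin> W" using W(2) by (auto simp: A_def)
  have "d0 \<in> V" using d0 two E_in by blast
  obtain u a b where u: "u \<in> V" "u \<notin> W" "a \<in> W" "b \<in> W" "E a b" "E u a" "\<not> E u b"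
  proof (rule prime_mixed[OF prime W(3), of p q])
    show "W \<subseteq> V" using W(2) by (auto simp: A_def)
    show "W \<noteq> V" using \<open>d0 \<in> V\<close> \<open>d0 \<notin> W\<close> by blast
  qed (use two W(1) that in auto)
  \<comment> \<open>As a centre, \<open>u\<close> would see \<open>b\<close>; as an element of
    \<open>A\<close>, it would lie in \<open>W\<close>. So some centre \<open>v\<close> misses
    \<open>u\<close>.\<close>
  have "u \<notin> D" using u W(2) by (auto simp: A_def)
  have "u \<notin> A" using comp u E_sym by blast
  then obtain v where v: "v \<in> D" "\<not> E v u" using u(1) \<open>u \<notin> D\<close> by
    (auto simp: A_def)
  have vP: "\<And>x. x \<in> P \<Longrightarrow> E v x" using v by (auto simp: D_def)
  have uP: "\<not> E u x" if "x \<in> P" for x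
  proof
    assume "E u x"
    then have "\<forall>y\<in>P. E u y" using hom[of v u x] v that E_comm[of u v] by (auto simp: D_def)
    then show False using \<open>u \<notin> D\<close> by (simp add: D_def)
  qed
  have "p \<in> W" using two W(1) by blast
  obtain y z where yz: "y \<in> W" "z \<in> W" "E y z" "E u y" "\<not> E u z"
    using conn_pred_edge[OF W(3) u(3) \<open>p \<in> W\<close>, of "E u"] u(6) uP[OF two(1)] by metis
  have vW: "\<And>x. x \<in> W \<Longrightarrow> E v x" using v W(2) by (auto simp: A_def)
  \<comment> \<open>\<open>v\<close> sees all of \<open>W\<close> and misses \<open>u\<close>. A
    bull with triangle through \<open>y\<close> and \<open>v\<close> and pendant \<open>u\<close> at
    \<open>y\<close> still needs a third triangle vertex and a pendant at \<open>v\<close>: either a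
    nonedge of \<open>P\<close> on which \<open>y\<close> is mixed supplies both, or they are
    \<open>z\<close> and a vertex of \<open>P\<close> missed by \<open>z\<close>.\<close>
  show False
  proof (cases "\<exists>c\<in>P. E y c")
    case True
    then obtain c0 where c0: "c0 \<in> P" "E y c0" by blast
    have "y \<notin> D" using yz W(2) by (auto simp: A_def)
    then obtain c1 where c1: "c1 \<in> P" "\<not> E y c1" by (auto simp: D_def)
    obtain c d where cd: "c \<in> P" "d \<in> P" "co V E c d" "E y c" "\<not> E y d"
      using conn_pred_edge[OF coconn, of c0 c1 "E y"] c0 c1 by metis
    have "\<not> E c d" using cd(3) by (simp add: co_def)
    then show False using bull_freeD[OF bull, of y v c u d] vW[OF yz(1)] yz cd v vP[of c] vP[of d] uP[of c]
      uP[of d]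
      by (simp add: E_comm)
  next
    case False
    have "z \<notin> D" using yz W(2) by (auto simp: A_def)
    then obtain c where c: "c \<in> P" "\<not> E z c" by (auto simp: D_def)
    then show False using bull_freeD[OF bull, of y v z u c] vW[of y] vW[of z] yz v vP[of c] uP[of c] False
      by (auto simp: E_comm)
  qed
qed

end

text \<open>The bull is self-complementary: in the complement, \<open>d\<close>, \<open>e\<close>,
  \<open>c\<close> form the triangle, and \<open>b\<close>, \<open>a\<close> are the pendants at
  \<open>d\<close>, \<open>e\<close>.\<close>

lemma bull_free_co:
  assumes "finite_graph V E" "bull_free E"
  shows "bull_free (co V E)"
proof -
  interpret finite_graph V E by fact
  have no: False if h: "co V E a b" "co V E a c" "co V E b c" "co V E a d" "co V E b e"
     "\<not> co V E b d" "\<not> co V E c d" "\<not> co V E a e" "\<not> co V E c e" "\<not> co V E d e" for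
     a b c d e
  proof -
    have "b \<noteq> d" "c \<noteq> d" "a \<noteq> e" "c \<noteq> e" "d \<noteq> e" using h E_comm by
      (auto simp: co_def)
    then have "E b d" "E c d" "E a e" "E c e" "E d e" "\<not> E a b" "\<not> E a c" "\<not> E b c"
      "\<not> E a d" "\<not> E b e"
      using h by (auto simp: co_def)
    then show False using bull_freeD[OF assms(2), of d e c b a] by (auto simp: E_comm)
  qed
  show ?thesis unfolding bull_free_def by (intro notI, elim exE conjE) (rule no)
qed

section \<open>House-free graphs\<close>

locale house_graph = prime_bull_free +
  assumes house: "house_free E"
begin

text \<open>Let \<open>W\<close> be the component of the edge \<open>s t\<close> in
  \<open>N y\<close>, \<open>u\<close> a vertex mixed on an edge of \<open>W\<close>, and
  \<open>z\<close> a neighbour of \<open>y\<close> outside \<open>W\<close>. With \<open>y\<close>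
  and that edge they form a house if \<open>u\<close> sees \<open>z\<close>, and a bull
  otherwise.\<close>

lemma N_conn:
  assumes "E y s" "E y t" "E s t"
  shows "conn E (N y)"
proof -
  have "conn E {s, t}" "{s, t} \<subseteq> N y" "N y \<subseteq> V" using conn_pair assms E_in2 by auto
  then obtain W where W: "{s, t} \<subseteq> W" "W \<subseteq> N y" "conn E W"
    and comp: "\<And>w x. w \<in> N y \<Longrightarrow> w \<notin> W \<Longrightarrow> x \<in> W \<Longrightarrow> \<not> E x w"
    using component by (metis insert_not_empty)
  have "N y \<subseteq> W"
  proof
    fix z assume z: "z \<in> N y"
    show "z \<in> W"
    proof (rule ccontr)
      assume zW: "z \<notin> W"
      have "y \<notin> W" "y \<in> V" using W(2) E_in assms by auto
      obtain u a b where u: "u \<notin> W" "a \<in> W" "b \<in> W" "E a b" "E u a" "\<not> E u b"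
      proof (rule prime_mixed[OF prime W(3), of s t])
        show "W \<subseteq> V" using W(2) \<open>N y \<subseteq> V\<close> by blast
        show "W \<noteq> V" using \<open>y \<notin> W\<close> \<open>y \<in> V\<close> by blast
        show "s \<noteq> t" using assms(3) by auto
      qed (use W(1) that in auto)
      have y: "E y a" "E y b" "E y z" "\<not> E a z" "\<not> E b z" using u W(2) z comp[OF z zW] by auto
      have "\<not> E y u" using comp[of u a] u E_comm[of u a] by auto
      then show False
        using house_freeD[OF house, of a y z u b] bull_freeD[OF bull, of a y b u z] u y
        by (auto simp: E_comm)
    qed
  qed
  then show ?thesis using W by (metis subset_antisym)
qed

text \<open>Lying in a triangle passes along an edge \<open>a b\<close>: \<open>N a\<close> is
  connected with more than one vertex, so \<open>b\<close> has a neighbour in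
  \<open>N a\<close>.\<close>

lemma N_conn_all:
  assumes "conn E V" "E p q" "E q r" "E p r" "y \<in> V"
  shows "conn E (N y)" "\<exists>s t. E y s \<and> E y t \<and> E s t"
proof -
  show ex: "\<exists>s t. E y s \<and> E y t \<and> E s t"
  proof (rule ccontr)
    assume no: "\<not> ?thesis"
    have "p \<in> V" using assms E_in by blast
    define Q where "Q y \<longleftrightarrow> (\<exists>s t. E y s \<and> E y t \<and> E s t)" for y
    have "Q p" "\<not> Q y" using assms no by (auto simp: Q_def)
    then obtain a b where ab: "E a b" "Q a" "\<not> Q b"
      using conn_pred_edge[OF assms(1) \<open>p \<in> V\<close> assms(5)] by metis
    obtain s t where st: "E a s" "E a t" "E s t" using ab(2) by (auto simp: Q_def)
    then have cN: "conn E (N a)" using N_conn by blast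
    have "\<exists>x. x \<in> N a - {b}" using st by (metis E_irr in_N Diff_iff singletonD)
    then have "{b} \<noteq> N a" by blast
    then obtain r where "r \<in> N a" "E b r"
      using conn_cutD[OF cN, of "{b}"] ab(1) by auto
    then have "Q b" using ab(1) E_comm[of a b] E_comm[of a r] E_comm[of b r] unfolding Q_def by (metis in_N)
    then show False using ab by simp
  qed
  then show "conn E (N y)" using N_conn by blast
qed

text \<open>Supplies the homogeneity premise of \<open>no_center\<close>: used on the four-vertex
  subpaths, read from both ends, it makes a nonneighbour of a centre constant along a five-vertex
  path.\<close>

lemma P4_center:
  assumes "E p1 p2" "E p2 p3" "E p3 p4" "\<not> E p1 p3" "\<not> E p1 p4" "\<not> E p2 p4"
    and "E d p1" "E d p2" "E d p3" "E d p4" "\<not> E z d"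
  shows "E z p1 \<longleftrightarrow> E z p2"
proof -
  note h = house_freeD[OF house] and b = bull_freeD[OF bull]
  show ?thesis
    using assms b[of p1 d p2 z p4] b[of p2 d p1 z p4] b[of p3 d p4 z p1] b[of p4 d p3 z p1]
      b[of p2 p3 z p1 p4] h[of d p3 z p1 p4] h[of d p2 z p4 p1] h[of d p1 z p4 p2] h[of d p4 z p1 p3]
    by (cases "E z p1"; cases "E z p2"; cases "E z p3"; cases "E z p4") (simp_all add: E_comm)
qed

text \<open>The pair \<open>p1\<close>, \<open>p5\<close> is left unconstrained, so that
  \<open>P5\<close> and \<open>C5\<close> are covered together. In either case
  \<open>p4 p1 p3 p5 p2\<close> is a path of the complement, which gives co-connectedness.\<close>

lemma no_P5_center:
  assumes "E p1 p2" "E p2 p3" "E p3 p4" "E p4 p5" "\<not> E p1 p3" "\<not> E p1 p4" "\<not> E p2 p4"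
    "\<not> E p2 p5"
    "\<not> E p3 p5" and d: "E d p1" "E d p2" "E d p3" "E d p4" "E d p5"
  shows False
proof (rule no_center)
  interpret c: finite_graph V "co V E" by (rule finite_graph_co)
  let ?P = "{p1, p2, p3, p4, p5}"
  have V: "p1 \<in> V" "p2 \<in> V" "p3 \<in> V" "p4 \<in> V" "p5 \<in> V" using assms E_in E_in2 by blast+
  have "conn E {p5, p4, p3, p2, p1}"
    by (rule conn_insert[of _ p4], rule conn_insert[of _ p3], rule conn_insert[of _ p2],
        rule conn_insert[of _ p1], rule conn_singleton) (use assms in auto)
  then show "conn E ?P" by (simp add: insert_commute)
  have "conn (co V E) {p2, p5, p3, p1, p4}"
    by (rule c.conn_insert[of _ p5], rule c.conn_insert[of _ p3], rule c.conn_insert[of _ p1],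
        rule c.conn_insert[of _ p4], rule conn_singleton)
      (use assms V E_sym in \<open>auto simp: co_def\<close>)
  then show "conn (co V E) ?P" by (simp add: insert_commute)
  show "p1 \<in> ?P" "p2 \<in> ?P" "p1 \<noteq> p2" using assms by auto
  show "\<forall>p\<in>?P. E d p" using d by simp
  fix d z p q
  assume h: "\<forall>p\<in>?P. E d p" "\<not> E z d" "p \<in> ?P" "q \<in> ?P" "E z p"
  have "E z p1 \<longleftrightarrow> E z p2" "E z p2 \<longleftrightarrow> E z p3"
    "E z p3 \<longleftrightarrow> E z p4" "E z p4 \<longleftrightarrow> E z p5"
    using P4_center[of p1 p2 p3 p4 d z] P4_center[of p2 p3 p4 p5 d z]
      P4_center[of p4 p3 p2 p1 d z] P4_center[of p5 p4 p3 p2 d z] assms h E_comm by auto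
  then show "E z q" using h by auto
qed

text \<open>\<open>r\<close> duplicates the middle of the path \<open>m a y b m'\<close>, whose ends
  may be adjacent. \<open>A\<close> collects all such duplicates. A vertex mixed on the component of
  \<open>y\<close> and \<open>r\<close> in \<open>A\<close> must see \<open>a\<close> and
  \<open>b\<close>, hence also \<open>m\<close> or \<open>m'\<close>, and each possibility closes a
  bull or a house.\<close>

lemma no_P5_twin:
  assumes "E m a" "E a y" "E y b" "E b m'" "\<not> E m y" "\<not> E m b" "\<not> E a b" "\<not> E m' y"
    "\<not> E m' a"
    and r: "E r a" "E r b" "E r y" "\<not> E r m" "\<not> E r m'"
  shows False
proof -
  define A where "A = {x \<in> V. E a x \<and> E b x \<and> \<not> E m x \<and> \<not> E m' x}"
  have "conn E {y, r}" "{y, r} \<subseteq> A" "A \<subseteq> V"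
    using conn_pair assms E_in E_in2 E_comm by (auto simp: A_def)
  then obtain W where W: "{y, r} \<subseteq> W" "W \<subseteq> A" "conn E W"
    and comp: "\<And>w x. w \<in> A \<Longrightarrow> w \<notin> W \<Longrightarrow> x \<in> W \<Longrightarrow> \<not> E x w"
    using component by (metis insert_not_empty)
  have "a \<in> V" "a \<notin> W" using assms E_in W(2) by (auto simp: A_def)
  obtain u z z' where u: "u \<in> V" "u \<notin> W" "z \<in> W" "z' \<in> W" "E z z'" "E u z"
    "\<not> E u z'"
  proof (rule prime_mixed[OF prime W(3), of y r])
    show "W \<subseteq> V" using W(2) \<open>A \<subseteq> V\<close> by blast
    show "W \<noteq> V" using \<open>a \<in> V\<close> \<open>a \<notin> W\<close> by blast
    show "y \<noteq> r" using r(3) by auto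
  qed (use W(1) that in auto)
  have z: "E a z" "E b z" "\<not> E m z" "\<not> E m' z" "E a z'" "E b z'" "\<not> E m z'" "\<not> E m' z'"
    using u W(2) by (auto simp: A_def)
  note hs = house_freeD[OF house] and bl = bull_freeD[OF bull]
  have ua: "E u a" using hs[of z a m u z'] bl[of a z z' m u] u z assms by (auto simp: E_comm)
  have ub: "E u b" using hs[of z b m' u z'] bl[of b z z' m' u] u z assms by (auto simp: E_comm)
  have "E u m \<or> E u m'" using comp[of u z] u ua ub E_comm by (auto simp: A_def)
  then show False
    using hs[of u b m' m z] bl[of b u z m' m] hs[of u a m m' z] bl[of a u z m m'] hs[of u a z' b m]
      u z ua ub assms by (auto simp: E_comm)
qed

text \<open>A neighbour of \<open>y\<close> private to \<open>m\<close> and one private to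
  \<open>m'\<close> are nonadjacent, by bull or house (\<open>AB\<close>). So an edge
  \<open>a0 r\<close> of the connected set \<open>N y\<close> that leaves the private neighbours of
  \<open>m\<close> ends in a vertex seeing both or neither of \<open>m\<close>, \<open>m'\<close>.
  Such an \<open>r\<close> is a centre of the path \<open>m a0 y b m'\<close> or a twin of its
  middle.\<close>

lemma neighbourhood_chain:
  assumes "conn E (N y)" "E y a" "E y b" "\<not> E y m" "\<not> E y m'" "E m a" "\<not> E m b" "E m' b"
    "\<not> E m' a"
  shows False
proof -
  note hs = house_freeD[OF house] and bl = bull_freeD[OF bull]
  have AB: False if "E y a'" "E y b'" "E m a'" "\<not> E m b'" "E m' b'" "\<not> E m' a'" "E a' b'" for a'
    b'
    using that assms bl[of a' b' y m m'] hs[of a' b' m' m y] by (auto simp: E_comm)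
  obtain a0 r where r: "E y a0" "E m a0" "\<not> E m' a0" "E y r" "E a0 r"
    "\<not> (E m r \<and> \<not> E m' r)"
    using conn_pred_edge[OF assms(1), of a b "\<lambda>x. E m x \<and> \<not> E m' x"] assms by (metis in_N)
  have ab: "\<not> E a0 b" using AB[of a0 b] r assms by blast
  show False
  proof (cases "E m r")
    case True
    then have "E m' r" using r by blast
    then have "E r b" using hs[of y r m' b a0] r ab assms by (auto simp: E_comm)
    then show False using no_P5_center[of m a0 y b m' r] r ab assms True \<open>E m' r\<close> by
      (auto simp: E_comm)
  next
    case False
    have "\<not> E m' r" using AB[of a0 r] r False assms by blast
    then have "E r b" using bl[of a0 y r m b] r ab False assms by (auto simp: E_comm)
    then show False using no_P5_twin[of m a0 y b m' r] r ab assms False \<open>\<not> E m' r\<close> by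
      (auto simp: E_comm)
  qed
qed

end

section \<open>House-free case: nested neighbourhoods\<close>

locale chain_graph = house_graph +
  assumes V_conn: "conn E V"
    and chained: "\<And>y a b m m'. E y a \<Longrightarrow> E y b \<Longrightarrow> \<not> E y m \<Longrightarrow> \<not> E y m' \<Longrightarrow> E m a \<Longrightarrow> \<not> E m b \<Longrightarrow>
      E m' b \<Longrightarrow> \<not> E m' a \<Longrightarrow> False"
    and conn_N: "\<And>y. y \<in> V \<Longrightarrow> conn E (N y)"
begin

text \<open>\<open>chained\<close> also makes the traces of the neighbours of \<open>y\<close> on
  \<open>M y\<close> nested, so one of largest cardinality contains all others.\<close>

lemma top_neighbour:
  assumes "E y x0"
  obtains u where "E y u"
    "\<And>m x. m \<in> M y \<Longrightarrow> E y x \<Longrightarrow> E x m \<Longrightarrow> E u m"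
proof -
  have fin_N: "finite (N x \<inter> M y)" for x
    using fin by (auto simp: M_def)
  have "finite (N y)" using fin E_in2 by (auto intro: finite_subset[of _ V])
  then have "finite ((\<lambda>x. card (N x \<inter> M y)) ` N y)"
    "(\<lambda>x. card (N x \<inter> M y)) ` N y \<noteq> {}"
    using assms by auto
  from Max_in[OF this] Max_ge[OF this(1)]
  obtain u where u: "E y u"
    "\<And>x. E y x \<Longrightarrow> card (N x \<inter> M y) \<le> card (N u \<inter> M y)"
    by auto
  have "E u m" if m: "m \<in> M y" and x: "E y x" "E x m" for m x
  proof (rule ccontr)
    assume um: "\<not> E u m"
    have "\<not> N u \<inter> M y \<subset> N x \<inter> M y"
      using psubset_card_mono[OF fin_N[of x]] u(2)[OF x(1)] leD by blast
    moreover have "m \<in> N x \<inter> M y" "m \<notin> N u \<inter> M y" using m x um by auto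
    ultimately have "\<not> N u \<inter> M y \<subseteq> N x \<inter> M y" by blast
    then obtain m'' where "m'' \<in> M y" "E u m''" "\<not> E x m''" by (metis IntE IntI in_N subsetI)
    then show False using chained[of y x u m m''] m x um u(1) E_comm by (auto simp: in_M)
  qed
  then show ?thesis using that u(1) by blast
qed

end

context chain_graph begin

text \<open>The component \<^term>\<open>W\<close> of \<^term>\<open>N u \<inter> M y\<close> is distinguished only by vertices of
  \<^term>\<open>N u \<inter> N y\<close>; this forces \<^term>\<open>y\<close> to be complete to the rest of \<^term>\<open>N u \<inter> M n\<close>.\<close>

lemma complete_to_nonneighbours:
  assumes E: "E y u" "E u x" "E u x1" "E x x1" "\<not> E y x" "\<not> E y x1" "x \<noteq> y" "x1 \<noteq> y"
    and n: "n \<in> V" "\<not> E n y" "\<And>v. E y v \<Longrightarrow> \<not> E n v" "E n x"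
    and q: "E u q" "\<not> E n q" "q \<noteq> n" "q \<noteq> y"
  shows "E y q"
proof (rule ccontr)
  assume yq: "\<not> E y q"
  note hs = house_freeD[OF house] and bl = bull_freeD[OF bull]
  interpret c: finite_graph V "co V E" by (rule finite_graph_co)
  have nu: "\<not> E n u" using n E by blast
  define A where "A = {w \<in> V. E u w \<and> \<not> E y w \<and> w \<noteq> y}"
  have "conn E {x, x1}" "{x, x1} \<subseteq> A" "A \<subseteq> V" using conn_pair E E_in2 by
    (auto simp: A_def)
  then obtain W where W: "{x, x1} \<subseteq> W" "W \<subseteq> A" "conn E W"
    and comp: "\<And>w x. w \<in> A \<Longrightarrow> w \<notin> W \<Longrightarrow> x \<in> W \<Longrightarrow> \<not> E x w"
    using component by (metis insert_not_empty)
  have inW: "E u z" "\<not> E y z" "z \<noteq> y" "z \<in> V" if "z \<in> W" for z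
    using that W(2) by (auto simp: A_def)
  \<comment> \<open>Nonneighbours of \<open>u\<close> cannot split \<open>W\<close>. Hence
    \<open>n\<close>, which sees \<open>x\<close>, is complete to \<open>W\<close>; and the vertex
    \<open>w\<close> that splits \<open>W\<close> lies in \<open>N u\<close>, thus in
    \<open>N y\<close> by maximality of \<open>W\<close>.\<close>
  have homW: "E z t" if h: "\<not> E u z" "s \<in> W" "t \<in> W" "E z s" for z s t
  proof (rule ccontr)
    assume "\<not> E z t"
    then obtain a b where "a \<in> W" "b \<in> W" "E a b" "E z a" "\<not> E z b"
      using conn_pred_edge[OF W(3) h(2,3), of "E z"] h by metis
    then show False using bl[of a u b z y] hs[of a u y z b] inW[of a] inW[of b] h(1) E
      by (auto simp: E_comm)
  qed
  have nW: "E n z" if "z \<in> W" for z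
    using homW[of n x z] that W(1) n nu E_comm[of n u] by auto
  have "u \<notin> W" "u \<in> V" using inW[of u] E E_in by auto
  obtain w z1 z2 where w: "w \<in> V" "w \<notin> W" "z1 \<in> W" "z2 \<in> W" "E z1 z2" "E w z1"
    "\<not> E w z2"
  proof (rule prime_mixed[OF prime W(3), of x x1])
    show "W \<subseteq> V" using W(2) \<open>A \<subseteq> V\<close> by blast
    show "W \<noteq> V" using \<open>u \<notin> W\<close> \<open>u \<in> V\<close> by blast
    show "x \<noteq> x1" using E by auto
  qed (use W(1) that in auto)
  have uw: "E u w" using homW[of w z1 z2] w by blast
  have "w \<notin> A" using comp[of w z1] w E_comm[of w z1] by blast
  then have yw: "E y w" using w uw inW[of z1] by (auto simp: A_def)
  then have nw: "\<not> E n w" using n by blast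

  \<comment> \<open>The second component is taken in the complement: \<open>Q\<close> contains the
    nonedge \<open>y q\<close> inside \<open>N u \<inter> M n\<close>. It turns out anticomplete to
    \<open>W\<close>, whereas \<open>w\<close>, from a different co-component, is complete to
    it.\<close>
  define R where "R = {r \<in> V. E u r \<and> \<not> E n r \<and> r \<noteq> n}"
  have yn: "y \<noteq> n" using n(3)[of u] E nu n(4) E_comm by blast
  have "co V E y q" using yq q E E_in E_in2 by (auto simp: co_def)
  then have "conn (co V E) {y, q}" by (rule c.conn_pair)
  moreover have "{y, q} \<subseteq> R" "R \<subseteq> V" using E q n yn E_in E_in2 E_comm by
    (auto simp: R_def)
  ultimately obtain Q where Q: "{y, q} \<subseteq> Q" "Q \<subseteq> R" "conn (co V E) Q"
    and cocomp: "\<And>w x. w \<in> R \<Longrightarrow> w \<notin> Q \<Longrightarrow> x \<in> Q \<Longrightarrow> \<not> co V E x w"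
    using c.component by (metis insert_not_empty)
  have inQ: "E u z" "\<not> E n z" "z \<noteq> n" "z \<in> V" if "z \<in> Q" for z
    using that Q(2) by (auto simp: R_def)
  have homQ: "E z t" if h: "E u z" "E n z" "s \<in> Q" "t \<in> Q" "E z s" for z s t
  proof (rule ccontr)
    assume "\<not> E z t"
    then obtain a b where ab: "a \<in> Q" "b \<in> Q" "co V E a b" "E z a" "\<not> E z b"
      using conn_pred_edge[OF Q(3) h(3,4), of "E z"] h by metis
    then have "\<not> E a b" by (simp add: co_def)
    then show False using bl[of z u a n b] inQ[of a] inQ[of b] h ab nu
      by (auto simp: E_comm)
  qed
  have WQ: "\<not> E z r" if "z \<in> W" "r \<in> Q" for z r
    using homQ[of z r y] inW[of z] nW[of z] that Q(1) E_comm[of z y] by auto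
  have "w \<notin> Q" using WQ[of z1 w] w E_comm[of w z1] by auto
  moreover have "w \<in> R" using w uw nw nu E_comm[of n u] by (auto simp: R_def)
  ultimately have wQ: "E w r" if "r \<in> Q" for r
    using cocomp[of w r] that inQ[of r] w E_comm[of w r] by (auto simp: co_def)
  obtain v t s where v: "v \<in> V" "v \<notin> Q" "t \<in> Q" "s \<in> Q" "co V E t s" "co V E v t"
    "\<not> co V E v s"
  proof (rule c.prime_mixed[OF prime_co[OF prime] Q(3), of y q])
    show "Q \<subseteq> V" using Q(2) \<open>R \<subseteq> V\<close> by blast
    show "Q \<noteq> V" using \<open>w \<notin> Q\<close> w by blast
    show "y \<noteq> q" using q by auto
  qed (use Q(1) that in auto)
  have v': "E v s" "\<not> E v t" "\<not> E t s" using v inQ[of s] by (auto simp: co_def)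
  have uv: "\<not> E u v"
  proof
    assume "E u v"
    show False
    proof (cases "E n v")
      case True
      then show False using homQ[of v s t] v v' \<open>E u v\<close> by blast
    next
      case False
      then have "v \<in> R" using v \<open>E u v\<close> nu E_comm[of n u] by (auto simp: R_def)
      then show False using cocomp[of v t] v v' E_comm[of v t] by (auto simp: co_def)
    qed
  qed
  \<comment> \<open>Both \<open>v\<close> and \<open>n\<close> miss \<open>u\<close>, and
    \<open>s\<close> is seen by \<open>v\<close> but not by \<open>n\<close>; so by nestedness at
    \<open>u\<close>, \<open>v\<close> sees whatever \<open>n\<close> sees in
    \<open>N u\<close>.\<close>
  have vW: "E v z" if "z \<in> W" for z
    using chained[of u s z v n] inQ[of s] inW[of z] nW[of z] that v v' uv nu E_comm by metis
  \<comment> \<open>The 4-cycle \<open>s u z2 v\<close> with roof \<open>w\<close> forces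
    \<open>w\<close> to see \<open>v\<close>; then \<open>w u z2 v\<close> is a 4-cycle with roof
    \<open>t\<close>.\<close>
  have "E w v"
    using hs[of s u z2 v w] inQ[of s] inW[of z2] v v' w uw uv wQ[of s] vW[of z2] WQ[of z2 s]
    by (auto simp: E_comm)
  then show False
    using hs[of w u z2 v t] inQ[of t] inW[of z2] v v' w uw uv wQ[of t] vW[of z2] WQ[of z2 t]
    by (auto simp: E_comm)
qed

text \<open>If some vertices \<open>M0\<close> of \<open>M y\<close> are not attached to
  \<open>N y\<close>, they turn out to be complete to the attached ones \<open>M1\<close>, which
  cuts the complement of \<open>M y\<close>.\<close>

lemma nonneighbours_attached:
  assumes y: "y \<in> V" and coconn: "conn (co V E) (M y)" and m0: "m0 \<in> M y"
  shows "\<exists>v. E y v \<and> E m0 v"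
proof (rule ccontr)
  assume m0N: "\<not> ?thesis"
  define M1 where "M1 = {m \<in> M y. \<exists>v. E y v \<and> E m v}"
  define M0 where "M0 = M y - M1"
  have inM1: "m \<in> V" "m \<noteq> y" "\<not> E y m" if "m \<in> M1" for m using that by
    (auto simp: M1_def in_M)
  have inM0: "m \<in> V" "m \<noteq> y" "\<not> E y m" "\<And>v. E y v \<Longrightarrow> \<not> E m v" if
    "m \<in> M0" for m
    using that by (auto simp: M0_def M1_def in_M)
  have classify: "m = y \<or> E y m \<or> m \<in> M1 \<or> m \<in> M0" if "m \<in> V" for m
    using that by (auto simp: M0_def in_M)
  have m00: "m0 \<in> M0" using m0 m0N by (auto simp: M0_def M1_def)
  have "m0 \<in> V" "m0 \<noteq> y" using inM0 m00 by auto
  obtain x0 where "E y x0"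
    using conn_pred_edge[OF V_conn y \<open>m0 \<in> V\<close>, of "\<lambda>x. x = y"]
      \<open>m0 \<noteq> y\<close> by metis
  then obtain u where u: "E y u"
    "\<And>m x. m \<in> M y \<Longrightarrow> E y x \<Longrightarrow> E x m \<Longrightarrow> E u m"
    using top_neighbour by blast
  have uM1: "E u m" if "m \<in> M1" for m using that u(2) E_sym by (auto simp: M1_def)
  \<comment> \<open>Otherwise connectedness of \<open>V\<close> gives an edge \<open>a b\<close> of
    \<open>M0\<close> where \<open>a\<close> has no neighbour in \<open>M1\<close> but
    \<open>b\<close> sees some \<open>x\<close> in \<open>M1\<close>. Then \<open>y u x b a\<close>
    violates nestedness at \<open>x\<close>.\<close>
  have ex: "\<exists>x\<in>M1. E x m" if m: "m \<in> M0" for m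
  proof (rule ccontr)
    assume no: "\<not> ?thesis"
    define Q where "Q z \<longleftrightarrow> z \<in> M0 \<and> \<not> (\<exists>x\<in>M1. E x z)" for z
    have "Q m" "\<not> Q y" using m no inM0(2) by (auto simp: Q_def)
    then obtain a b where ab: "a \<in> V" "b \<in> V" "E a b" "Q a" "\<not> Q b"
      using conn_pred_edge[OF V_conn inM0(1)[OF m] y] by metis
    have a: "a \<in> M0" "\<And>x. x \<in> M1 \<Longrightarrow> \<not> E x a" using ab(4) by
      (auto simp: Q_def)
    have "b \<noteq> y" "\<not> E y b" "b \<notin> M1" using a(2)[of b] inM0[OF a(1)] ab(3) E_comm by blast+
    then have b: "b \<in> M0" using classify ab by blast
    then obtain x where x: "x \<in> M1" "E x b" using ab(5) by (auto simp: Q_def)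
    have "E x u" "\<not> E x y" "\<not> E x a" "\<not> E b u" "\<not> E a u" "E b x" "E y u" "\<not> E y b"
      "E a b"
      using uM1[OF x(1)] a(2)[OF x(1)] inM1[OF x(1)] inM0[OF b] inM0[OF a(1)] u(1) ab(3) x E_comm
      by blast+
    then show False using chained[of x u b y a] x by (auto simp: E_comm)
  qed
  have full: "E n x'" if n: "n \<in> M0" and x': "x' \<in> M1" for n x'
  proof -
    obtain x where x: "x \<in> M1" "E x n" using ex n by blast
    have "conn E (N x)" using conn_N inM1 x by blast
    moreover have "u \<in> N x" using uM1[OF x(1)] E_comm by auto
    moreover have "u \<notin> M0" using inM0 u(1) by blast
    \<comment> \<open>Leaving \<open>M0\<close> inside the connected set \<open>N x\<close> yields a
      neighbour \<open>x1\<close> of \<open>x\<close> in \<open>M1\<close>: its neighbour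
      \<open>k\<close> in \<open>M0\<close> rules out that \<open>x1\<close> is \<open>y\<close> or
      lies in \<open>N y\<close>.\<close>
    ultimately obtain k x1 where k: "E x x1" "E k x1" "k \<in> M0" "x1 \<notin> M0"
      using conn_pred_edge[of E "N x" n u "\<lambda>z. z \<in> M0"] x n by (metis in_N)
    have "x1 \<noteq> y" "\<not> E y x1" using k inM1[OF x(1)] inM0[OF k(3)] E_comm by blast+
    then have x1: "x1 \<in> M1" using classify[of x1] k E_in2 by blast
    show "E n x'"
    proof (rule ccontr)
      assume "\<not> E n x'"
      then have "E y x'"
        using complete_to_nonneighbours[of y u x x1 n x'] u(1) uM1 x x1 x' k inM1 inM0[OF n] E_comm n
        by (metis DiffD2 M0_def)
      then show False using inM1 x' by blast
    qed
  qed
  obtain x where "x \<in> M1" using ex m00 by blast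
  then have "x \<in> M y" "x \<notin> M0" by (auto simp: M0_def M1_def)
  then obtain a b where "a \<in> M y" "b \<in> M y" "co V E a b" "a \<in> M0" "b \<notin> M0"
    using conn_pred_edge[OF coconn m0, of x "\<lambda>z. z \<in> M0"] m00 by metis
  then show False using full[of a b] by (auto simp: co_def M0_def)
qed

end

lemma house_free_co:
  assumes "finite_graph V E"
    and P5: "\<And>p1 p2 p3 p4 p5. E p1 p2 \<Longrightarrow> E p2 p3 \<Longrightarrow> E p3 p4 \<Longrightarrow> E p4 p5 \<Longrightarrow> \<not> E p1 p3 \<Longrightarrow> \<not> E p1 p4 \<Longrightarrow>
      \<not> E p2 p4 \<Longrightarrow> \<not> E p2 p5 \<Longrightarrow> \<not> E p3 p5 \<Longrightarrow>
        False"
  shows "house_free (co V E)"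
proof -
  interpret finite_graph V E by fact
  have no: False if h: "co V E p q" "co V E q r" "co V E r s" "co V E s p" "co V E t p" "co V E t q"
     "\<not> co V E p r" "\<not> co V E q s" "\<not> co V E t r" "\<not> co V E t s" for p q r s t
  proof -
    have "p \<noteq> r" "q \<noteq> s" "t \<noteq> r" "t \<noteq> s" using h E_comm by (auto simp: co_def)
    then have "E p r" "E q s" "E t r" "E t s" "\<not> E p q" "\<not> E q r" "\<not> E r s" "\<not> E s p"
      "\<not> E t p" "\<not> E t q"
      using h by (auto simp: co_def)
    then show False using P5[of p r t s q] by (auto simp: E_comm)
  qed
  show ?thesis unfolding house_free_def by (intro notI, elim exE conjE) (rule no)
qed

text \<open>The triangle makes neighbourhoods connected in the graph, the stable triple in the
  complement. Then the top neighbour \<open>u\<close> of \<open>p\<close> sees all nonneighbours of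
  \<open>p\<close>, while \<open>nonneighbours_attached\<close> in the complement produces one that
  \<open>u\<close> misses.\<close>

lemma (in house_graph) triangle_stable_False:
  assumes tri: "E p q" "E q r" "E p r"
    and st: "co V E s1 s2" "co V E s2 s3" "co V E s1 s3"
  shows False
proof -
  have V_conn: "conn E V"
  proof (rule prime_conn[OF prime])
    show "p \<in> V" "q \<in> V" "r \<in> V" "p \<noteq> q" "p \<noteq> r" "q \<noteq> r" using tri E_in
      E_in2 by auto
  qed
  note N = N_conn_all[OF V_conn tri]
  have ch: False if h: "E y a" "E y b" "\<not> E y m" "\<not> E y m'" "E m a" "\<not> E m b" "E m' b"
    "\<not> E m' a"
    for y a b m m'
    using neighbourhood_chain[of y a b m m'] N(1)[of y] E_in h by blast
  interpret chain_graph V E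
    using V_conn N(1) ch by unfold_locales
  interpret c: finite_graph V "co V E" by (rule finite_graph_co)
  have cob: "bull_free (co V E)" using bull_free_co finite_graph_axioms bull by blast
  \<comment> \<open>Nestedness fails at the middle of a \<open>P5\<close> and at a vertex of a
    \<open>C5\<close>, so neither occurs.\<close>
  have coh: "house_free (co V E)"
    using finite_graph_axioms
  proof (rule house_free_co)
    fix p1 p2 p3 p4 p5
    assume "E p1 p2" "E p2 p3" "E p3 p4" "E p4 p5" "\<not> E p1 p3" "\<not> E p1 p4" "\<not> E p2 p4"
      "\<not> E p2 p5" "\<not> E p3 p5"
    then show False using ch[of p3 p2 p4 p1 p5] by (auto simp: E_comm)
  qed
  interpret c: house_graph V "co V E"
    using prime_co[OF prime] cob coh by unfold_locales
  have coV: "conn (co V E) V"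
  proof (rule c.prime_conn[OF prime_co[OF prime]])
    show "s1 \<in> V" "s2 \<in> V" "s3 \<in> V" "s1 \<noteq> s2" "s1 \<noteq> s3" "s2 \<noteq> s3" using st
      by (auto simp: co_def)
  qed
  note cN = c.N_conn_all[OF coV st(1,2,3)]
  \<comment> \<open>\<open>chained\<close> is self-complementary: complementation exchanges the
    neighbours \<open>a\<close>, \<open>b\<close> of \<open>y\<close> with the nonneighbours
    \<open>m\<close>, \<open>m'\<close>.\<close>
  interpret c: chain_graph V "co V E"
  proof unfold_locales
    fix y a b m m'
    assume h: "co V E y a" "co V E y b" "\<not> co V E y m" "\<not> co V E y m'" "co V E m a"
      "\<not> co V E m b"
      "co V E m' b" "\<not> co V E m' a"
    have "y \<noteq> m" "y \<noteq> m'" "m \<noteq> b" "m' \<noteq> a" using h E_comm by (auto simp: co_def)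
    then have "E y m" "E y m'" "E m b" "E m' a" "\<not> E y a" "\<not> E y b" "\<not> E m a" "\<not> E m' b"
      using h by (auto simp: co_def)
    then show False using ch[of y m m' b a] by (auto simp: E_comm)
  qed (use coV cN(1) in auto)
  have Nc: "c.N y = M y" "c.M y = N y" if "y \<in> V" for y
    using that E_in2 by (auto simp: in_M c.in_M co_def)
  have p: "p \<in> V" using tri E_in by blast
  obtain u where u: "E p u"
    "\<And>m x. m \<in> M p \<Longrightarrow> E p x \<Longrightarrow> E x m \<Longrightarrow> E u m"
    using top_neighbour tri(1) by blast
  have uM: "E u m" if "m \<in> M p" for m
  proof -
    have "conn (co V E) (M p)" using cN(1)[OF p] Nc[OF p] by simp
    then show ?thesis using nonneighbours_attached[OF p _ that] u(2)[OF that] E_comm by metis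
  qed
  have "conn (co V (co V E)) (c.M p)"
  proof -
    have "conn E (c.M p)" using conn_N[OF p] Nc[OF p] by simp
    then show ?thesis unfolding conn_def by (metis (no_types) co_def E_in E_in2 E_irr)
  qed
  then obtain v where "co V E p v" "co V E u v"
    using c.nonneighbours_attached[OF p, of u] Nc[OF p] u(1) by auto
  then show False using uM[of v] by (auto simp: co_def in_M)
qed

section \<open>Graphs with hammer-free complement\<close>

text \<open>The banner, a 4-cycle with a pendant edge, is the complement of the hammer.
  \<open>q\<close> and \<open>s\<close> have the same adjacencies to the other vertices, so their
  distinctness must be demanded explicitly.\<close>

definition banner_free :: "('a \<Rightarrow> 'a \<Rightarrow> bool) \<Rightarrow> bool" where
  "banner_free E \<longleftrightarrow> \<not> (\<exists>p q r s t. E p q \<and> E q r \<and> E r s \<and> E s p \<and> E p t \<and> q \<noteq> s \<and>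
     \<not> E p r \<and> \<not> E q s \<and> \<not> E q t \<and> \<not> E r t \<and> \<not> E s t)"

lemma banner_freeD:
  "banner_free E \<Longrightarrow> E p q \<Longrightarrow> E q r \<Longrightarrow> E r s \<Longrightarrow> E s p \<Longrightarrow> E p t \<Longrightarrow> q \<noteq> s \<Longrightarrow>
   \<not> E p r \<Longrightarrow> \<not> E q s \<Longrightarrow> \<not> E q t \<Longrightarrow> \<not> E r t
     \<Longrightarrow> \<not> E s t \<Longrightarrow> False"
  unfolding banner_free_def by blast

locale banner_graph = prime_bull_free +
  assumes banner: "banner_free E"
begin

text \<open>This rule comes from the bull alone, the next one from the banner alone. They describe
  how a nonneighbour \<open>y\<close> of \<open>v\<close> meets \<open>N v\<close> and drive most of
  the analysis below.\<close>

lemma edge_dominates: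
  assumes "\<not> E v y" "E v s" "E v t" "E v z" "E s t" "E y s" "\<not> E y t" "\<not> E z s"
    "\<not> E z t"
  shows "E y z"
  using bull_freeD[OF bull, of s v t y z] assms by (auto simp: E_comm)

lemma nonedge_dominates:
  assumes "\<not> E v y" "E v s" "E v t" "E v z" "\<not> E s t" "s \<noteq> t" "E y s" "E y t"
    "\<not> E z s" "\<not> E z t"
  shows "E y z"
  using banner_freeD[OF banner, of v s y t z] assms by (auto simp: E_comm)

text \<open>By the edge rule, a nonneighbour of \<open>v\<close> splitting \<open>W\<close> sees all
  of \<open>N v - W\<close>. A nonedge inside either part then contradicts the nonedge rule for a
  suitable such vertex; inside \<open>W\<close> it has to split a nonedge, found in a
  co-component.\<close>

lemma disconnected_neighbourhood:
  assumes W: "W \<subseteq> N v" "conn E W" "p \<in> W" "q \<in> W" "p \<noteq> q"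
    and comp: "\<And>w x. w \<in> N v \<Longrightarrow> w \<notin> W \<Longrightarrow> x \<in> W \<Longrightarrow> \<not> E x w"
    and z: "z \<in> N v" "z \<notin> W"
  shows "\<And>d e. d \<in> W \<Longrightarrow> e \<in> W \<Longrightarrow> d \<noteq> e \<Longrightarrow> E d e"
    and "\<And>d e. d \<in> N v - W \<Longrightarrow> e \<in> N v - W \<Longrightarrow> d \<noteq> e \<Longrightarrow> E d e"
proof -
  have WV: "W \<subseteq> V" using W(1) E_in2 by auto
  have v: "v \<in> V" "v \<notin> W" using z W(1) E_in by auto
  have full: "E y d" if y: "\<not> E v y" "s \<in> W" "t \<in> W" "E y s" "\<not> E y t" and d:
    "d \<in> N v" "d \<notin> W" for y s t d
  proof -
    obtain a b where "a \<in> W" "b \<in> W" "E a b" "E y a" "\<not> E y b"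
      using conn_pred_edge[OF W(2) y(2,3), of "E y"] y by metis
    then show ?thesis using edge_dominates[of v y a b d] y(1) subsetD[OF W(1), of a] subsetD[OF W(1), of b]
        d comp[OF d, of a] comp[OF d, of b] by (auto simp: E_comm)
  qed
  show "E d e" if de: "d \<in> W" "e \<in> W" "d \<noteq> e" for d e
  proof (rule ccontr)
    assume nde: "\<not> E d e"
    interpret c: finite_graph V "co V E" by (rule finite_graph_co)
    have "co V E d e" using de nde WV by (auto simp: co_def)
    then have "conn (co V E) {d, e}" by (rule c.conn_pair)
    moreover have "{d, e} \<subseteq> W" using de by auto
    ultimately obtain Q where Q: "{d, e} \<subseteq> Q" "Q \<subseteq> W" "conn (co V E) Q"
      and cocomp: "\<And>w x. w \<in> W \<Longrightarrow> w \<notin> Q \<Longrightarrow> x \<in> Q \<Longrightarrow> \<not> co V E x w"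
      using c.component WV by (metis insert_not_empty)
    obtain u t s where u: "u \<in> V" "u \<notin> Q" "t \<in> Q" "s \<in> Q" "co V E t s" "co V E u t"
      "\<not> co V E u s"
    proof (rule c.prime_mixed[OF prime_co[OF prime] Q(3), of d e])
      show "Q \<subseteq> V" using Q(2) WV by blast
      show "Q \<noteq> V" using v Q(2) by blast
    qed (use Q(1) de that in auto)
    have u': "E u s" "\<not> E u t" "\<not> E t s" "t \<noteq> s" "u \<noteq> t" using u by
      (auto simp: co_def)
    have st: "s \<in> W" "t \<in> W" "E v s" "E v t" using u Q(2) W(1) by auto
    have vu: "\<not> E v u"
    proof
      assume "E v u"
      show False
      proof (cases "u \<in> W")
        case True
        then show ?thesis using cocomp[of u t] u E_comm[of u t] by (auto simp: co_def)
      next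
        case False
        then show ?thesis using comp[of u s] st u' \<open>E v u\<close> E_comm[of u s] by auto
      qed
    qed
    have "E u z" using full[of u s t z] vu st u' z by blast
    then show False
      using nonedge_dominates[of v u s z t] vu st u' z comp[OF z, of s] comp[OF z, of t] E_comm by auto
  qed
  obtain u a b where u: "u \<in> V" "u \<notin> W" "a \<in> W" "b \<in> W" "E a b" "E u a" "\<not> E u b"
  proof (rule prime_mixed[OF prime W(2) WV _ W(3,4,5)])
    show "W \<noteq> V" using v by blast
  qed (use that in auto)
  have vu: "\<not> E v u" using comp[of u a] u E_comm[of u a] by auto
  show "E d e" if de: "d \<in> N v - W" "e \<in> N v - W" "d \<noteq> e" for d e
  proof (rule ccontr)
    assume "\<not> E d e"
    moreover have "E u d" "E u e" using full[of u a b] vu u de by auto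
    ultimately show False
      using nonedge_dominates[of v u d e b] vu u de W(1) comp[of d b] comp[of e b] E_comm by auto
  qed
qed

text \<open>Otherwise two cliques would cover \<open>N v\<close>, and with it a stable
  triple.\<close>

lemma neighbourhood_conn:
  assumes st: "E v a" "E v b" "E v c" "\<not> E a b" "\<not> E a c" "\<not> E b c" "a \<noteq> b"
    "a \<noteq> c" "b \<noteq> c"
    and pq: "E v p" "E v q" "E p q"
  shows "conn E (N v)"
proof -
  have "conn E {p, q}" "{p, q} \<subseteq> N v" "N v \<subseteq> V" using conn_pair pq E_in2 by auto
  then obtain W where W: "{p, q} \<subseteq> W" "W \<subseteq> N v" "conn E W"
    and comp: "\<And>w x. w \<in> N v \<Longrightarrow> w \<notin> W \<Longrightarrow> x \<in> W \<Longrightarrow> \<not> E x w"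
    using component by (metis insert_not_empty)
  have "N v \<subseteq> W"
  proof (rule ccontr)
    assume "\<not> ?thesis"
    then obtain z where z: "z \<in> N v" "z \<notin> W" by blast
    have "p \<in> W" "q \<in> W" "p \<noteq> q" using W pq by auto
    note cl = disconnected_neighbourhood[OF W(2,3) this comp z]
    show False
      using cl(1)[of a b] cl(1)[of a c] cl(1)[of b c] cl(2)[of a b] cl(2)[of a c] cl(2)[of b c] st by auto
  qed
  then show ?thesis using W by (metis subset_antisym)
qed

lemma nonneighbour_hom:
  assumes "\<not> E v y" "E v x" "E y x" "E v b" "E v c" "\<not> E y b" "\<not> E y c" "\<not> E b c"
    "E x b"
  shows "E x c"
  using edge_dominates[of v y x b c] assms by (auto simp: E_comm)

text \<open>The configuration of the next two lemmas is a path \<open>y a v b y'\<close>, possibly closed to a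
  5-cycle, with a pendant vertex \<open>c\<close> at \<open>v\<close>.\<close>

lemma no_pendant_P5_twin:
  assumes st: "\<not> E a b" "\<not> E a c" "\<not> E b c" "a \<noteq> b" "a \<noteq> c" "b \<noteq> c"
    and y: "E y a" "\<not> E y b" "\<not> E y c" "\<not> E y v" "E y' b" "\<not> E y' a" "\<not> E y' c"
      "\<not> E y' v"
    and v: "E v a" "E v b" "E v c"
    and x: "E x a" "E x b" "E x c" "\<not> E x y" "\<not> E x y'" "E v x"
  shows False
proof -
  \<comment> \<open>The vertices that can replace \<open>v\<close>. A vertex \<open>u\<close> mixed
    on the component of \<open>v\<close> and \<open>x\<close> is shown to see \<open>a\<close>,
    \<open>b\<close>, \<open>c\<close> and to miss \<open>y\<close>, \<open>y'\<close>, so it would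
    belong to that component.\<close>
  define A where "A = {w \<in> V. E a w \<and> E b w \<and> E c w \<and> \<not> E y w \<and> \<not> E y' w}"
  have "conn E {v, x}" "{v, x} \<subseteq> A" "A \<subseteq> V"
    using conn_pair assms E_in E_in2 E_comm by (auto simp: A_def)
  then obtain W where W: "{v, x} \<subseteq> W" "W \<subseteq> A" "conn E W"
    and comp: "\<And>w x. w \<in> A \<Longrightarrow> w \<notin> W \<Longrightarrow> x \<in> W \<Longrightarrow> \<not> E x w"
    using component by (metis insert_not_empty)
  have "a \<in> V" "a \<notin> W" using assms E_in2 W(2) by (auto simp: A_def)
  obtain u z z' where u: "u \<in> V" "u \<notin> W" "z \<in> W" "z' \<in> W" "E z z'" "E u z"
    "\<not> E u z'"
  proof (rule prime_mixed[OF prime W(3), of v x])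
    show "W \<subseteq> V" using W(2) \<open>A \<subseteq> V\<close> by blast
    show "W \<noteq> V" using \<open>a \<in> V\<close> \<open>a \<notin> W\<close> by blast
    show "v \<noteq> x" using x by auto
  qed (use W(1) that in auto)
  have z: "E a z" "E b z" "E c z" "\<not> E y z" "\<not> E y' z" "E a z'" "E b z'" "E c z'" "\<not> E y z'"
    "\<not> E y' z'"
    using u W(2) by (auto simp: A_def)
  note bn = banner_freeD[OF banner] and bl = bull_freeD[OF bull]
  have ne: "u \<noteq> a" "u \<noteq> b" "u \<noteq> c" using u z by auto
  have ua: "E u a"
  proof (rule ccontr)
    assume "\<not> E u a"
    moreover from this have "E u y" using bl[of a z z' y u] u z y by (auto simp: E_comm)
    ultimately have "E u b" "E u c" using bn[of z u y a b] bn[of z u y a c] u z y st ne by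
      (auto simp: E_comm)
    then show False using bn[of z' b u c a] \<open>\<not> E u a\<close> u z st by (auto simp: E_comm)
  qed
  have ub: "E u b"
  proof (rule ccontr)
    assume "\<not> E u b"
    moreover from this have "E u y'" using bl[of b z z' y' u] u z y by (auto simp: E_comm)
    ultimately have "E u c" using bn[of z u y' b c] u z y st ne by (auto simp: E_comm)
    then show False using bn[of z' a u c b] \<open>\<not> E u b\<close> ua u z st by (auto simp: E_comm)
  qed
  have uc: "E u c" using bn[of z' a u b c] ua ub u z st by (auto simp: E_comm)
  have "\<not> E u y" using bn[of u b z' c y] ub uc u z st y by (auto simp: E_comm)
  moreover have "\<not> E u y'" using bn[of u a z' c y'] ua uc u z st y by (auto simp: E_comm)
  ultimately have "u \<in> A" using ua ub uc u E_comm by (auto simp: A_def)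
  then show False using comp[of u z] u E_comm[of u z] by blast
qed

lemma no_pendant_P5_center:
  assumes st: "\<not> E a b" "\<not> E a c" "\<not> E b c" "a \<noteq> b" "a \<noteq> c" "b \<noteq> c"
    and y: "E y a" "\<not> E y b" "\<not> E y c" "\<not> E y v" "E y' b" "\<not> E y' a" "\<not> E y' c"
      "\<not> E y' v"
    and v: "E v a" "E v b" "E v c"
    and x: "E x y" "E x a" "E x v" "E x b" "E x y'" "E x c"
  shows False
proof (rule no_center)
  interpret c: finite_graph V "co V E" by (rule finite_graph_co)
  let ?P = "{y, a, v, b, y', c}"
  have V: "y \<in> V" "a \<in> V" "v \<in> V" "b \<in> V" "y' \<in> V" "c \<in> V" using assms E_in E_in2 by
    blast+
  have "conn E {y', b, c, y, a, v}"
    by (rule conn_insert[of _ b], rule conn_insert[of _ v], rule conn_insert[of _ v],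
        rule conn_insert[of _ a], rule conn_insert[of _ v], rule conn_singleton) (use assms E_comm in auto)
  then show "conn E ?P" by (simp add: insert_commute)
  have "conn (co V E) {v, y, y', c, b, a}"
    by (rule c.conn_insert[of _ y'], rule c.conn_insert[of _ b], rule c.conn_insert[of _ a],
        rule c.conn_insert[of _ b], rule c.conn_insert[of _ a], rule conn_singleton)
      (use assms V E_comm in \<open>auto simp: co_def\<close>)
  then show "conn (co V E) ?P" by (simp add: insert_commute)
  show "a \<in> ?P" "b \<in> ?P" "a \<noteq> b" using assms by auto
  show "\<forall>p\<in>?P. E x p" using x by simp
  fix d z p q
  assume h: "\<forall>p\<in>?P. E d p" "\<not> E z d" "p \<in> ?P" "q \<in> ?P" "E z p"
  have d: "E d y" "E d a" "E d v" "E d b" "E d y'" "E d c" "\<not> E d z" using h E_comm by auto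
  have ne: "b \<noteq> y" "c \<noteq> y" "y' \<noteq> a" "y' \<noteq> c" "y \<noteq> b" "y \<noteq> c"
    "c \<noteq> b" "a \<noteq> c" using assms E_comm by auto
  note R2 = nonedge_dominates[of d z] and R1 = edge_dominates[of d z]
  have e: "E v a" "E a v" "E v b" "E b v" "E v c" "E c v" "E a y" "E y a" "E b y'" "E y' b"
    using assms E_comm by auto
  have n: "\<not> E a b" "\<not> E b a" "\<not> E a c" "\<not> E c a" "\<not> E b c" "\<not> E c b"
    "\<not> E y b" "\<not> E b y" "\<not> E y c" "\<not> E c y"
    "\<not> E y v" "\<not> E v y" "\<not> E y' a" "\<not> E a y'" "\<not> E y' c" "\<not> E c y'"
    "\<not> E y' v" "\<not> E v y'"
    using assms E_comm by auto
  have r2: "E z s \<and> E z t \<longrightarrow> E z w"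
    if "s \<in> ?P" "t \<in> ?P" "w \<in> ?P" "\<not> E s t" "s \<noteq> t" "\<not> E w s" "\<not> E w t"
      for s t w
    using nonedge_dominates[of d z s t w] that h(1) d(7) by blast
  have r1: "E z s \<and> \<not> E z t \<longrightarrow> E z w"
    if "s \<in> ?P" "t \<in> ?P" "w \<in> ?P" "E s t" "\<not> E w s" "\<not> E w t" for s t w
    using edge_dominates[of d z s t w] that h(1) d(7) by blast
  have P: "y \<in> ?P" "a \<in> ?P" "v \<in> ?P" "b \<in> ?P" "y' \<in> ?P" "c \<in> ?P" by simp_all
  \<comment> \<open>Instances of the two domination rules at the centre \<open>d\<close>. Together
    with one more banner they leave only the two constant adjacency patterns of \<open>z\<close> on
    the six vertices.\<close>
  have k0: "E z a \<and> E z b \<longrightarrow> E z c" by (rule r2) (fact P n st ne)+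
  have k1: "E z a \<and> E z c \<longrightarrow> E z b" by (rule r2) (fact P n st ne)+
  have k2: "E z b \<and> E z c \<longrightarrow> E z a" by (rule r2) (fact P n st ne)+
  have k3: "E z b \<and> E z c \<longrightarrow> E z y" by (rule r2) (fact P n st ne)+
  have k4: "E z y \<and> E z b \<longrightarrow> E z c" by (rule r2) (fact P n st ne)+
  have k5: "E z y \<and> E z c \<longrightarrow> E z b" by (rule r2) (fact P n st ne)+
  have k6: "E z a \<and> E z c \<longrightarrow> E z y'" by (rule r2) (fact P n st ne)+
  have k7: "E z y' \<and> E z a \<longrightarrow> E z c" by (rule r2) (fact P n st ne)+
  have k8: "E z y' \<and> E z c \<longrightarrow> E z a" by (rule r2) (fact P n st ne)+
  have l0: "E z y \<and> \<not> E z a \<longrightarrow> E z b" by (rule r1) (fact P n e)+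
  have l1: "E z a \<and> \<not> E z v \<longrightarrow> E z y'" by (rule r1) (fact P n e)+
  have l2: "E z v \<and> \<not> E z a \<longrightarrow> E z y'" by (rule r1) (fact P n e)+
  have l3: "E z v \<and> \<not> E z b \<longrightarrow> E z y" by (rule r1) (fact P n e)+
  have l4: "E z b \<and> \<not> E z v \<longrightarrow> E z y" by (rule r1) (fact P n e)+
  have l5: "E z y' \<and> \<not> E z b \<longrightarrow> E z a" by (rule r1) (fact P n e)+
  have l6: "E z y \<and> \<not> E z a \<longrightarrow> E z c" by (rule r1) (fact P n e)+
  have l7: "E z y' \<and> \<not> E z b \<longrightarrow> E z c" by (rule r1) (fact P n e)+
  have l8: "E z a \<and> \<not> E z y \<longrightarrow> E z b" by (rule r1) (fact P n e)+
  have l9: "E z a \<and> \<not> E z y \<longrightarrow> E z c" by (rule r1) (fact P n e)+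
  have l10: "E z b \<and> \<not> E z y' \<longrightarrow> E z a" by (rule r1) (fact P n e)+
  have l11: "E z b \<and> \<not> E z y' \<longrightarrow> E z c" by (rule r1) (fact P n e)+
  have l12: "E z v \<and> \<not> E z c \<longrightarrow> E z y" by (rule r1) (fact P n e)+
  have l13: "E z c \<and> \<not> E z v \<longrightarrow> E z y" by (rule r1) (fact P n e)+
  have l14: "E z v \<and> \<not> E z c \<longrightarrow> E z y'" by (rule r1) (fact P n e)+
  have l15: "E z c \<and> \<not> E z v \<longrightarrow> E z y'" by (rule r1) (fact P n e)+
  have ba: "E z a \<and> E z c \<and> E z y' \<longrightarrow> E z v"
    using banner_freeD[OF banner, of z a v c y'] d e n st E_comm[of c z] by auto
  have all: "E z y \<longleftrightarrow> E z c" "E z a \<longleftrightarrow> E z c"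
    "E z v \<longleftrightarrow> E z c" "E z b \<longleftrightarrow> E z c"
    "E z y' \<longleftrightarrow> E z c"
    using ba k0 k1 k2 k3 k4 k5 k6 k7 k8
      l0 l1 l2 l3 l4 l5 l6 l7 l8 l9 l10 l11 l12 l13 l14 l15
    by argo+
  then show "E z q" using h by auto
qed

end

section \<open>Neighbourhoods containing a stable triple\<close>

context banner_graph begin

text \<open>Seeing exactly two vertices of the triple contradicts \<open>nonedge_dominates\<close>.
  Seeing only \<open>a\<close> leads to a path \<open>y a v b' y'\<close> with pendant
  \<open>c'\<close> at \<open>v\<close>, where the nonedge \<open>b' c'\<close> is split by
  \<open>y'\<close>. Connectedness of \<open>N v\<close> then yields a vertex that is a centre of
  this configuration or a twin of \<open>v\<close>, unless a bull or banner appears first.\<close>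

lemma stable_triple_hom:
  assumes conn: "conn E (N v)" and vy: "\<not> E v y"
    and st: "E v a" "E v b" "E v c" "\<not> E a b" "\<not> E a c" "\<not> E b c" "a \<noteq> b"
      "a \<noteq> c" "b \<noteq> c"
  shows "E y a \<longleftrightarrow> E y b"
proof -
  have one: False if st: "E v a" "E v b" "E v c" "\<not> E a b" "\<not> E a c" "\<not> E b c" "a \<noteq> b"
    "a \<noteq> c" "b \<noteq> c"
    and y: "E y a" "\<not> E y b" "\<not> E y c" for a b c
  proof -
    interpret co: finite_graph V "co V E" by (rule finite_graph_co)
    define B where "B = {t \<in> N v. \<not> E y t}"
    have BV: "B \<subseteq> V" using E_in2 by (auto simp: B_def)
    have inB: "E v t" "\<not> E y t" "t \<in> V" if "t \<in> B" for t using that E_in2 by (auto simp: B_def)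
    have "co V E b c" using st E_in2 by (auto simp: co_def)
    then have "conn (co V E) {b, c}" by (rule co.conn_pair)
    moreover have "{b, c} \<subseteq> B" using st y by (auto simp: B_def)
    ultimately obtain Q where Q: "{b, c} \<subseteq> Q" "Q \<subseteq> B" "conn (co V E) Q"
      and cocomp: "\<And>w x. w \<in> B \<Longrightarrow> w \<notin> Q \<Longrightarrow> x \<in> Q \<Longrightarrow> \<not> co V E x w"
      using co.component BV by (metis insert_not_empty)
    \<comment> \<open>Common neighbours of \<open>v\<close> and \<open>y\<close> cannot split a
      nonedge of \<open>B\<close>; in particular \<open>a\<close>, which misses \<open>b\<close>,
      misses all of \<open>Q\<close>.\<close>
    have homQ: "E x t" if x: "E v x" "E y x" and q: "s \<in> Q" "t \<in> Q" "E x s" for x s t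
    proof (rule ccontr)
      assume "\<not> E x t"
      then obtain r r' where r: "r \<in> Q" "r' \<in> Q" "co V E r r'" "E x r" "\<not> E x r'"
        using conn_pred_edge[OF Q(3) q(1,2), of "E x"] q by metis
      then show False
        using nonneighbour_hom[of v y x r r'] vy x inB[of r] inB[of r'] Q(2) by (auto simp: co_def)
    qed
    have "v \<notin> Q" "v \<in> V" using inB(1)[of v] Q(2) E_in[OF st(1)] by auto
    obtain y' b' c' where y': "y' \<in> V" "y' \<notin> Q" "c' \<in> Q" "b' \<in> Q" "co V E c' b'"
      "co V E y' c'" "\<not> co V E y' b'"
    proof (rule co.prime_mixed[OF prime_co[OF prime] Q(3), of b c])
      show "Q \<subseteq> V" using Q(2) BV by blast
      show "Q \<noteq> V" using \<open>v \<notin> Q\<close> \<open>v \<in> V\<close> by blast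
    qed (use Q(1) st that in auto)
    have bc: "E y' b'" "\<not> E y' c'" "\<not> E b' c'" "b' \<noteq> c'" using y' E_comm by
      (auto simp: co_def)
    have inb: "E v b'" "E v c'" "\<not> E y b'" "\<not> E y c'" using y' inB Q(2) by auto
    have vy': "\<not> E v y'"
    proof
      assume vy': "E v y'"
      show False
      proof (cases "E y y'")
        case True
        then show False using homQ[of y' b' c'] y' bc vy' by blast
      next
        case False
        then have "y' \<in> B" using vy' by (auto simp: B_def)
        then show False using cocomp[of y' c'] y' E_comm[of y' c'] by (auto simp: co_def)
      qed
    qed
    have aQ: "\<not> E a q" if "q \<in> Q" for q
      using homQ[of a q b] that st y Q(1) by auto
    have a: "\<not> E a b'" "\<not> E a c'" "a \<noteq> b'" "a \<noteq> c'" using aQ y' inb y by auto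
    have y'a: "\<not> E y' a"
      using nonedge_dominates[of v y' a b' c'] vy' st inb a bc E_comm by auto
    \<comment> \<open>The adjacencies required of the vertex in the role of \<open>a\<close>. Since
      \<open>b'\<close> violates them, some edge \<open>a' x\<close> of \<open>N v\<close> leaves
      this set.\<close>
    define A where "A x \<longleftrightarrow> E y x \<and> \<not> E y' x \<and> \<not> E x b' \<and> \<not> E x c'" for x
    have "A a" "\<not> A b'" using a y y'a inb by (auto simp: A_def)
    then obtain a' x where x: "E v a'" "E v x" "E a' x" "A a'" "\<not> A x"
      using conn_pred_edge[OF conn, of a b' A] st inb by (metis in_N)
    have a': "E y a'" "\<not> E y' a'" "\<not> E a' b'" "\<not> E a' c'" "a' \<noteq> b'" "a' \<noteq> c'"
      using x(4) inb by (auto simp: A_def)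
    have ne: "y' \<noteq> a'" "b' \<noteq> y" using a' bc vy vy' x inb E_comm by metis+
    note bn = banner_freeD[OF banner] and bl = bull_freeD[OF bull]
    show False
    proof (cases "E y x")
      case False
      have xb: "E x b'" "E x c'"
        using edge_dominates[of v y a' x b'] edge_dominates[of v y a' x c'] vy x a' inb False E_comm by auto
      show False
      proof (cases "E y' x")
        case True
        then show False
          using bl[of a' x v y y'] bn[of x a' y y' c'] xb False x a' inb bc vy vy' ne by (auto simp: E_comm)
      next
        case xy': False
        show False
          by (rule no_pendant_P5_twin[of a' b' c' y v y' x])
            (use xy' xb False x a' inb bc vy vy' E_comm in auto)
      qed
    next
      case yx: True
      have xbc: "E x b' \<longleftrightarrow> E x c'" using homQ[of x] x yx y' by blast
      show False
      proof (cases "E y' x")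
        case False
        then have "E x b'" "E x c'" using x(5) yx xbc by (auto simp: A_def)
        then show False
          using bl[of x b' v y y'] bn[of x b' y' y c'] yx False x inb bc vy vy' ne by (auto simp: E_comm)
      next
        case True
        have "E x c'" using edge_dominates[of v y' x a' c'] vy' True x a' inb bc E_comm by auto
        then have "E x b'" using xbc by blast
        show False
          by (rule no_pendant_P5_center[of a' b' c' y v y' x])
            (use yx True \<open>E x b'\<close> \<open>E x c'\<close> x a' inb bc vy vy' E_comm in auto)
      qed
    qed
  qed
  note R2 = nonedge_dominates[of v y]
  show ?thesis
    using one[of a b c] one[of b a c] R2[of a c b] R2[of b c a] vy st E_comm by auto
qed

text \<open>Otherwise the component, in the complement of \<^term>\<open>N v\<close>, of the stable triple would be
  homogeneous.\<close>

lemma claw_neighbourhood_stable: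
  assumes st: "E v a0" "E v b0" "E v c0" "\<not> E a0 b0" "\<not> E a0 c0" "\<not> E b0 c0" "a0 \<noteq> b0"
    "a0 \<noteq> c0" "b0 \<noteq> c0"
    and pq: "E v p" "E v q" "E p q"
  shows False
proof -
  interpret co: finite_graph V "co V E" by (rule finite_graph_co)
  note bn = banner_freeD[OF banner]
  have conn: "conn E (N v)" using neighbourhood_conn assms by blast
  have NV: "N v \<subseteq> V" using E_in2 by auto
  have "co V E a0 b0" using st E_in2 by (auto simp: co_def)
  then have "conn (co V E) {a0, b0}" by (rule co.conn_pair)
  moreover have "{a0, b0} \<subseteq> N v" using st by auto
  ultimately obtain Q where Q: "{a0, b0} \<subseteq> Q" "Q \<subseteq> N v" "conn (co V E) Q"
    and cocomp: "\<And>w x. w \<in> N v \<Longrightarrow> w \<notin> Q \<Longrightarrow> x \<in> Q \<Longrightarrow> \<not> co V E x w"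
    using co.component NV by (metis insert_not_empty)
  have "v \<notin> Q" "v \<in> V" using Q(2) st E_in by auto
  obtain y s t where y: "y \<in> V" "y \<notin> Q" "s \<in> Q" "t \<in> Q" "co V E s t" "co V E y s"
    "\<not> co V E y t"
  proof (rule co.prime_mixed[OF prime_co[OF prime] Q(3), of a0 b0])
    show "Q \<subseteq> V" using Q(2) NV by blast
    show "Q \<noteq> V" using \<open>v \<notin> Q\<close> \<open>v \<in> V\<close> by blast
  qed (use Q(1) st that in auto)
  have y': "\<not> E y s" "E y t" using y by (auto simp: co_def)
  have st': "E v s" "E v t" using y Q(2) by auto
  have vy: "\<not> E v y" using cocomp[of y s] y E_comm by (auto simp: co_def)
  \<comment> \<open>The stable triples in \<open>N v\<close>. The vertex \<open>y\<close> is
    constant on each of them; the goal is to carry this over to the nonedge \<open>s t\<close> of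
    \<open>Q\<close> that \<open>y\<close> splits.\<close>
  define tr where "tr a b c \<longleftrightarrow> E v a \<and> E v b \<and> E v c \<and> co V E a b \<and> co V E a c \<and> co V E b c" for a b c
  have tr_hom: "E y a \<longleftrightarrow> E y b" if "tr a b c" for a b c
    using stable_triple_hom[OF conn vy, of a b c] that by (auto simp: tr_def co_def)
  have tr_sym: "tr b a c" "tr a c b" if "tr a b c" for a b c
    using that co.E_comm by (auto simp: tr_def)
  have co: "co V E l a" if "E v l" "E v a" "l \<noteq> a" "\<not> E l a" for l a
    using that E_in2 by (auto simp: co_def)
  \<comment> \<open>A vertex \<open>l\<close> missing \<open>a\<close> may belong to the triple or
    complete another triple with \<open>a\<close>. Otherwise it sees both \<open>b\<close> and
    \<open>c\<close>, and a disagreement with the triple gives a banner or contradicts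
    \<open>nonneighbour_hom\<close>.\<close>
  have one: "E y l \<longleftrightarrow> E y a" if abc: "tr a b c" and l: "E v l" "co V E l a" for a b c l
  proof -
    have "tr l a b \<or> l = b \<or> E l b" "tr l a c \<or> l = c \<or> E l c"
      using co[of l b] co[of l c] abc l by (auto simp: tr_def co.E_comm)
    then consider "tr l a b" | "l = b" | "tr l a c" | "l = c" | "E l b" "E l c" by blast
    then show ?thesis
    proof cases
      case 5
      have n: "\<not> E a b" "\<not> E b c" "\<not> E a c" "b \<noteq> c" "E v a" "E v b" "E v c"
        "\<not> E l a"
        using abc l by (auto simp: tr_def co_def)
      have "E y a \<longleftrightarrow> E y b" "E y a \<longleftrightarrow> E y c" using tr_hom abc tr_sym
        by blast+
      then show ?thesis
        using bn[of y b l c a] nonneighbour_hom[of v y l b a] 5 n vy l by (auto simp: E_comm)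
    qed (use tr_hom tr_sym abc in blast)+
  qed
  have not_tr: "\<not> tr s b c" "\<not> tr t b c" for b c
    using one[of s b c t] one[of t b c s] y' y(5) st' co.E_comm by auto
  \<comment> \<open>If \<open>l'\<close> saw the whole triple, \<open>l' b l c\<close> would be a
    4-cycle with pendant \<open>a\<close> at \<open>l'\<close>.\<close>
  have two: "\<exists>x. co V E l' x \<and> (x = a \<or> x = b \<or> x = c)"
    if abc: "tr a b c" and l: "E v l" "co V E l a" "\<not> (\<exists>d e. tr l d e)"
      and l': "E v l'" "co V E l l'" "\<not> (\<exists>d e. tr l' d e)" for a b c l l'
  proof (rule ccontr)
    assume no: "\<not> ?thesis"
    have v: "E v a" "E v b" "E v c" and n: "\<not> E a b" "\<not> E b c" "\<not> E a c" "b \<noteq> c"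
      "\<not> E l a" "\<not> E l l'"
      using abc l l' by (auto simp: tr_def co_def)
    have "l \<noteq> b" "l \<noteq> c" "l' \<noteq> a" "l' \<noteq> b" "l' \<noteq> c"
      using abc tr_sym(1)[OF abc] tr_sym(1)[OF tr_sym(2)[OF abc]] l(3) l'(3) by auto
    then have "E l' a" "E l' b" "E l' c" using no co[of l'] l' v by blast+
    moreover have "E l b"
    proof (rule ccontr)
      assume "\<not> E l b"
      then have "tr l a b" using co[of l b] abc l(1,2) v \<open>l \<noteq> b\<close> by (simp add: tr_def)
      then show False using l(3) by blast
    qed
    moreover have "E l c"
    proof (rule ccontr)
      assume "\<not> E l c"
      then have "tr l a c" using co[of l c] abc l(1,2) v \<open>l \<noteq> c\<close> by (simp add: tr_def)
      then show False using l(3) by blast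
    qed
    ultimately show False using bn[of l' b l c a] n by (auto simp: E_comm)
  qed
  \<comment> \<open>\<open>P\<close> holds on triples and next to them in the complement. By
    \<open>two\<close> it spreads along the nonedges of \<open>Q\<close>, from \<open>a0\<close> to
    \<open>s\<close>.\<close>
  define P where "P x \<longleftrightarrow> (\<exists>b c. tr x b c) \<or> (\<exists>a b c. tr a b c \<and> co V E x a)" for x
  have "tr a0 b0 c0" using st co by (auto simp: tr_def)
  then have "P a0" by (auto simp: P_def)
  have "P s"
  proof (rule ccontr)
    assume "\<not> P s"
    then obtain l l' where l: "l \<in> Q" "l' \<in> Q" "co V E l l'" "P l" "\<not> P l'"
      using conn_pred_edge[OF Q(3) _ y(3), of a0 P] \<open>P a0\<close> Q(1) by (metis insert_subset)
    have "\<not> (\<exists>d e. tr l d e)" using l co.E_comm[of l l'] unfolding P_def by metis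
    moreover have "\<not> (\<exists>d e. tr l' d e)" using l by (auto simp: P_def)
    moreover obtain a b c where "tr a b c" "co V E l a" using l calculation by (auto simp: P_def)
    ultimately obtain x where "co V E l' x" "x = a \<or> x = b \<or> x = c"
      using two[of a b c l l'] l subsetD[OF Q(2), of l] subsetD[OF Q(2), of l'] by auto
    then have "P l'" using \<open>tr a b c\<close> tr_sym unfolding P_def by metis
    then show False using l by blast
  qed
  then obtain a b c where abc: "tr a b c" "co V E s a" using not_tr by (auto simp: P_def)
  then obtain x where x: "co V E t x" "x = a \<or> x = b \<or> x = c"
    using two[of a b c s t] not_tr st' y(5) by blast
  have "E y s \<longleftrightarrow> E y a" using one abc st' by blast
  moreover have "E y t \<longleftrightarrow> E y x" using one[of x] x abc st' tr_sym by metis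
  moreover have "E y x \<longleftrightarrow> E y a" using x abc tr_hom tr_sym by metis
  ultimately show False using y' by blast
qed

end

lemma prime_graphD:
  assumes "prime_graph V E" "X \<subseteq> V" "X \<noteq> V" "p \<in> X" "q \<in> X" "p \<noteq> q"
  obtains u a b where "u \<in> V" "u \<notin> X" "a \<in> X" "b \<in> X" "E u a" "\<not> E u b"
proof -
  have "(\<exists>x\<in>X. \<exists>y\<in>X. x \<noteq> y) \<and> X \<noteq> V" using assms by blast
  then have "\<exists>u\<in>V - X. \<exists>a\<in>X. \<exists>b\<in>X. E u a \<and> \<not> E u b"
    using assms(1,2) unfolding prime_graph_def by (elim allE[of _ X]) simp
  then show ?thesis using that by blast
qed

context banner_graph begin

text \<open>Without claws at \<open>w\<close>, its neighbours other than \<open>x\<close> form a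
  clique \<open>K\<close>. A vertex \<open>u\<close> splitting \<open>K\<close> sees
  \<open>x\<close> by a bull, and a third neighbour of \<open>x\<close> would give a banner or a
  claw. So \<open>u\<close> is the only splitter, and two elements of \<open>K\<close> that
  \<open>u\<close> does not distinguish would be homogeneous.\<close>

lemma triangle_free_vertex:
  assumes xw: "E x w" and x: "\<And>p q. E x p \<Longrightarrow> E x q \<Longrightarrow> \<not> E p q" and
    w: "E w p0" "E w q0" "E p0 q0"
  obtains u p q where "N w = {x, p, q}" "N x = {w, u}" "E p q" "E u p" "\<not> E u q" "u \<noteq> w"
    "\<not> E u w"
proof -
  note bn = banner_freeD[OF banner] and bl = bull_freeD[OF bull]
  have iso: "\<not> E x g" if "E w g" for g using x xw that E_comm by metis
  have noclaw: "\<not> (E z a \<and> E z b \<and> E z c \<and> \<not> E a b \<and> \<not> E a c \<and> \<not> E b c \<and> a \<noteq> b \<and> a \<noteq> c \<and> b \<noteq> c)"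
    if "E z d" "E z e" "E d e" for z a b c d e
    using claw_neighbourhood_stable that by blast
  define K where "K = {g. E w g \<and> g \<noteq> x}"
  have K: "E g h" if "g \<in> K" "h \<in> K" "g \<noteq> h" for g h
    using noclaw[OF w, of x g h] that iso[of g] iso[of h] xw E_comm by (auto simp: K_def)
  have KV: "K \<subseteq> V" using E_in2 by (auto simp: K_def)
  have tail: "E x u \<and> (\<forall>v. E x v \<longrightarrow> v = w \<or> v = u) \<and> \<not> E u w"
    if p: "p \<in> K" "q \<in> K" "E u p" "\<not> E u q" "u \<noteq> w" "u \<noteq> q" for u p q
  proof -
    have pq: "E w p" "E w q" "E p q" "\<not> E x p" "\<not> E x q"
      using K[of p q] p iso by (auto simp: K_def)
    then have "u \<noteq> x" using p by auto
    have uw: "\<not> E u w"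
      using K[of u q] p \<open>u \<noteq> x\<close> E_comm[of u w] by (auto simp: K_def)
    have xu: "E x u"
      using bl[of w p q x u] pq p uw xw by (auto simp: E_comm)
    have "v = w \<or> v = u" if v: "E x v" for v
    proof (rule ccontr)
      assume ne: "\<not> (v = w \<or> v = u)"
      have "\<not> E v w" "\<not> E v u" using x[OF v xw] x[OF v xu] by auto
      moreover from this have "E p v"
        using bn[of x w p u v] xw pq p xu uw v by (auto simp: E_comm)
      ultimately show False
        using noclaw[of p w q w u v] pq p uw ne by (auto simp: E_comm)
    qed
    then show ?thesis using xu uw by blast
  qed
  have "p0 \<noteq> x" "q0 \<noteq> x" using x[OF xw] w xw E_comm by metis+
  then have pq0: "p0 \<in> K" "q0 \<in> K" "p0 \<noteq> q0" using w by (auto simp: K_def)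
  have wV: "w \<in> V" "w \<notin> K" using xw E_in2 by (auto simp: K_def)
  then obtain u p q where u: "u \<in> V" "u \<notin> K" "p \<in> K" "q \<in> K" "E u p" "\<not> E u q"
    using prime_graphD[OF prime KV _ pq0] by metis
  have uw: "u \<noteq> w" using u by (auto simp: K_def)
  have xu: "E x u" "\<And>v. E x v \<Longrightarrow> v = w \<or> v = u" "\<not> E u w"
    using tail[OF u(3-6) uw] u by auto
  have single: "a = b" if ab: "a \<in> K" "b \<in> K" "E u a \<longleftrightarrow> E u b" for a b
  proof (rule ccontr)
    assume "a \<noteq> b"
    moreover have "{a, b} \<subseteq> V" "{a, b} \<noteq> V" using ab KV wV by auto
    ultimately obtain u' c d where u': "u' \<notin> {a, b}" "c \<in> {a, b}" "d \<in> {a, b}" "E u' c"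
      "\<not> E u' d"
      using prime_graphD[OF prime, of "{a, b}" a b] by (metis insertCI)
    then have "u' \<noteq> w" using ab by (auto simp: K_def)
    then have "E x u'" using tail[of c d u'] u' ab by auto
    then have "u' = u" using xu(2) \<open>u' \<noteq> w\<close> by blast
    then show False using u'(2-5) ab(3) by (metis insertE singletonD)
  qed
  show thesis
  proof
    show "N w = {x, p, q}"
    proof -
      have "g = p \<or> g = q" if "g \<in> K" for g using single[of g p] single[of g q] that u by blast
      then have "E w g \<longleftrightarrow> g = x \<or> g = p \<or> g = q" for g
        using u(3,4) xw E_comm[of x w] by (auto simp: K_def)
      then show ?thesis by (intro set_eqI) simp
    qed
    have "E x g \<longleftrightarrow> g = w \<or> g = u" for g using xu xw by blast
    then show "N x = {w, u}" by (intro set_eqI) simp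
    show "E p q" using K u by blast
  qed (use u uw xu in auto)
qed

text \<open>If some vertex lies in a triangle and some vertex does not, the graph turns out to be one of two
  graphs with at most six vertices.\<close>

lemma all_in_triangles:
  assumes V_conn: "conn E V" and tri: "E a b" "E a c" "E b c"
    and st: "co V E s1 s2" "co V E s1 s3" "co V E s2 s3" and "z \<in> V"
  shows "\<exists>p q. E z p \<and> E z q \<and> E p q"
proof (rule ccontr)
  assume no: "\<not> ?thesis"
  note bl = bull_freeD[OF bull]
  define T where "T y \<longleftrightarrow> (\<exists>p q. E y p \<and> E y q \<and> E p q)" for y
  have "T a" "\<not> T z" "a \<in> V" using tri no E_in by (auto simp: T_def)
  then obtain w x where wx: "E w x" "T w" "\<not> T x"
    using conn_pred_edge[OF V_conn \<open>a \<in> V\<close> \<open>z \<in> V\<close>, of T] by metis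
  have whole: "V \<subseteq> X" if X: "x \<in> X"
    "\<And>y g. y \<in> X \<Longrightarrow> E y g \<Longrightarrow> g \<in> X" for X
  proof
    fix v assume v: "v \<in> V"
    have "x \<in> V" using wx E_in2 by blast
    show "v \<in> X"
    proof (rule ccontr)
      assume "v \<notin> X"
      then obtain y g where "E y g" "y \<in> X" "g \<notin> X"
        using conn_pred_edge[OF V_conn \<open>x \<in> V\<close> v, of "\<lambda>v. v \<in> X"] X(1) by metis
      then show False using X(2) by blast
    qed
  qed
  have s: "\<not> E s1 s2" "\<not> E s1 s3" "\<not> E s2 s3" "s1 \<noteq> s2" "s1 \<noteq> s3"
    "s2 \<noteq> s3" "s1 \<in> V" "s2 \<in> V" "s3 \<in> V"
    using st by (auto simp: co_def)
  have key: "\<exists>u p q. N w = {x, p, q} \<and> N x = {w, u} \<and> E p q \<and> E u p \<and> \<not> E u q \<and> u \<noteq> w \<and> \<not> E u w"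
    if xw: "E x w" "T w" "\<not> T x" for x w
  proof -
    obtain p0 q0 where w: "E w p0" "E w q0" "E p0 q0" using xw by (auto simp: T_def)
    have "\<And>p q. E x p \<Longrightarrow> E x q \<Longrightarrow> \<not> E p q" using xw by
      (auto simp: T_def)
    from triangle_free_vertex[OF xw(1) this w] show ?thesis by metis
  qed
  obtain u p q where u: "N w = {x, p, q}" "N x = {w, u}" "E p q" "E u p" "\<not> E u q" "u \<noteq> w"
    "\<not> E u w"
    using key[of x w] wx E_comm[of x w] by blast
  have Nw: "E w g \<longleftrightarrow> g = x \<or> g = p \<or> g = q" for g using u(1) in_N[of g w] by auto
  have Nx: "E x g \<longleftrightarrow> g = w \<or> g = u" for g using u(2) in_N[of g x] by auto
  have xpq: "\<not> E x p" "\<not> E x q" using Nx[of p] Nx[of q] Nw[of u] u E_comm Nw[of w] by auto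
  show False
  proof (cases "T u")
    case False
    \<comment> \<open>Here \<open>u\<close> lies in no triangle either, and the whole graph becomes
      a house: the 4-cycle \<open>x w p u\<close> with roof \<open>q\<close>.\<close>
    have "T p" using Nw u(3) E_comm unfolding T_def by metis
    then obtain u2 p' q' where u2: "N p = {u, p', q'}" "N u = {p, u2}"
      using key[of u p] False u(4) by blast
    have "x \<in> N u" using Nx[of u] E_comm[of u x] by auto
    moreover have "x \<noteq> p" using xpq(2) u(3) by auto
    ultimately have "u2 = x" using u2(2) by auto
    then have Nu: "E u g \<longleftrightarrow> g = p \<or> g = x" for g using u2(2) in_N[of g u] by auto
    have "w \<in> N p" "q \<in> N p" "w \<noteq> q" "w \<noteq> u" "q \<noteq> u" using Nw[of p] Nw[of q] u
      E_comm Nw[of w] by auto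
    then have Np: "E p g \<longleftrightarrow> g = u \<or> g = w \<or> g = q" for g
      using u2(1) in_N[of g p] by (metis insert_iff singletonD)
    have Nq: "g = w \<or> g = p" if g: "E q g" for g
    proof (rule ccontr)
      assume n: "\<not> ?thesis"
      have "g \<noteq> u" "g \<noteq> q" using g u E_comm by auto
      then have "\<not> E p g" "\<not> E w g" "\<not> E g x" using n Np[of g] Nw[of g] Nx[of g] g xpq E_comm
        by metis+
      moreover have "E w p" "E w q" using Nw by auto
      ultimately show False using bl[of q w p g x] g u(3) xpq wx(1) by (auto simp: E_comm)
    qed
    have "V \<subseteq> {x, u, w, p, q}"
      by (rule whole) (use Nw Nx Nu Np Nq in \<open>blast+\<close>)
    then have m: "s1 \<in> {x, u, w, p, q}" "s2 \<in> {x, u, w, p, q}" "s3 \<in> {x, u, w, p, q}" using s by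
      auto
    have e: "E x w" "E x u" "E w p" "E w q" "E u p" "E p q" using Nw Nx Nu u(3) by simp_all
    then have "E w x" "E u x" "E p w" "E q w" "E p u" "E q p" by (simp_all only: E_comm)
    with e m s(1-6) show False by simp (elim disjE; simp)
  next
    case True
    \<comment> \<open>Now the whole graph becomes the 5-cycle \<open>x w q q' u\<close> together
      with \<open>p\<close>, which sees all of it but \<open>x\<close>.\<close>
    obtain u2 p' q' where u2: "N u = {x, p', q'}" "N x = {u, u2}" "E p' q'" "E u2 p'" "\<not> E u2 q'"
      "u2 \<noteq> u"
      using key[of x u] True wx(3) Nx[of u] by blast
    have "u2 = w" using Nx[of u2] u2 in_N[of u2 x] by auto
    have "p \<in> N u" "p \<noteq> x" "p \<noteq> q'" using u Nw[of p] u2(5) \<open>u2 = w\<close> xpq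
      E_comm by auto
    then have "p' = p" using u2(1) by auto
    then have q': "E p q'" "\<not> E w q'" "E u q'" using u2 \<open>u2 = w\<close> in_N[of q' u] by auto
    have Nu: "E u g \<longleftrightarrow> g = x \<or> g = p \<or> g = q'" for g using u2(1)
      \<open>p' = p\<close> in_N[of g u] by auto
    have ne: "q' \<noteq> q" "q' \<noteq> x" "\<not> E x q'" using q' Nw[of q] Nw[of x] Nx[of q'] u E_comm
      by auto
    have pw: "E p w" "E p u" "E w q" "E p q" "E w p" using Nw u E_comm by auto
    have Np: "g = w \<or> g = u \<or> g = q \<or> g = q'" if g: "E p g" for g
    proof (rule ccontr)
      assume n: "\<not> ?thesis"
      have "g \<noteq> x" "g \<noteq> p" using g xpq E_comm[of p x] by auto
      then show False
        using claw_neighbourhood_stable[of p w u g w q] Nw[of g] Nu[of g] pw u(6,7) g n E_comm[of w u] by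
          auto
    qed
    have qq: "E q q'"
      using bl[of p u q' q x] pw q' u xpq ne Nx[of u] by (auto simp: E_comm)
    have Nq: "g = w \<or> g = p \<or> g = q'" if g: "E q g" for g
    proof (rule ccontr)
      assume n: "\<not> ?thesis"
      have "g \<noteq> u" "g \<noteq> q" using g u E_comm by auto
      then have "\<not> E p g" "\<not> E w g" "\<not> E g x" using n Np[of g] Nw[of g] Nx[of g] g xpq E_comm
        by metis+
      then show False using bl[of q w p g x] g pw xpq wx(1) by (auto simp: E_comm)
    qed
    have Nq': "g = u \<or> g = p \<or> g = q" if g: "E q' g" for g
    proof (rule ccontr)
      assume n: "\<not> ?thesis"
      have "g \<noteq> w" "g \<noteq> q'" using g q' E_comm by auto
      then have "\<not> E p g" "\<not> E u g" "\<not> E g x" using n Np[of g] Nu[of g] Nx[of g] g ne E_comm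
        by metis+
      then show False using bl[of q' u p g x] g pw q' xpq ne Nx[of u] by (auto simp: E_comm)
    qed
    have "V \<subseteq> {x, u, w, p, q, q'}"
      by (rule whole) (use Nw Nx Nu Np Nq Nq' in \<open>blast+\<close>)
    then have m: "s1 \<in> {x, u, w, p, q, q'}" "s2 \<in> {x, u, w, p, q, q'}"
      "s3 \<in> {x, u, w, p, q, q'}"
      using s by auto
    have e: "E x w" "E x u" "E w p" "E w q" "E u p" "E p q" "E u q'" "E p q'" "E q q'"
      using Nw Nx Nu u(3) q' qq by simp_all
    then have "E w x" "E u x" "E p w" "E q w" "E p u" "E q p" "E q' u" "E q' p" "E q' q"
      by (simp_all only: E_comm)
    with e m s(1-6) show False by simp (elim disjE; simp)
  qed
qed

end

section \<open>Induced \<open>P5\<close> in prime claw-free and bull-free graphs\<close>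

locale claw_free_graph = prime_bull_free +
  assumes claw: "E v a \<Longrightarrow> E v b \<Longrightarrow> E v c \<Longrightarrow> a \<noteq> b \<Longrightarrow> a \<noteq> c \<Longrightarrow> b \<noteq> c \<Longrightarrow>
    \<not> E a b \<Longrightarrow> \<not> E a c \<Longrightarrow> \<not> E b c \<Longrightarrow> False"
begin

definition P5 :: "'a \<Rightarrow> 'a \<Rightarrow> 'a \<Rightarrow> 'a \<Rightarrow> 'a \<Rightarrow> bool" where
  "P5 a b c d e \<longleftrightarrow> E a b \<and> E b c \<and> E c d \<and> E d e \<and> a \<noteq> e \<and>
     \<not> E a c \<and> \<not> E a d \<and> \<not> E a e \<and> \<not> E b d \<and> \<not> E b e \<and>
       \<not> E c e"

lemma P5_rev: "P5 a b c d e \<Longrightarrow> P5 e d c b a"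
  unfolding P5_def by (auto simp: E_comm)

lemma P5_ne: "P5 a b c d e \<Longrightarrow> a \<noteq> c \<and> a \<noteq> d \<and> b \<noteq> d \<and> b \<noteq> e \<and> c \<noteq> e"
  unfolding P5_def by (auto simp: E_comm)

text \<open>A vertex \<open>u\<close> splitting the pair \<open>c\<close>, \<open>g\<close> is
  forced to see \<open>x\<close>, \<open>z\<close>, \<open>s\<close> and \<open>s'\<close>; then
  \<open>s\<close>, \<open>s'\<close> and the element \<open>a\<close> of the pair seen by
  \<open>u\<close> form a claw at \<open>u\<close>.\<close>

lemma P5_twin:
  assumes P5: "P5 s x c z s'" and g: "E g x" "E g c" "E g z" "\<not> E g s" "\<not> E g s'"
  shows False
proof -
  note bl = bull_freeD[OF bull]
  have p: "E s x" "E x c" "E c z" "E z s'" "s \<noteq> s'" "\<not> E s c" "\<not> E s z" "\<not> E s s'"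
    "\<not> E x z" "\<not> E x s'" "\<not> E c s'"
    using P5 by (auto simp: P5_def)
  have ne: "s \<noteq> c" "s \<noteq> z" "x \<noteq> z" "x \<noteq> s'" "c \<noteq> s'" "g \<noteq> s"
    "g \<noteq> s'" using P5_ne[OF P5] g p E_comm by auto
  have V: "{c, g} \<subseteq> V" "{c, g} \<noteq> V" "x \<in> V" using p g E_in E_in2 by auto
  then obtain u a b where u: "u \<notin> {c, g}" "a \<in> {c, g}" "b \<in> {c, g}" "E u a" "\<not> E u b"
    using prime_graphD[OF prime V(1,2), of c g] g(2) by (metis E_irr insertCI)
  have ab: "E a b" "E x a" "E x b" "E z a" "E z b" "\<not> E s a" "\<not> E s b" "\<not> E s' a"
    "\<not> E s' b"
    using u p g E_comm by auto
  have ne': "u \<noteq> x" "u \<noteq> z" "s \<noteq> a" "s' \<noteq> a" "s \<noteq> b" "s' \<noteq> b"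
    using u ab ne by auto
  have ux: "E u x"
  proof (rule ccontr)
    assume "\<not> E u x"
    have su: "E s u" using bl[of x a b s u] u ab p \<open>\<not> E u x\<close> by (auto simp: E_comm)
    have "E u z" using claw[of a u x z] u ab ne ne' p \<open>\<not> E u x\<close> by (auto simp: E_comm)
    then have "E u s'" using claw[of z u b s'] u ab p ne' ne by (auto simp: E_comm)
    then show False using claw[of u s s' a] su u ab p ne' by (auto simp: E_comm)
  qed
  have uz: "E u z"
  proof (rule ccontr)
    assume "\<not> E u z"
    have su: "E s' u" using bl[of z a b s' u] u ab p \<open>\<not> E u z\<close> by (auto simp: E_comm)
    have "E u s" using claw[of x u b s] ux u ab p ne' ne su by (auto simp: E_comm)
    then show False using claw[of u s s' a] su u ab p ne' by (auto simp: E_comm)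
  qed
  have "E u s" using claw[of x s b u] ux u ab p ne' by (auto simp: E_comm)
  moreover have "E u s'" using claw[of z s' b u] uz u ab p ne' by (auto simp: E_comm)
  ultimately show False using claw[of u s s' a] u ab p ne' by (auto simp: E_comm)
qed

text \<open>So \<open>g\<close> has the adjacencies of \<open>p2\<close> to the rest of the path and
  can replace it.\<close>

lemma P5_middle:
  assumes P5: "P5 p1 p2 p3 p4 p5" and g: "E g p3" "E g p2"
  shows "\<not> E g p4" "g \<noteq> p4 \<Longrightarrow> E g p1"
    "g \<noteq> p4 \<Longrightarrow> \<not> E g p5"
proof -
  note bl = bull_freeD[OF bull]
  have p: "E p1 p2" "E p2 p3" "E p3 p4" "E p4 p5" "p1 \<noteq> p5" "\<not> E p1 p3" "\<not> E p1 p4"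
    "\<not> E p1 p5" "\<not> E p2 p4"
     "\<not> E p2 p5" "\<not> E p3 p5"
    using P5 by (auto simp: P5_def)
  note ne = P5_ne[OF P5]
  show g4: "\<not> E g p4"
    using P5_twin[OF P5] bl[of g p4 p3 p1 p5] bl[of g p2 p3 p5 p1] claw[of g p1 p3 p5] p g ne
    by (auto simp: E_comm)
  show g1: "E g p1" if "g \<noteq> p4"
    using bl[of p2 p3 g p1 p4] p g ne g4 by (auto simp: E_comm)
  show "\<not> E g p5" if "g \<noteq> p4"
    using claw[of g p1 p3 p5] p g ne g1[OF that] by (auto simp: E_comm)
qed

lemma P5_replace:
  assumes P5: "P5 p1 p2 p3 p4 p5" and g: "E g p3" "E g p2"
  shows "P5 p1 g p3 p4 p5"
proof -
  have "g \<noteq> p4" using g P5 by (auto simp: P5_def E_comm)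
  then show ?thesis using P5_middle[OF assms] P5 g by (auto simp: P5_def E_comm)
qed

text \<open>A vertex \<open>u\<close> splitting the pair \<open>p2\<close>, \<open>g\<close> misses
  \<open>p3\<close>, hence sees \<open>p4\<close>, \<open>p5\<close> and \<open>p1\<close>; the
  triangle \<open>u p4 p5\<close> with pendants \<open>p1\<close>, \<open>p3\<close> is a
  bull.\<close>

lemma P5_no_side_twin:
  assumes P5: "P5 p1 p2 p3 p4 p5" and g: "E g p3" "E g p2"
  shows False
proof -
  note bl = bull_freeD[OF bull]
  have P: "P5 p1 a p3 p4 p5" if "a \<in> {p2, g}" for a using P5 P5_replace[OF assms] that by auto
  have V: "{p2, g} \<subseteq> V" "p3 \<in> V" "p3 \<notin> {p2, g}" "p2 \<noteq> g" using g P5 E_in E_in2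
    by (auto simp: P5_def)
  then have "{p2, g} \<noteq> V" by blast
  then obtain u a b where u: "u \<notin> {p2, g}" "a \<in> {p2, g}" "b \<in> {p2, g}" "E u a" "\<not> E u b"
    using prime_graphD[OF prime V(1), of p2 g] V(4) by blast
  have Pa: "P5 p1 a p3 p4 p5" and Pb: "P5 p1 b p3 p4 p5" using P u by auto
  have p: "E p1 a" "E a p3" "E p3 p4" "E p4 p5" "p1 \<noteq> p5" "\<not> E p1 p3" "\<not> E p1 p4"
    "\<not> E p1 p5" "\<not> E a p4"
     "\<not> E a p5" "\<not> E p3 p5" "E p1 b" "E b p3" "\<not> E b p4" "\<not> E b p5"
    using Pa Pb by (auto simp: P5_def)
  note ne = P5_ne[OF Pa]
  have ab: "E a b" using u g E_comm by auto
  have u3: "\<not> E u p3"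
  proof
    assume u3: "E u p3"
    then have "\<not> E u p4" using P5_middle(1)[OF Pa u3] u by blast
    moreover have "u \<noteq> p4" using u p E_comm by auto
    moreover have "u \<noteq> b" using u by auto
    ultimately show False using claw[of p3 b p4 u] p u u3 P5_ne[OF Pb] by (auto simp: E_comm)
  qed
  have "u \<noteq> p3" "u \<noteq> p5" "u \<noteq> p1" using u p E_comm by auto
  have u4: "E u p4" using bl[of a p3 b u p4] u3 u p ab by (auto simp: E_comm)
  then have u5: "E u p5" using claw[of p4 u p3 p5] u3 p ne \<open>u \<noteq> p3\<close>
    \<open>u \<noteq> p5\<close> by (auto simp: E_comm)
  have "E u p1" using claw[of a u p3 p1] u3 u p ne \<open>u \<noteq> p3\<close> \<open>u \<noteq> p1\<close>
    u4 by (auto simp: E_comm)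
  then show False using bl[of u p4 p5 p1 p3] u3 u4 u5 p by (auto simp: E_comm)
qed

text \<open>By claw-freeness a third neighbour of \<open>p3\<close> would see \<open>p2\<close> or
  \<open>p4\<close>, a side twin of the path or of its reverse. So only the nonadjacent
  \<open>p2\<close>, \<open>p4\<close> are neighbours of \<open>p3\<close>.\<close>

lemma P5_middle_not_in_triangle:
  assumes P5: "P5 p1 p2 p3 p4 p5" and g: "E p3 g" "E p3 h" "E g h"
  shows False
proof -
  have p: "E p3 p2" "E p3 p4" "\<not> E p2 p4" "p2 \<noteq> p4" using P5 P5_ne[OF P5] E_comm by
    (auto simp: P5_def)
  have no: "x = p2 \<or> x = p4" if "E p3 x" for x
    using claw[of p3 p2 p4 x] P5_no_side_twin[OF P5, of x] P5_no_side_twin[OF P5_rev[OF P5], of x] p that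
    by (auto simp: E_comm)
  show False using no[of g] no[of h] g p E_comm by auto
qed

text \<open>Enlarge the triple to a maximal stable set \<open>S\<close>. It dominates the graph, and
  no vertex sees three of its elements; connectedness then provides edges between vertices attached
  to different elements.\<close>

lemma stable_triple_P5:
  assumes V_conn: "conn E V"
    and st: "co V E t1 t2" "co V E t1 t3" "co V E t2 t3"
  shows "\<exists>a b c d e. P5 a b c d e"
proof (rule ccontr)
  assume no: "\<not> ?thesis"
  note bl = bull_freeD[OF bull]
  define stab where "stab S \<longleftrightarrow> S \<subseteq> V \<and> (\<forall>s\<in>S. \<forall>t\<in>S. \<not> E s t)" for S
  have "stab {t1, t2, t3}" using st E_comm by (auto simp: stab_def co_def)
  moreover have "finite {S. stab S}" by (rule finite_subset[of _ "Pow V"])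
    (use fin in \<open>auto simp: stab_def\<close>)
  ultimately obtain S where S: "stab S" "{t1, t2, t3} \<subseteq> S" and max:
    "\<And>S'. stab S' \<Longrightarrow> S \<subseteq> S' \<Longrightarrow> S' = S"
    using finite_has_maximal2[of "{S. stab S}" "{t1, t2, t3}"] by auto
  have Sn: "\<not> E s t" if "s \<in> S" "t \<in> S" for s t using S that by (auto simp: stab_def)
  have SV: "S \<subseteq> V" using S by (auto simp: stab_def)
  have dom: "\<exists>s\<in>S. E v s" if "v \<in> V" "v \<notin> S" for v
  proof (rule ccontr)
    assume "\<not> ?thesis"
    then have "stab (insert v S)" using S that E_comm by (auto simp: stab_def)
    then show False using max that by blast
  qed
  have "t1 \<in> S" "t2 \<in> S" "t3 \<in> S" "t1 \<noteq> t2" "t1 \<noteq> t3" "t2 \<noteq> t3" using S(2)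
    st by (auto simp: co_def)
  then have third: "\<exists>s\<in>S. s \<noteq> a \<and> s \<noteq> b" for a b by metis
  have claw3: False if "s \<in> S" "s' \<in> S" "s'' \<in> S" "E v s" "E v s'" "E v s''" "s \<noteq> s'"
    "s \<noteq> s''" "s' \<noteq> s''" for v s s' s''
    using claw[of v s s' s''] Sn that by blast
  have meet: False if s: "s \<in> S" "s' \<in> S" "s'' \<in> S" "s \<noteq> s'" "s \<noteq> s''"
    "s' \<noteq> s''"
    and x: "E x s" "E x s'" "E z s'" "E z s''" for x z s s' s''
  proof -
    have "\<not> E x s''" "\<not> E z s" using claw3 s x by blast+
    note n = this Sn[of s s'] Sn[of s s''] Sn[of s' s'']
    show False
    proof (cases "E x z")
      case True
      then show False using bl[of x z s' s s''] n x s by (auto simp: E_comm)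
    next
      case False
      then have "P5 s x s' z s''" using n x s by (auto simp: P5_def E_comm)
      then show False using no by blast
    qed
  qed
  show False
  proof (cases "\<exists>x. \<exists>s1\<in>S. \<exists>s2\<in>S. s1 \<noteq> s2 \<and> E x s1 \<and> E x s2")
    case True
    then obtain x s1 s2 where x: "s1 \<in> S" "s2 \<in> S" "s1 \<noteq> s2" "E x s1" "E x s2" by blast
    \<comment> \<open>\<open>Q\<close> marks the vertices attached to no element of \<open>S\<close>
      besides \<open>s1\<close>, \<open>s2\<close>. An edge \<open>u w\<close> leaving it, prolonged
      to \<open>s\<close> on one side and through \<open>x\<close> on the other, gives the
      \<open>P5\<close>.\<close>
    define Q where "Q u \<longleftrightarrow> (\<forall>s\<in>S. u = s \<or> E u s \<longrightarrow> s = s1 \<or> s = s2)" for u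
    have "Q s1" using Sn x by (auto simp: Q_def)
    obtain s3 where s3: "s3 \<in> S" "s3 \<noteq> s1" "s3 \<noteq> s2" using third by blast
    then have "\<not> Q s3" by (auto simp: Q_def)
    then obtain u w where uw: "u \<in> V" "w \<in> V" "E u w" "Q u" "\<not> Q w"
      using conn_pred_edge[OF V_conn, of s1 s3 Q] \<open>Q s1\<close> x(1) s3(1) SV by (metis subsetD)
    then obtain s where s: "s \<in> S" "w = s \<or> E w s" "s \<noteq> s1" "s \<noteq> s2" by
      (auto simp: Q_def)
    have "w \<noteq> s" using uw s by (auto simp: Q_def)
    then have ws: "E w s" using s by blast
    have us: "\<not> E u s" "u \<noteq> s" using uw(4) s by (auto simp: Q_def)
    have w12: "\<not> E w s1" "\<not> E w s2" using meet[of s2 s1 s x w] meet[of s1 s2 s x w] x s ws by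
      blast+
    have "u \<notin> S" using uw(3,4) w12 E_comm[of u w] by (auto simp: Q_def)
    then obtain t where t: "t \<in> S" "E u t" using dom uw by blast
    have main: False if x: "s1 \<in> S" "s2 \<in> S" "s1 \<noteq> s2" "E x s1" "E x s2" and s:
      "s \<noteq> s1" "s \<noteq> s2"
      and w: "\<not> E w s1" "\<not> E w s2" and u1: "E u s1" for s1 s2
    proof -
      have n: "\<not> E s s1" "\<not> E s s2" "\<not> E s1 s2" "\<not> E x s" "w \<noteq> s1"
        "w \<noteq> s2" "s \<noteq> x" "u \<noteq> x"
        using Sn[of s s1] Sn[of s s2] Sn[of s1 s2] claw3[of s s1 s2 x] x s \<open>s \<in> S\<close> ws
          E_comm Sn
          claw[of u s1 s2 w] uw(3) w by metis+
      have u2: "\<not> E u s2" using claw[of u s1 s2 w] uw(3) w n u1 x by (auto simp: E_comm)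
      have xw: "\<not> E x w" using claw[of x s1 s2 w] w n x by (auto simp: E_comm)
      show False
      proof (cases "E u x")
        case True
        then have "P5 s w u x s2" using n u2 xw ws us uw(3) w x s by (auto simp: P5_def E_comm)
        then show ?thesis using no by blast
      next
        case False
        then have "P5 s w u s1 x" using n u2 xw ws us uw(3) w x s u1 by (auto simp: P5_def E_comm)
        then show ?thesis using no by blast
      qed
    qed
    have "t = s1 \<or> t = s2" using t uw(4) by (auto simp: Q_def)
    then show False
      using main[of s1 s2] main[of s2 s1] x s w12 t(2) by blast
  next
    case False
    then have uni: "s = s'" if "s \<in> S" "s' \<in> S" "E v s" "E v s'" for v s s' using that by blast
    \<comment> \<open>Stars around three elements of \<open>S\<close>, with cross edges
      \<open>p1 p2\<close> and \<open>u w\<close> both ending at the middle star, contain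
      \<open>s1 p1 p2 u w\<close> or \<open>s1 p1 p2 s2 u\<close> as \<open>P5\<close>.\<close>
    have claim: False if s: "s1 \<in> S" "s2 \<in> S" "s3 \<in> S" "s1 \<noteq> s2" "s1 \<noteq> s3"
      "s2 \<noteq> s3"
      and p: "E p1 s1" "E p2 s2" "E p1 p2" "E u s2" "E w s3" "E u w" for s1 s2 s3 p1 p2 u w
    proof -
      have n: "\<not> E s1 s2" "\<not> E s1 s3" "\<not> E s2 s3" "\<not> E p1 s2" "\<not> E p1 s3"
        "\<not> E p2 s1" "\<not> E p2 s3" "\<not> E u s1" "\<not> E u s3"
        "\<not> E w s1" "\<not> E w s2" using s p Sn uni by blast+
      have base: False if "E v s2" "E p1 v" "E v w" for v
        using bl[of p1 v w s1 s2] claw[of v s2 p1 w] that n p s uni[of s1 s2 v] uni[of s3 s2 v] E_comm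
        by (metis E_irr)
      have a: "\<not> E p1 u" "\<not> E p2 w" using base[of u] base[of p2] p by blast+
      have b: "\<not> E p1 w" using claw[of p1 s1 p2 w] a n p s E_comm by (metis E_irr)
      show False
      proof (cases "E p2 u")
        case True
        then have "P5 s1 p1 p2 u w" using a b n p s by (auto simp: P5_def E_comm)
        then show ?thesis using no by blast
      next
        case False
        then have "P5 s1 p1 p2 s2 u" using a b n p s by (auto simp: P5_def E_comm)
        then show ?thesis using no by blast
      qed
    qed
    define Q where "Q s u \<longleftrightarrow> u = s \<or> E u s" for s u
    have att: "w \<notin> S \<and> u \<notin> S" if "s \<in> S" "E u w" "Q s u" "\<not> Q s w" for s u w
      using that uni[of w s u] uni[of _ _ w] Sn E_comm unfolding Q_def by metis
    have t1: "t1 \<in> S" "t2 \<in> S" "t1 \<noteq> t2" using S(2) st by (auto simp: co_def)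
    have "Q t1 t1" "\<not> Q t1 t2" using t1 Sn[of t2 t1] by (auto simp: Q_def)
    then obtain p1 p2 where p: "p2 \<in> V" "E p1 p2" "Q t1 p1" "\<not> Q t1 p2"
      using conn_pred_edge[OF V_conn, of t1 t2 "Q t1"] t1 SV by (metis subsetD)
    then have "p2 \<notin> S" "p1 \<notin> S" using att[of t1 p1 p2] t1 by blast+
    then obtain s2 where s2: "s2 \<in> S" "E p2 s2" using dom p by blast
    have "s2 \<noteq> t1" using s2 p by (auto simp: Q_def)
    have p1: "E p1 t1" using p t1 \<open>p1 \<notin> S\<close> by (auto simp: Q_def)
    obtain s3 where s3: "s3 \<in> S" "s3 \<noteq> t1" "s3 \<noteq> s2" using third by blast
    define R where "R u \<longleftrightarrow> Q t1 u \<or> Q s2 u" for u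
    have "R t1" "\<not> R s3" using s3 Sn t1 s2 by (auto simp: R_def Q_def)
    then obtain u w where u: "w \<in> V" "E u w" "R u" "\<not> R w"
      using conn_pred_edge[OF V_conn, of t1 s3 R] t1 s3 SV by (metis subsetD)
    then have "w \<notin> S" "u \<notin> S" using att[of t1 u w] att[of s2 u w] t1 s2 by (auto simp: R_def)
    then obtain s where s: "s \<in> S" "E w s" using dom u by blast
    have "s \<noteq> t1" "s \<noteq> s2" using s u by (auto simp: R_def Q_def)
    have "E u t1 \<or> E u s2" using u \<open>u \<notin> S\<close> t1 s2 by (auto simp: R_def Q_def)
    then show False
      using claim[of t1 s2 s p1 p2 u w] claim[of s2 t1 s p2 p1 u w] t1 s2 s p1 p u(2)
        \<open>s2 \<noteq> t1\<close>
        \<open>s \<noteq> t1\<close> \<open>s \<noteq> s2\<close> E_comm[of p1 p2] by metis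
  qed
qed

end

lemma (in banner_graph) triangle_stable_False:
  assumes tri: "E a b" "E a c" "E b c"
    and st: "co V E s1 s2" "co V E s1 s3" "co V E s2 s3"
  shows False
proof -
  have V_conn: "conn E V"
  proof (rule prime_conn[OF prime])
    show "a \<in> V" "b \<in> V" "c \<in> V" "a \<noteq> b" "a \<noteq> c" "b \<noteq> c" using tri E_in
      E_in2 by auto
  qed
  note all = all_in_triangles[OF V_conn tri st]
  interpret claw_free_graph V E
  proof unfold_locales
    fix v a b c
    assume h: "E v a" "E v b" "E v c" "a \<noteq> b" "a \<noteq> c" "b \<noteq> c" "\<not> E a b"
      "\<not> E a c" "\<not> E b c"
    then obtain p q where "E v p" "E v q" "E p q" using all E_in by blast
    then show False using claw_neighbourhood_stable h by blast
  qed
  obtain p1 p2 p3 p4 p5 where P: "P5 p1 p2 p3 p4 p5" using stable_triple_P5[OF V_conn st] by blast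
  then have "p3 \<in> V" using E_in by (auto simp: P5_def)
  then show False using all P5_middle_not_in_triangle[OF P] by blast
qed

section \<open>Diamond-free graphs\<close>

definition diamond_free :: "('a \<Rightarrow> 'a \<Rightarrow> bool) \<Rightarrow> bool" where
  "diamond_free E \<longleftrightarrow> \<not> (\<exists>a b c d. E a c \<and> E a d \<and> E b c \<and> E b d \<and> E c d \<and> a \<noteq> b \<and> \<not> E a b)"

definition clique :: "('a \<Rightarrow> 'a \<Rightarrow> bool) \<Rightarrow> 'a set \<Rightarrow> bool" where
  "clique E K \<longleftrightarrow> (\<forall>u\<in>K. \<forall>v\<in>K. u \<noteq> v \<longrightarrow> E u v)"

definition max_clique ::
  "('a \<Rightarrow> 'a \<Rightarrow> bool) \<Rightarrow> 'a set \<Rightarrow> 'a set \<Rightarrow> bool" where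
  "max_clique E S K \<longleftrightarrow> K \<subseteq> S \<and> clique E K \<and> (\<forall>v\<in>S - K. \<exists>c\<in>K. \<not> E v c)"

lemma diamond_freeD:
  "diamond_free E \<Longrightarrow> E a c \<Longrightarrow> E a d \<Longrightarrow> E b c \<Longrightarrow> E b d \<Longrightarrow> E c d \<Longrightarrow> a \<noteq> b \<Longrightarrow> E a b"
  unfolding diamond_free_def by blast

lemma cliqueD: "clique E K \<Longrightarrow> u \<in> K \<Longrightarrow> v \<in> K \<Longrightarrow> u \<noteq> v \<Longrightarrow> E u v"
  unfolding clique_def by blast

lemma clique_subset: "clique E K \<Longrightarrow> K' \<subseteq> K \<Longrightarrow> clique E K'"
  unfolding clique_def by blast

context finite_graph begin

lemma clique_insert: "clique E K \<Longrightarrow> (\<And>u. u \<in> K \<Longrightarrow> E v u) \<Longrightarrow> clique E (insert v K)"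
  unfolding clique_def using E_sym by blast

lemma ex_max_clique:
  assumes "clique E K" "K \<subseteq> S" "S \<subseteq> V"
  obtains K' where "K \<subseteq> K'" "max_clique E S K'"
proof -
  let ?F = "{K. K \<subseteq> S \<and> clique E K}"
  have "finite S" using assms(3) fin finite_subset by blast
  then have "finite ?F" by (intro finite_subset[of ?F "Pow S"]) auto
  then obtain K' where K': "K' \<in> ?F" "K \<subseteq> K'"
    "\<And>L. L \<in> ?F \<Longrightarrow> K' \<subseteq> L \<Longrightarrow> K' = L"
    using finite_has_maximal2[of ?F K] assms by auto
  have "\<exists>c\<in>K'. \<not> E v c" if "v \<in> S - K'" for v
  proof (rule ccontr)
    assume "\<not> ?thesis"
    then have "insert v K' \<in> ?F" using K'(1) that clique_insert by auto
    then show False using K'(3) that by blast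
  qed
  then have "max_clique E S K'" using K'(1) by (auto simp: max_clique_def)
  then show ?thesis using that K'(2) by blast
qed

end

locale diamond_graph = prime_bull_free +
  assumes diamond: "diamond_free E"
begin

text \<open>Maximality gives some \<open>c\<close> in \<open>K\<close> missed by \<open>v\<close>;
  with two neighbours of \<open>v\<close> in \<open>K\<close> this is a diamond.\<close>

lemma outside_unique:
  assumes K: "max_clique E V K" and v: "v \<notin> K" "a \<in> K" "b \<in> K" "E v a" "E v b"
  shows "a = b"
proof (rule ccontr)
  assume ab: "a \<noteq> b"
  obtain c where c: "c \<in> K" "\<not> E v c" using K v E_in[of v a] unfolding max_clique_def by blast
  have "E a b" "E c a" "E c b" using K v c ab by (auto simp: max_clique_def clique_def)
  then show False using diamond_freeD[OF diamond, of v a b c] v c by auto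
qed

text \<open>The third vertex \<open>c\<close> is needed to complete the triangle of a bull with
  pendants \<open>v\<close> and \<open>w\<close>.\<close>

lemma outside_joined:
  assumes K: "max_clique E V K" and abc: "a \<in> K" "b \<in> K" "c \<in> K" "a \<noteq> b" "a \<noteq> c"
    "b \<noteq> c"
    and v: "v \<notin> K" "w \<notin> K" "E a v" "E b w"
  shows "E v w"
proof (rule ccontr)
  assume "\<not> E v w"
  moreover have "\<not> E b v" "\<not> E c v" "\<not> E a w" "\<not> E c w"
    using outside_unique[OF K v(1), of a] outside_unique[OF K v(2), of b] abc v E_comm by blast+
  moreover have "E a b" "E a c" "E b c" using K abc by (auto simp: max_clique_def clique_def)
  ultimately show False using bull_freeD[OF bull, of a b c v w] v by blast
qed

lemma triangle_stable_False:
  assumes tri: "E p q" "E p r" "E q r"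
    and no_simplicial: "\<And>s. s \<in> V \<Longrightarrow> \<not> clique E (N s)"
    and st: "co V E s1 s2" "co V E s1 s3" "co V E s2 s3"
  shows False
proof -
  have V_conn: "conn E V"
  proof (rule prime_conn[OF prime])
    show "p \<in> V" "q \<in> V" "r \<in> V" "p \<noteq> q" "p \<noteq> r" "q \<noteq> r" using tri E_in
      E_in2 by auto
  qed
  have ex_out: "\<exists>h. h \<notin> K \<and> E a h" if "max_clique E V K" "a \<in> K" for K a
  proof (rule ccontr)
    assume "\<not> ?thesis"
    then have "N a \<subseteq> K" by auto
    then show False using no_simplicial[of a] clique_subset[of E K "N a"] that by
      (auto simp: max_clique_def)
  qed
  have "clique E {p, q, r}" "{p, q, r} \<subseteq> V"
    using tri E_in E_in2 by (auto simp: clique_def E_comm[of q p] E_comm[of r p] E_comm[of r q])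
  then obtain K where pqr: "{p, q, r} \<subseteq> K" and K: "max_clique E V K"
    using ex_max_clique[of "{p, q, r}" V] by (metis subset_refl)
  have dist: "p \<noteq> q" "p \<noteq> r" "q \<noteq> r" using tri by auto
  have others: "\<exists>b c. b \<in> K \<and> c \<in> K \<and> a \<noteq> b \<and> a \<noteq> c \<and> b \<noteq> c" for a
    using pqr dist by (metis insert_subset)
  have third: "\<exists>c\<in>K. a \<noteq> c \<and> b \<noteq> c" for a b
    using pqr dist by (metis insert_subset)
  have joined: "E v w" if "a \<in> K" "b \<in> K" "a \<noteq> b" "v \<notin> K" "w \<notin> K" "E a v"
    "E b w" for a b v w
    using outside_joined[OF K] third[of a b] that by blast
  \<comment> \<open>Both \<open>v\<close> and \<open>w\<close> see the edge \<open>b' c'\<close>, so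
    they are adjacent; then \<open>a\<close> and \<open>b'\<close> both see the edge
    \<open>v w\<close>, so they would be adjacent too.\<close>
  have uniq: "v = w" if a: "a \<in> K" "v \<notin> K" "w \<notin> K" "E a v" "E a w" for a v w
  proof (rule ccontr)
    assume vw: "v \<noteq> w"
    obtain b c where bc: "b \<in> K" "c \<in> K" "a \<noteq> b" "a \<noteq> c" "b \<noteq> c" using others
      by blast
    obtain b' c' where b': "b' \<notin> K" "E b b'" and c': "c' \<notin> K" "E c c'" using ex_out[OF K] bc
      by blast
    have j: "E v b'" "E w b'" "E v c'" "E w c'" "E b' c'" using joined bc b' c' a by blast+
    have "\<not> E a b'" using outside_unique[OF K b'(1) a(1) bc(1)] b' bc E_comm by blast
    have "E v w" using diamond_freeD[OF diamond j(1,3,2,4,5) vw] .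
    then have "E a b'" using diamond_freeD[OF diamond, of a v w b'] a j b' E_comm by blast
    then show False using \<open>\<not> E a b'\<close> by blast
  qed
  define X where "X v \<longleftrightarrow> v \<in> K \<or> (\<exists>a\<in>K. E a v)" for v
  \<comment> \<open>Suppose \<open>g\<close> is at distance two from \<open>K\<close>. If it sees an
    outer vertex \<open>d'\<close> besides \<open>y\<close>, apply \<open>outside_joined\<close> to
    a maximal clique containing \<open>y\<close>, \<open>d'\<close>, \<open>g\<close>: an outside
    neighbour \<open>h\<close> of \<open>g\<close> sees \<open>a\<close> and \<open>d\<close>, so it
    lies in \<open>K\<close>, which \<open>g\<close> misses. If it sees neither \<open>b'\<close>
    nor \<open>c'\<close>, the triangle \<open>y b' c'\<close> with pendants \<open>g\<close>,
    \<open>b\<close> is a bull.\<close>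
  have closed: "X g" if y: "X y" "E y g" for y g
  proof (rule ccontr)
    assume g: "\<not> X g"
    then have gK: "g \<notin> K" "\<And>a. a \<in> K \<Longrightarrow> \<not> E a g" by (auto simp: X_def)
    then have "y \<notin> K" using y by blast
    then obtain a where a: "a \<in> K" "E a y" using y by (auto simp: X_def)
    obtain b c where bc: "b \<in> K" "c \<in> K" "a \<noteq> b" "a \<noteq> c" "b \<noteq> c" using others
      by blast
    obtain b' c' where b': "b' \<notin> K" "E b b'" and c': "c' \<notin> K" "E c c'" using ex_out[OF K] bc
      by blast
    have j: "E y b'" "E y c'" "E b' c'" using joined bc b' c' a \<open>y \<notin> K\<close> by blast+
    have no: False if d: "d \<in> K" "a \<noteq> d" "d' \<notin> K" "E d d'" "E y d'" "E g d'" for d d'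
    proof -
      have "clique E {y, d', g}" "{y, d', g} \<subseteq> V"
        using d y E_in E_in2 by (auto simp: clique_def E_comm[of d' y] E_comm[of g y] E_comm[of d' g])
      then obtain L where L: "{y, d', g} \<subseteq> L" "max_clique E V L"
        using ex_max_clique[of "{y, d', g}" V] by (metis subset_refl)
      then obtain h where h: "h \<notin> L" "E g h" using ex_out[of L g] by blast
      have ne: "y \<noteq> d'" "y \<noteq> g" "d' \<noteq> g" using y d by auto
      have nad: "\<not> E a d'" "\<not> E d y"
        using outside_unique[OF K d(3) a(1) d(1)] outside_unique[OF K \<open>y \<notin> K\<close> a(1) d(1)]
          d a E_comm by blast+
      have "a \<notin> L" "d \<notin> L" using L nad a d gK ne unfolding max_clique_def clique_def by
        (metis insert_subset)+
      have "E h a"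
        using outside_joined[OF L(2), of g y d' h a] L(1) h a ne \<open>a \<notin> L\<close> E_comm by auto
      moreover have "E h d"
        using outside_joined[OF L(2), of g d' y h d] L(1) h d ne \<open>d \<notin> L\<close> E_comm by auto
      ultimately have "h \<in> K" using outside_unique[OF K _ a(1) d(1), of h] d(2) by blast
      then show False using gK(2) h E_comm by blast
    qed
    have "\<not> E g b'" "\<not> E g c'" using no[of b b'] no[of c c'] bc b' c' j by blast+
    moreover have "\<not> E b y" "\<not> E b c'"
      using outside_unique[OF K \<open>y \<notin> K\<close> a(1) bc(1)] outside_unique[OF K c'(1) bc(2,1)] a
        c' bc E_comm by blast+
    ultimately show False using bull_freeD[OF bull, of y b' c' g b] j b' y gK(2)[OF bc(1)] E_comm by metis
  qed
  have all: "X v" if v: "v \<in> V" for v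
  proof (rule ccontr)
    assume "\<not> X v"
    moreover have "X p" "p \<in> V" using pqr tri E_in by (auto simp: X_def)
    ultimately obtain y g where "E y g" "X y" "\<not> X g" using conn_pred_edge[OF V_conn _ v, of p X] by
      metis
    then show False using closed by blast
  qed
  \<comment> \<open>The vertices outside \<open>K\<close> form a clique as well, so two cliques
    cover \<open>V\<close>.\<close>
  have sep: "s \<in> K \<or> t \<in> K" if "co V E s t" for s t
  proof (rule ccontr)
    assume n: "\<not> ?thesis"
    moreover have "s \<in> V" "t \<in> V" using that by (auto simp: co_def)
    ultimately obtain a b where ab: "a \<in> K" "E a s" "b \<in> K" "E b t" using all[of s] all[of t] by
      (auto simp: X_def)
    then show False using joined[of a b s t] uniq[of a s t] n that by (auto simp: co_def)
  qed
  have "\<not> (s \<in> K \<and> t \<in> K)" if "co V E s t" for s t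
    using K that by (auto simp: max_clique_def clique_def co_def)
  then show False using sep st by blast
qed

end

section \<open>Perfection under substitution\<close>

definition clique_num :: "('a \<Rightarrow> 'a \<Rightarrow> bool) \<Rightarrow> 'a set \<Rightarrow> nat"
  where
  "clique_num E T = Max {card K | K. K \<subseteq> T \<and> clique E K}"

definition colors :: "('a \<Rightarrow> 'a \<Rightarrow> bool) \<Rightarrow> 'a set \<Rightarrow> nat \<Rightarrow> ('a \<Rightarrow> nat) \<Rightarrow> bool" where
  "colors E T k c \<longleftrightarrow> (\<forall>v\<in>T. c v < k) \<and> (\<forall>u\<in>T. \<forall>v\<in>T. E u v \<longrightarrow> c u \<noteq> c v)"

text \<open>Only \<chi> \<le> \<omega> is demanded; the converse inequality is
  \<open>colors_card\<close>.\<close>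

definition perfect_on :: "('a \<Rightarrow> 'a \<Rightarrow> bool) \<Rightarrow> 'a set \<Rightarrow> bool" where
  "perfect_on E S \<longleftrightarrow> (\<forall>T\<subseteq>S. \<exists>c. colors E T (clique_num E T) c)"

lemma clique_num_finite:
  assumes "finite T"
  shows "finite {card K | K. K \<subseteq> T \<and> clique E K}"
    "{card K | K. K \<subseteq> T \<and> clique E K} \<noteq> {}"
proof -
  have "{card K | K. K \<subseteq> T \<and> clique E K} \<subseteq> card ` Pow T" by auto
  then show "finite {card K | K. K \<subseteq> T \<and> clique E K}" using assms finite_subset by blast
  have "clique E {}" by (simp add: clique_def)
  then show "{card K | K. K \<subseteq> T \<and> clique E K} \<noteq> {}" by blast
qed

lemma clique_num_ge: "finite T \<Longrightarrow> K \<subseteq> T \<Longrightarrow> clique E K \<Longrightarrow> card K \<le> clique_num E T"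
  unfolding clique_num_def by (rule Max_ge[OF clique_num_finite(1)]) auto

lemma clique_num_clique:
  assumes "finite T"
  obtains K where "K \<subseteq> T" "clique E K" "card K = clique_num E T"
  using Max_in[OF clique_num_finite[OF assms, of E]] unfolding clique_num_def by auto

lemma clique_num_mono:
  assumes "finite T" "T' \<subseteq> T"
  shows "clique_num E T' \<le> clique_num E T"
proof -
  obtain K where K: "K \<subseteq> T'" "clique E K" "card K = clique_num E T'"
    using clique_num_clique[OF finite_subset[OF assms(2,1)]] .
  show ?thesis using clique_num_ge[OF assms(1) subset_trans[OF K(1) assms(2)] K(2)] K(3) by simp
qed

lemma colors_clique_inj:
  "colors E T k c \<Longrightarrow> K \<subseteq> T \<Longrightarrow> clique E K \<Longrightarrow> inj_on c K"
  unfolding colors_def clique_def inj_on_def by blast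

lemma colors_card:
  assumes "colors E T k c" "K \<subseteq> T" "clique E K"
  shows "card K \<le> k"
proof -
  have "c ` K \<subseteq> {..<k}" using assms by (auto simp: colors_def)
  then have "card (c ` K) \<le> k" using card_mono[of "{..<k}"] by fastforce
  then show ?thesis using card_image[OF colors_clique_inj[OF assms]] by simp
qed

lemma perfect_on_empty: "perfect_on E {}"
  by (simp add: perfect_on_def colors_def)

context finite_graph begin

lemma colors_insert:
  assumes c: "colors E T k c" and k: "k \<le> k'" "i < k'" and s: "s \<notin> T"
    "\<And>v. v \<in> T \<Longrightarrow> E s v \<Longrightarrow> c v \<noteq> i"
  shows "colors E (insert s T) k' (c(s := i))"
  unfolding colors_def
proof (intro conjI ballI impI)
  fix v assume "v \<in> insert s T"
  then show "(c(s := i)) v < k'" using c k by (auto simp: colors_def)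
next
  fix u v assume uv: "u \<in> insert s T" "v \<in> insert s T" "E u v"
  then have "u \<noteq> s \<or> v \<noteq> s" by auto
  then show "(c(s := i)) u \<noteq> (c(s := i)) v"
    using uv c s(2)[of u] s(2)[of v] E_comm[of u s] by (auto simp: colors_def)
qed

text \<open>The neighbours of \<open>s\<close> in \<open>T\<close> form a clique with
  \<open>s\<close>, so they use fewer than \<open>clique_num E T\<close> colours and one is free for
  \<open>s\<close>.\<close>

lemma perfect_on_simplicial:
  assumes P: "perfect_on E S" "S \<subseteq> V" "s \<in> V" and cl: "clique E {x \<in> S. E s x}"
  shows "perfect_on E (insert s S)"
  unfolding perfect_on_def
proof (intro allI impI)
  fix T assume T: "T \<subseteq> insert s S"
  show "\<exists>c. colors E T (clique_num E T) c"
  proof (cases "T \<subseteq> S")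
    case True
    then show ?thesis using P(1) by (auto simp: perfect_on_def)
  next
    case False
    then have "s \<in> T" using T by auto
    have finT: "finite T" using T P fin by (auto intro: finite_subset[of T V])
    obtain c where c: "colors E (T - {s}) (clique_num E (T - {s})) c"
      using P(1) T unfolding perfect_on_def by (metis Diff_subset_conv insert_is_Un)
    define K where "K = {x \<in> T - {s}. E s x}"
    have "K \<subseteq> {x \<in> S. E s x}" using T by (auto simp: K_def)
    then have "clique E K" by (rule clique_subset[OF cl])
    then have "clique E (insert s K)" by (rule clique_insert) (simp add: K_def)
    moreover have "insert s K \<subseteq> T" using \<open>s \<in> T\<close> by (auto simp: K_def)
    ultimately have "card (insert s K) \<le> clique_num E T" using clique_num_ge finT by blast
    moreover have "finite K" "s \<notin> K" using finT by (auto simp: K_def)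
    ultimately have "card (c ` K) < clique_num E T" using card_image_le[of K c] by simp
    then have "\<not> {..<clique_num E T} \<subseteq> c ` K" using
      card_mono[of "c ` K" "{..<clique_num E T}"] \<open>finite K\<close> by auto
    then obtain i where i: "i < clique_num E T" "i \<notin> c ` K" by auto
    have "clique_num E (T - {s}) \<le> clique_num E T" using clique_num_mono finT by blast
    then have "colors E (insert s (T - {s})) (clique_num E T) (c(s := i))"
      by (rule colors_insert[OF c]) (use i in \<open>auto simp: K_def\<close>)
    then have "colors E T (clique_num E T) (c(s := i))" using \<open>s \<in> T\<close> by
      (simp add: insert_absorb)
    then show ?thesis by blast
  qed
qed

lemma perfect_on_clique:
  assumes "clique E K" "K \<subseteq> V"
  shows "perfect_on E K"
proof -
  have "finite K" using assms fin finite_subset by blast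
  then show ?thesis using assms
  proof (induction K)
    case (insert s K)
    have "clique E K" "K \<subseteq> V" using insert clique_subset[of E "insert s K" K] by auto
    then show ?case
      using insert perfect_on_simplicial[of K s] clique_subset[of E K "{x \<in> K. E s x}"] by auto
  qed (simp add: perfect_on_empty)
qed

lemma perfect_on_swap:
  assumes P: "perfect_on E (insert w S)" and S: "S \<subseteq> V" "w \<in> V" "w \<notin> S" "w' \<notin> S"
    "w' \<in> V"
    and twin: "\<And>s. s \<in> S \<Longrightarrow> E w s \<longleftrightarrow> E w' s"
  shows "perfect_on E (insert w' S)"
  unfolding perfect_on_def
proof (intro allI impI)
  fix T assume T: "T \<subseteq> insert w' S"
  define f where "f v = (if v = w' then w else v)" for v
  have inj: "inj_on f T" using T S by (auto simp: inj_on_def f_def)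
  have fE: "E (f u) (f v) \<longleftrightarrow> E u v" if "u \<in> T" "v \<in> T" for u v
    using that T twin E_comm S by (auto simp: f_def)
  have fT: "f ` T \<subseteq> insert w S" using T by (auto simp: f_def)
  then have "finite (f ` T)" using S fin by (auto intro: finite_subset[of _ V])
  then obtain K where K: "K \<subseteq> f ` T" "clique E K" "card K = clique_num E (f ` T)" using
    clique_num_clique by blast
  obtain L where L: "L \<subseteq> T" "K = f ` L" using K(1) by (auto simp: subset_image_iff)
  have "clique E L" unfolding clique_def
  proof (intro ballI impI)
    fix u v assume uv: "u \<in> L" "v \<in> L" "u \<noteq> v"
    then have "f u \<noteq> f v" using inj L by (auto dest: inj_onD)
    then show "E u v" using cliqueD[OF K(2), of "f u" "f v"] fE[of u v] uv L by auto
  qed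
  moreover have "card L = card K" using L card_image[OF inj_on_subset[OF inj L(1)]] by simp
  moreover have "finite T" using T S fin by (auto intro: finite_subset[of _ V])
  ultimately have le: "clique_num E (f ` T) \<le> clique_num E T" using clique_num_ge[OF _ L(1)] K(3) by
    fastforce
  obtain c where c: "colors E (f ` T) (clique_num E (f ` T)) c" using P fT by (auto simp: perfect_on_def)
  have "colors E T (clique_num E T) (c \<circ> f)"
    unfolding colors_def
  proof (intro conjI ballI impI)
    fix v assume "v \<in> T"
    then show "(c \<circ> f) v < clique_num E T" using c le by (fastforce simp: colors_def)
  next
    fix u v assume "u \<in> T" "v \<in> T" "E u v"
    then show "(c \<circ> f) u \<noteq> (c \<circ> f) v" using c fE[of u v] by (auto simp: colors_def)
  qed
  then show "\<exists>c. colors E T (clique_num E T) c" by blast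
qed

text \<open>Lovasz's replication lemma.  If no maximum clique of the old graph contains \<open>w\<close>, deleting the
  colour class of \<open>w\<close> except \<open>w\<close> itself lowers the clique number; \<open>w'\<close> then joins the deleted
  vertices in one new colour class.\<close>

lemma perfect_on_replicate:
  assumes P: "perfect_on E (insert w S)" and S: "S \<subseteq> V" "w \<notin> S" "w' \<notin> S" "E w w'"
    and twin: "\<And>s. s \<in> S \<Longrightarrow> E w s \<longleftrightarrow> E w' s"
  shows "perfect_on E (insert w' (insert w S))"
  unfolding perfect_on_def
proof (intro allI impI)
  fix T assume T: "T \<subseteq> insert w' (insert w S)"
  have wV: "w \<in> V" "w' \<in> V" "w \<noteq> w'" using S E_in E_in2 by auto
  have P': "perfect_on E (insert w' S)" using perfect_on_swap[OF P S(1) _ S(2,3)] wV twin by blast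
  show "\<exists>c. colors E T (clique_num E T) c"
  proof (cases "w \<in> T \<and> w' \<in> T")
    case False
    then have "T \<subseteq> insert w S \<or> T \<subseteq> insert w' S" using T by auto
    then show ?thesis using P P' by (auto simp: perfect_on_def)
  next
    case True
    define T0 where "T0 = T - {w'}"
    have T0: "T = insert w' T0" "w' \<notin> T0" "w \<in> T0" "T0 \<subseteq> insert w S" using True T wV by
      (auto simp: T0_def)
    have finT: "finite T" "finite T0" using T S wV fin by (auto simp: T0_def intro: finite_subset[of _ V])
    obtain c where c: "colors E T0 (clique_num E T0) c" using P T0 by (auto simp: perfect_on_def)
    have tw: "E w' v \<longleftrightarrow> E w v" if "v \<in> T0" "v \<noteq> w" for v using that T0 twin by
      auto
    show ?thesis
    proof (cases "\<exists>K\<subseteq>T0. clique E K \<and> card K = clique_num E T0 \<and> w \<in> K")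
      \<comment> \<open>Adding \<open>w'\<close> to this maximum clique raises the clique number, so
        \<open>w'\<close> may receive a new colour.\<close>
      case True
      then obtain K where K: "K \<subseteq> T0" "clique E K" "card K = clique_num E T0" "w \<in> K" by blast
      have "E w' u" if "u \<in> K" for u
        using tw[of u] cliqueD[OF K(2) K(4) that] S(4) E_comm[of w w'] K(1) that by (cases "u = w") auto
      then have "clique E (insert w' K)" using clique_insert K by blast
      moreover have "insert w' K \<subseteq> T" using K T0 by auto
      ultimately have "card (insert w' K) \<le> clique_num E T" using clique_num_ge finT by blast
      moreover have "card (insert w' K) = Suc (clique_num E T0)"
        using K T0 finT by (metis card_insert_disjoint finite_subset subsetD)
      ultimately have "clique_num E T0 < clique_num E T" by simp
      then have "colors E T (clique_num E T) (c(w' := clique_num E T0))"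
        unfolding T0(1) by (intro colors_insert[OF c]) (use T0 c in \<open>auto simp: colors_def\<close>)
      then show ?thesis by blast
    next
      case no: False
      define C where "C = {v \<in> T0. c v = c w \<and> v \<noteq> w}"
      have "clique_num E (T0 - C) < clique_num E T0"
      proof -
        obtain K where K: "K \<subseteq> T0 - C" "clique E K" "card K = clique_num E (T0 - C)"
          using clique_num_clique[of "T0 - C" E] finT by blast
        have "card K \<noteq> clique_num E T0"
        proof
          assume eq: "card K = clique_num E T0"
          have "w \<notin> K" using no K eq by auto
          then have "c ` K \<subseteq> {..<clique_num E T0} - {c w}"
            using K(1) c T0(3) by (auto simp: C_def colors_def)
          moreover have "card (c ` K) = clique_num E T0"
            using card_image[OF colors_clique_inj[OF c _ K(2)]] K(1) eq by auto
          moreover have "c w < clique_num E T0" using c T0(3) by (auto simp: colors_def)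
          ultimately show False
            using card_mono[of "{..<clique_num E T0} - {c w}" "c ` K"] by simp
        qed
        then show ?thesis using K(3) clique_num_mono[of T0 "T0 - C" E] finT by fastforce
      qed
      moreover have "clique_num E T0 \<le> clique_num E T" using clique_num_mono[of T T0] finT T0 by auto
      ultimately have lt: "clique_num E (T0 - C) < clique_num E T" by simp
      obtain d where d: "colors E (T0 - C) (clique_num E (T0 - C)) d"
        using P T0(4) unfolding perfect_on_def by (metis Diff_subset subset_trans)
      define c' where "c' v = (if v = w' \<or> v \<in> C then clique_num E (T0 - C) else d v)" for v
      have cne: "c u \<noteq> c v" if "u \<in> T0" "v \<in> T0" "E u v" for u v using c that by
        (auto simp: colors_def)
      have C: "v \<in> T0" "c v = c w" "v \<noteq> w" if "v \<in> C" for v using that by (auto simp: C_def)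
      have n1: "\<not> E w' v" if "v \<in> C" for v using tw[of v] cne[of w v] C[OF that] T0(3) by auto
      have n2: "\<not> E u v" if "u \<in> C" "v \<in> C" for u v using cne[of u v] C[OF that(1)]
        C[OF that(2)] by auto
      have dlt: "d x < clique_num E (T0 - C)" if "x \<in> T" "\<not> (x = w' \<or> x \<in> C)" for x
        using d T0(1) that by (auto simp: colors_def)
      have "colors E T (clique_num E T) c'"
        unfolding colors_def
      proof (intro conjI ballI impI)
        fix v assume "v \<in> T"
        then show "c' v < clique_num E T" using dlt[of v] lt unfolding c'_def by
          (cases "v = w' \<or> v \<in> C") auto
      next
        fix u v assume uv: "u \<in> T" "v \<in> T" "E u v"
        have "\<not> ((u = w' \<or> u \<in> C) \<and> (v = w' \<or> v \<in> C))"
          using uv(3) E_sym[OF uv(3)] n1[of u] n1[of v] n2[of u v] by auto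
        moreover have "d u \<noteq> d v" if "\<not> (u = w' \<or> u \<in> C)"
          "\<not> (v = w' \<or> v \<in> C)"
          using d T0(1) that uv by (auto simp: colors_def)
        ultimately show "c' u \<noteq> c' v" using uv dlt[of u] dlt[of v] unfolding c'_def by auto
      qed
      then show ?thesis by blast
    qed
  qed
qed

lemma perfect_on_blowup_clique:
  assumes P: "perfect_on E (insert w S)" and S: "S \<subseteq> V"
    and W: "W \<subseteq> V" "W \<inter> S = {}" "w \<in> W" "clique E W"
    and hom: "\<And>s u v. s \<in> S \<Longrightarrow> u \<in> W \<Longrightarrow> v \<in> W \<Longrightarrow> E u s \<Longrightarrow> E v s"
  shows "perfect_on E (S \<union> W)"
proof -
  have "finite (W - {w})" using W fin finite_subset by blast
  moreover have "W - {w} \<subseteq> W - {w}" by blast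
  ultimately have "perfect_on E (insert w (S \<union> (W - {w})))"
  proof (induction rule: finite_subset_induct')
    case empty
    then show ?case using P by simp
  next
    case (insert w' F)
    have "perfect_on E (insert w' (insert w (S \<union> F)))"
    proof (rule perfect_on_replicate[OF insert.IH])
      show "E w w'" using insert.hyps W(3) cliqueD[OF W(4), of w w'] by auto
      fix s assume s: "s \<in> S \<union> F"
      show "E w s \<longleftrightarrow> E w' s"
      proof (cases "s \<in> S")
        case True
        then show ?thesis using hom[of s w w'] hom[of s w' w] insert.hyps W(3) by blast
      next
        case False
        then have "s \<in> W" "s \<noteq> w" "s \<noteq> w'" "w' \<in> W" using s insert.hyps by auto
        then show ?thesis using cliqueD[OF W(4)] W(3) by blast
      qed
    qed (use insert W S in auto)
    then show ?case by (simp add: insert_commute)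
  qed
  moreover have "insert w (S \<union> (W - {w})) = S \<union> W" using W by auto
  ultimately show ?thesis by simp
qed

text \<open>Replace \<open>T \<inter> X\<close> by a maximum clique \<open>W\<close> of it; what
  results is coloured optimally thanks to replication. An optimal colouring of
  \<open>T \<inter> X\<close> has exactly as many colours as \<open>W\<close> has vertices, so it
  can be renamed, by \<open>g\<close>, to the colours of \<open>W\<close>. An outside vertex seeing
  any element of \<open>X\<close> sees all of \<open>W\<close>, so no conflict arises.\<close>

lemma perfect_on_substitute:
  assumes P: "perfect_on E (insert x S)" "perfect_on E X" and S: "S \<subseteq> V" "X \<subseteq> V"
    "x \<in> V" "x \<notin> S" "X \<inter> S = {}"
    and hom: "\<And>s u v. s \<in> S \<Longrightarrow> u \<in> insert x X \<Longrightarrow> v \<in> insert x X \<Longrightarrow> E u s \<Longrightarrow> E v s"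
  shows "perfect_on E (S \<union> X)"
  unfolding perfect_on_def
proof (intro allI impI)
  fix T assume T: "T \<subseteq> S \<union> X"
  have finT: "finite T" using T S fin by (auto intro: finite_subset[of _ V])
  define Y where "Y = T \<inter> X"
  obtain W where W: "W \<subseteq> Y" "clique E W" "card W = clique_num E Y" using clique_num_clique[of Y E]
    finT by (auto simp: Y_def)
  show "\<exists>c. colors E T (clique_num E T) c"
  proof (cases "Y = {}")
    case True
    then have "T \<subseteq> insert x S" using T by (auto simp: Y_def)
    then show ?thesis using P by (auto simp: perfect_on_def)
  next
    case False
    then obtain y where y: "y \<in> Y" by blast
    have "card {y} \<le> clique_num E Y" by (rule clique_num_ge)
      (use finT y in \<open>auto simp: Y_def clique_def\<close>)
    then have "W \<noteq> {}" using W(3) by auto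
    then obtain w where w: "w \<in> W" by blast
    have finW: "finite W" using W finT by (auto simp: Y_def intro: finite_subset)
    have WX: "W \<subseteq> X" "w \<in> X" using W w by (auto simp: Y_def)
    have "perfect_on E (insert w S)"
    proof (rule perfect_on_swap[OF P(1)])
      show "\<And>s. s \<in> S \<Longrightarrow> E x s \<longleftrightarrow> E w s" using hom WX by blast
    qed (use S WX in auto)
    then have "perfect_on E (S \<union> W)"
    proof (rule perfect_on_blowup_clique)
      show "E v s" if "s \<in> S" "u \<in> W" "v \<in> W" "E u s" for s u v using hom[of s u v] that WX by
        blast
    qed (use S WX W w in auto)
    moreover define T1 where "T1 = (T - Y) \<union> W"
    ultimately have "\<exists>c. colors E T1 (clique_num E T1) c"
      using T unfolding perfect_on_def by (elim allE[of _ T1]) (auto simp: Y_def)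
    then obtain c where c: "colors E T1 (clique_num E T1) c" by blast
    have "T1 \<subseteq> T" using W by (auto simp: T1_def Y_def)
    then have le: "clique_num E T1 \<le> clique_num E T" using clique_num_mono finT by blast
    obtain d where d: "colors E Y (clique_num E Y) d" using P(2) unfolding perfect_on_def Y_def by
      (meson inf_le2)
    have "W \<subseteq> T1" by (auto simp: T1_def)
    then have "card (c ` W) = clique_num E Y" using card_image[OF colors_clique_inj[OF c _ W(2)]] W by simp
    then obtain g where g: "bij_betw g {..<clique_num E Y} (c ` W)"
      using finW by (metis card_lessThan finite_imageI finite_lessThan finite_same_card_bij)
    define c' where "c' v = (if v \<in> Y then g (d v) else c v)" for v
    have gW: "\<exists>w\<in>W. g (d v) = c w" if "v \<in> Y" for v
    proof -
      have "d v \<in> {..<clique_num E Y}" using d that by (auto simp: colors_def)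
      then show ?thesis using g by (auto simp: bij_betw_def)
    qed
    have cross: "c' u \<noteq> c' v" if uv: "u \<in> Y" "v \<in> T - Y" "E u v" for u v
    proof -
      obtain w where w: "w \<in> W" "g (d u) = c w" using gW uv by blast
      have "v \<in> S" using uv T by (auto simp: Y_def)
      then have "E w v" using hom[of v u w] uv w WX by (auto simp: Y_def)
      then have "c w \<noteq> c v" using c w uv by (auto simp: colors_def T1_def)
      then show ?thesis using uv w by (simp add: c'_def)
    qed
    have "colors E T (clique_num E T) c'"
      unfolding colors_def
    proof (intro conjI ballI impI)
      fix v assume v: "v \<in> T"
      have "c' v < clique_num E T1"
      proof (cases "v \<in> Y")
        case True
        then obtain w where "w \<in> W" "g (d v) = c w" using gW by blast
        then show ?thesis using True c \<open>W \<subseteq> T1\<close> by (auto simp: c'_def colors_def)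
      qed (use v c in \<open>auto simp: c'_def colors_def T1_def\<close>)
      then show "c' v < clique_num E T" using le by simp
    next
      fix u v assume uv: "u \<in> T" "v \<in> T" "E u v"
      consider "u \<in> Y" "v \<in> Y" | "u \<in> Y" "v \<notin> Y" | "u \<notin> Y" "v \<in> Y" |
        "u \<notin> Y" "v \<notin> Y" by blast
      then show "c' u \<noteq> c' v"
      proof cases
        case 1
        then have "d u \<noteq> d v" "d u < clique_num E Y" "d v < clique_num E Y" using d uv by
          (auto simp: colors_def)
        then show ?thesis using g 1 by (auto simp: c'_def bij_betw_def dest: inj_onD)
      next
        case 2
        then show ?thesis using cross uv by blast
      next
        case 3
        then show ?thesis using cross[of v u] uv E_comm by fastforce
      next
        case 4
        then show ?thesis using c uv by (auto simp: c'_def colors_def T1_def)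
      qed
    qed
    then show ?thesis by blast
  qed
qed

end

section \<open>Transversals of maximal cliques\<close>

text \<open>On the empty vertex set the empty clique is maximal and no transversal exists; hence the
  nonemptiness conditions below.\<close>

definition transversal :: "('a \<Rightarrow> 'a \<Rightarrow> bool) \<Rightarrow> 'a set \<Rightarrow> bool" where
  "transversal E S \<longleftrightarrow> (\<exists>P\<subseteq>S. perfect_on E P \<and> (\<forall>K. max_clique E S K \<longrightarrow> K \<inter> P \<noteq> {}))"

definition restrict ::
  "'a set \<Rightarrow> ('a \<Rightarrow> 'a \<Rightarrow> bool) \<Rightarrow> 'a \<Rightarrow> 'a \<Rightarrow> bool" where
  "restrict S E x y \<longleftrightarrow> x \<in> S \<and> y \<in> S \<and> E x y"

context finite_graph begin

lemma finite_graph_restrict: "S \<subseteq> V \<Longrightarrow> finite_graph S (restrict S E)"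
  using fin E_sym by unfold_locales (auto simp: restrict_def intro: finite_subset)

text \<open>\<open>x\<close> represents the module \<open>X\<close> in the quotient. A transversal
  \<open>P\<close> of the quotient is kept if it avoids \<open>x\<close>; otherwise \<open>x\<close>
  is replaced in it by a transversal of \<open>X\<close>.\<close>

lemma transversal_substitute:
  assumes S: "S \<subseteq> V" "X \<subseteq> S" "x \<in> X"
    and hom: "\<And>s u v. s \<in> S - X \<Longrightarrow> u \<in> X \<Longrightarrow> v \<in> X \<Longrightarrow> E u s \<Longrightarrow> E v s"
    and tr: "transversal E (insert x (S - X))" "transversal E X"
  shows "transversal E S"
proof -
  obtain P where P: "P \<subseteq> insert x (S - X)" "perfect_on E P"
    and hit: "\<And>K. max_clique E (insert x (S - X)) K \<Longrightarrow> K \<inter> P \<noteq> {}"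
    using tr(1) unfolding transversal_def by blast
  obtain P' where P': "P' \<subseteq> X" "perfect_on E P'" and hit':
    "\<And>K. max_clique E X K \<Longrightarrow> K \<inter> P' \<noteq> {}"
    using tr(2) unfolding transversal_def by blast
  have outside: "max_clique E (insert x (S - X)) K" if K: "max_clique E S K" "K \<inter> X = {}" for K
  proof -
    have "\<exists>c\<in>K. \<not> E v c" if "v \<in> insert x (S - X) - K" for v
      using K that S unfolding max_clique_def by blast
    then show ?thesis using K by (auto simp: max_clique_def)
  qed
  have inside: "max_clique E X (K \<inter> X)" "max_clique E (insert x (S - X)) (insert x (K - X))"
    if K: "max_clique E S K" "K \<inter> X \<noteq> {}" for K
  proof -
    obtain k where k: "k \<in> K" "k \<in> X" using K by blast
    have KX: "E z c" if "z \<in> X" "c \<in> K - X" for z c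
      using hom[of c k z] k that K(1) cliqueD[of E K k c] by (auto simp: max_clique_def)
    have clK: "clique E K" "K \<subseteq> S" using K by (auto simp: max_clique_def)
    have "\<exists>c\<in>K \<inter> X. \<not> E v c" if "v \<in> X - K \<inter> X" for v
    proof -
      have "v \<in> S - K" using that S(2) by blast
      then obtain c where "c \<in> K" "\<not> E v c" using K(1) unfolding max_clique_def by meson
      then show ?thesis using KX that by blast
    qed
    then show "max_clique E X (K \<inter> X)"
      using clique_subset[OF clK(1), of "K \<inter> X"] by (auto simp: max_clique_def)
    have "\<exists>c\<in>insert x (K - X). \<not> E v c" if v: "v \<in> insert x (S - X) - insert x (K - X)"
      for v
    proof -
      have "v \<in> S - K" using v S by blast
      then obtain c where c: "c \<in> K" "\<not> E v c" using K(1) unfolding max_clique_def by meson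
      show ?thesis
      proof (cases "c \<in> X")
        case True
        then have "\<not> E v x" using hom[of v x c] v c S(3) E_comm[of v x] E_comm[of v c] by blast
        then show ?thesis by blast
      qed (use c in blast)
    qed
    moreover have "clique E (insert x (K - X))"
      using KX S(3) clique_subset[OF clK(1), of "K - X"] by (intro clique_insert) auto
    ultimately show "max_clique E (insert x (S - X)) (insert x (K - X))"
      using clK(2) by (auto simp: max_clique_def)
  qed
  show ?thesis
  proof (cases "x \<in> P")
    case False
    have "K \<inter> P \<noteq> {}" if K: "max_clique E S K" for K
    proof (cases "K \<inter> X = {}")
      case True
      then show ?thesis using hit outside K by blast
    next
      case F: False
      then show ?thesis using hit[OF inside(2)[OF K F]] False by blast
    qed
    moreover have "P \<subseteq> S" using P S by auto
    ultimately show ?thesis using P unfolding transversal_def by blast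
  next
    case True
    define Q where "Q = (P - {x}) \<union> P'"
    have "perfect_on E Q"
      unfolding Q_def
    proof (rule perfect_on_substitute)
      show "perfect_on E (insert x (P - {x}))" using P(2) True by (simp add: insert_absorb)
      show "E v s" if "s \<in> P - {x}" "u \<in> insert x P'" "v \<in> insert x P'" "E u s" for s u v
        using hom[of s u v] that P P' S(3) by blast
    qed (use P P' S in auto)
    moreover have "K \<inter> Q \<noteq> {}" if K: "max_clique E S K" for K
    proof (cases "K \<inter> X = {}")
      case T: True
      then have "K \<inter> P \<noteq> {}" "x \<notin> K" using hit outside K S(3) by blast+
      then show ?thesis by (auto simp: Q_def)
    next
      case F: False
      then show ?thesis using hit'[OF inside(1)[OF K F]] by (auto simp: Q_def)
    qed
    moreover have "Q \<subseteq> S" using P P' S by (auto simp: Q_def)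
    ultimately show ?thesis unfolding transversal_def by blast
  qed
qed

text \<open>A maximal clique avoiding \<open>s\<close> stays maximal after \<open>s\<close> is
  removed, so it suffices to add \<open>s\<close> to a transversal of the rest.\<close>

lemma transversal_simplicial:
  assumes S: "S \<subseteq> V" "s \<in> S" and cl: "clique E {x \<in> S. E s x}"
    and tr: "S - {s} \<noteq> {} \<Longrightarrow> transversal E (S - {s})"
  shows "transversal E S"
proof -
  have "\<exists>P\<subseteq>S - {s}. perfect_on E P \<and> (\<forall>K. S - {s} \<noteq> {} \<longrightarrow> max_clique E (S - {s}) K \<longrightarrow> K \<inter> P \<noteq> {})"
    using tr perfect_on_empty unfolding transversal_def by (cases "S - {s} = {}") auto
  then obtain P where P: "P \<subseteq> S - {s}" "perfect_on E P"
    and hit: "\<And>K. S - {s} \<noteq> {} \<Longrightarrow> max_clique E (S - {s}) K \<Longrightarrow> K \<inter> P \<noteq> {}" by blast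
  have "perfect_on E (insert s P)"
  proof (rule perfect_on_simplicial[OF P(2)])
    have "{x \<in> P. E s x} \<subseteq> {x \<in> S. E s x}" using P(1) by auto
    then show "clique E {x \<in> P. E s x}" by (rule clique_subset[OF cl])
  qed (use P S in auto)
  moreover have "K \<inter> insert s P \<noteq> {}" if K: "max_clique E S K" for K
  proof (cases "s \<in> K")
    case False
    then have "max_clique E (S - {s}) K" "K \<noteq> {}" using K S(2) by (auto simp: max_clique_def)
    then show ?thesis using hit[of K] by (auto simp: max_clique_def)
  qed auto
  ultimately show ?thesis using P S unfolding transversal_def by (intro exI[of _ "insert s P"]) auto
qed

text \<open>A maximal clique without \<open>v\<close> contains a nonneighbour of \<open>v\<close>;
  these nonneighbours form a clique, to which \<open>v\<close> is added as an isolated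
  vertex.\<close>

lemma transversal_alpha2:
  assumes S: "S \<subseteq> V" "v \<in> S"
    and no: "\<And>a b. a \<in> S \<Longrightarrow> b \<in> S \<Longrightarrow> co V E v a \<Longrightarrow> co V E v b \<Longrightarrow> \<not> co V E a b"
  shows "transversal E S"
proof -
  define P where "P = {x \<in> S. co V E v x}"
  have "clique E P" using no S by (auto simp: clique_def P_def co_def)
  moreover have "P \<subseteq> V" using S by (auto simp: P_def)
  ultimately have "perfect_on E P" by (rule perfect_on_clique)
  moreover have "{x \<in> P. E v x} = {}" by (auto simp: P_def co_def)
  ultimately have "perfect_on E (insert v P)"
    using perfect_on_simplicial[of P v] S \<open>P \<subseteq> V\<close> by (auto simp: clique_def)
  moreover have "K \<inter> insert v P \<noteq> {}" if K: "max_clique E S K" for K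
  proof (cases "v \<in> K")
    case False
    then obtain c where c: "c \<in> K" "\<not> E v c" using K S(2) unfolding max_clique_def by blast
    then have "c \<in> S" "c \<noteq> v" using K False by (auto simp: max_clique_def)
    then have "c \<in> P" using S c by (auto simp: P_def co_def)
    then show ?thesis using c by blast
  qed auto
  moreover have "insert v P \<subseteq> S" using S by (auto simp: P_def)
  ultimately show ?thesis unfolding transversal_def by blast
qed

lemma transversal_induct:
  assumes base: "\<And>S a b c x y z. S \<subseteq> V \<Longrightarrow> prime_graph S (restrict S E) \<Longrightarrow>
      (\<And>s. s \<in> S \<Longrightarrow> \<not> clique E {x \<in> S. E s x}) \<Longrightarrow>
      a \<in> S \<Longrightarrow> b \<in> S \<Longrightarrow> c \<in> S \<Longrightarrow> E a b
        \<Longrightarrow> E a c \<Longrightarrow> E b c \<Longrightarrow>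
      x \<in> S \<Longrightarrow> y \<in> S \<Longrightarrow> z \<in> S \<Longrightarrow> co V E x y
        \<Longrightarrow> co V E x z \<Longrightarrow> co V E y z \<Longrightarrow> False"
    and tf: "\<And>S. S \<subseteq> V \<Longrightarrow> S \<noteq> {} \<Longrightarrow>
      (\<And>a b c. a \<in> S \<Longrightarrow> b \<in> S \<Longrightarrow> c \<in> S \<Longrightarrow> E a b \<Longrightarrow> E a c \<Longrightarrow> E b c \<Longrightarrow> False) \<Longrightarrow> transversal E S"
    and S: "S \<subseteq> V" "S \<noteq> {}"
  shows "transversal E S"
  using S
proof (induction "card S" arbitrary: S rule: less_induct)
  case less
  have finS: "finite S" using less.prems fin finite_subset by blast
  have IH: "transversal E T" if "T \<subset> S" "T \<noteq> {}" for T
    using less.hyps[OF psubset_card_mono[OF finS that(1)]] that less.prems by blast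
  have "\<not> prime_graph S (restrict S E) \<or> (\<exists>s\<in>S. clique E {x \<in> S. E s x}) \<or>
      \<not> (\<exists>a\<in>S. \<exists>b\<in>S. \<exists>c\<in>S. E a b \<and> E a c \<and> E b c) \<or>
      \<not> (\<exists>x\<in>S. \<exists>y\<in>S. \<exists>z\<in>S. co V E x y \<and> co V E x z \<and> co V E y z)" (is "?A \<or> ?B \<or> \<not> ?C \<or> \<not> ?D")
  proof (rule ccontr)
    assume h: "\<not> ?thesis"
    then have ?C ?D by blast+
    then obtain a b c x y z where "a \<in> S" "b \<in> S" "c \<in> S" "E a b" "E a c" "E b c"
      "x \<in> S" "y \<in> S" "z \<in> S" "co V E x y" "co V E x z" "co V E y z" by blast
    then show False using base[OF less.prems(1), of a b c x y z] h by blast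
  qed
  then consider ?A | s where "s \<in> S" "clique E {x \<in> S. E s x}" | "\<not> ?C" | "\<not> ?D" by blast
  then show ?case
  proof cases
    case 1
    then obtain X where X: "X \<subseteq> S" "\<exists>x\<in>X. \<exists>y\<in>X. x \<noteq> y"
      "X \<noteq> S"
      and hom: "\<not> (\<exists>u\<in>S - X. \<exists>a\<in>X. \<exists>b\<in>X. restrict S E u a \<and> \<not> restrict S E u b)"
      unfolding prime_graph_def by blast
    obtain x y where xy: "x \<in> X" "y \<in> X" "x \<noteq> y" using X by blast
    show ?thesis
    proof (rule transversal_substitute[OF less.prems(1) X(1) xy(1)])
      show "E v s" if "s \<in> S - X" "u \<in> X" "v \<in> X" "E u s" for s u v
      proof -
        have "restrict S E s u" using that X(1) E_comm by (auto simp: restrict_def)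
        then have "restrict S E s v" using hom that by blast
        then show ?thesis using E_comm by (auto simp: restrict_def)
      qed
      show "transversal E (insert x (S - X))" by (rule IH) (use X xy in auto)
      show "transversal E X" by (rule IH) (use X in auto)
    qed
  next
    case 2
    show ?thesis
      by (rule transversal_simplicial[OF less.prems(1) 2]) (use 2 in \<open>auto intro!: IH\<close>)
  next
    case 3
    then show ?thesis by (intro tf less.prems) blast
  next
    case 4
    obtain v where "v \<in> S" using less.prems by blast
    then show ?thesis using transversal_alpha2[OF less.prems(1)] 4 by blast
  qed
qed

end

section \<open>Perfect divisibility\<close>

definition adj :: "'a graph \<Rightarrow> 'a \<Rightarrow> 'a \<Rightarrow> bool" where
  "adj G x y \<longleftrightarrow> {x, y} \<in> edges G"

definition hammer_free :: "('a \<Rightarrow> 'a \<Rightarrow> bool) \<Rightarrow> bool" where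
  "hammer_free E \<longleftrightarrow> \<not> (\<exists>a b c d e. E a b \<and> E a c \<and> E b c \<and> E c d \<and> E d e \<and>
     \<not> E a d \<and> \<not> E b d \<and> \<not> E a e \<and> \<not> E b e \<and> \<not> E c e)"

lemma finite_graph_adj:
  assumes "simple_graph G"
  shows "finite_graph (verts G) (adj G)"
proof
  have e: "x \<in> verts G \<and> x \<noteq> y" if "adj G x y" for x y
  proof -
    have "{x, y} \<in> {{u, v} | u v. u \<in> verts G \<and> v \<in> verts G \<and> u \<noteq> v}"
      using that assms by (auto simp: adj_def simple_graph_def)
    then obtain u v where "{x, y} = {u, v}" "u \<in> verts G" "v \<in> verts G" "u \<noteq> v" by blast
    then show ?thesis by (auto simp: doubleton_eq_iff)
  qed
  show "finite (verts G)" using assms by (simp add: simple_graph_def)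
  show "x \<in> verts G" "adj G y x" if "adj G x y" for x y
    using e that by (auto simp: adj_def insert_commute)
  show "\<not> adj G x x" for x using e by blast
qed

lemma verts_induce [simp]: "verts (induce G S) = S"
  by (simp add: induce_def)

lemma induce_induce: "T \<subseteq> S \<Longrightarrow> induce (induce G S) T = induce G T"
  by (auto simp: induce_def)

lemma induced_subgraph_induce:
  "induced_subgraph H (induce G S) \<longleftrightarrow> (\<exists>T\<subseteq>S. H = induce G T)"
  unfolding induced_subgraph_def by (metis induce_induce verts_induce)

lemma adj_induce: "x \<in> S \<Longrightarrow> y \<in> S \<Longrightarrow> adj (induce G S) x y \<longleftrightarrow> adj G x y"
  by (simp add: adj_def induce_def)

lemma clique_number_induce: "clique_number (induce G T) = clique_num (adj G) T"
proof -
  have "is_clique (induce G T) K \<longleftrightarrow> K \<subseteq> T \<and> clique (adj G) K" for K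
    unfolding is_clique_def clique_def adj_def induce_def by auto
  then show ?thesis by (simp add: clique_number_def clique_num_def)
qed

lemma proper_coloring_induce: "proper_coloring (induce G T) k c \<longleftrightarrow> colors (adj G) T k c"
  unfolding proper_coloring_def colors_def adj_def induce_def by auto

lemma chromatic_number_induce:
  assumes G: "simple_graph G" and T: "finite T"
  shows "chromatic_number (induce G T) = clique_num (adj G) T \<longleftrightarrow> (\<exists>c. colors (adj G) T (clique_num (adj G) T) c)"
proof
  interpret finite_graph "verts G" "adj G" by (rule finite_graph_adj[OF G])
  \<comment> \<open>An injective colouring shows that the \<open>LEAST\<close> in
    \<open>chromatic_number\<close> is attained.\<close>
  obtain h where h: "bij_betw h T {0..<card T}" using ex_bij_betw_finite_nat[OF T] by blast
  have "colors (adj G) T (card T) h"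
    unfolding colors_def
  proof (intro conjI ballI impI)
    show "h v < card T" if "v \<in> T" for v using h that by (auto simp: bij_betw_def)
    show "h u \<noteq> h v" if "u \<in> T" "v \<in> T" "adj G u v" for u v
      using h that E_irr by (auto simp: bij_betw_def dest: inj_onD)
  qed
  then have ex: "\<exists>k c. proper_coloring (induce G T) k c" by (auto simp: proper_coloring_induce)
  show "\<exists>c. colors (adj G) T (clique_num (adj G) T) c" if
    "chromatic_number (induce G T) = clique_num (adj G) T"
    using LeastI_ex[OF ex] that by (simp add: chromatic_number_def proper_coloring_induce)
  show "chromatic_number (induce G T) = clique_num (adj G) T" if c:
    "\<exists>c. colors (adj G) T (clique_num (adj G) T) c"
    unfolding chromatic_number_def
  proof (rule Least_equality)
    show "\<exists>c. proper_coloring (induce G T) (clique_num (adj G) T) c" using c by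
      (simp add: proper_coloring_induce)
    fix k assume "\<exists>c. proper_coloring (induce G T) k c"
    then obtain c where c: "colors (adj G) T k c" by (auto simp: proper_coloring_induce)
    obtain K where "K \<subseteq> T" "clique (adj G) K" "card K = clique_num (adj G) T" using
      clique_num_clique[OF T] .
    then show "clique_num (adj G) T \<le> k" using colors_card[OF c] by metis
  qed
qed

lemma perfect_induce:
  assumes "simple_graph G" "S \<subseteq> verts G"
  shows "perfect (induce G S) \<longleftrightarrow> perfect_on (adj G) S"
proof -
  have "finite T" if "T \<subseteq> S" for T
    using that assms by (auto simp: simple_graph_def intro: finite_subset)
  moreover have "perfect (induce G S) \<longleftrightarrow>
      (\<forall>T\<subseteq>S. chromatic_number (induce G T) = clique_number (induce G T))"
    unfolding perfect_def induced_subgraph_induce by metis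
  ultimately show ?thesis
    using chromatic_number_induce[OF assms(1)] by (simp add: perfect_on_def clique_number_induce)
qed

text \<open>A clique of \<open>S - P\<close> of size \<omega> would be maximal in \<open>S\<close>
  and yet avoid \<open>P\<close>.\<close>

lemma perfectly_divisible_if_transversal:
  assumes G: "simple_graph G" and tr:
    "\<And>S. S \<subseteq> verts G \<Longrightarrow> S \<noteq> {} \<Longrightarrow> transversal (adj G) S"
  shows "perfectly_divisible G"
  unfolding perfectly_divisible_def
proof (intro allI impI, elim conjE)
  interpret finite_graph "verts G" "adj G" by (rule finite_graph_adj[OF G])
  fix H assume "induced_subgraph H G" and vH: "verts H \<noteq> {}"
  then obtain S where S: "S \<subseteq> verts G" "H = induce G S" by (auto simp: induced_subgraph_def)
  then have "S \<noteq> {}" using vH by simp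
  then obtain P where P: "P \<subseteq> S" "perfect_on (adj G) P" and hit:
    "\<And>K. max_clique (adj G) S K \<Longrightarrow> K \<inter> P \<noteq> {}"
    using tr[OF S(1)] unfolding transversal_def by blast
  have finS: "finite S" using S fin finite_subset by blast
  have "clique_num (adj G) (S - P) < clique_num (adj G) S"
  proof (rule ccontr)
    assume n: "\<not> ?thesis"
    obtain K where K: "K \<subseteq> S - P" "clique (adj G) K" "card K = clique_num (adj G) (S - P)"
      using clique_num_clique[of "S - P"] finS by blast
    have finK: "finite K" using K(1) finS finite_subset by blast
    have "\<exists>c\<in>K. \<not> adj G v c" if v: "v \<in> S - K" for v
    proof (rule ccontr)
      assume "\<not> ?thesis"
      then have "clique (adj G) (insert v K)" using clique_insert K(2) by blast
      then have "card (insert v K) \<le> clique_num (adj G) S" using clique_num_ge[OF finS] K(1) v by blast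
      then show False using n K(3) v finK by simp
    qed
    then have "max_clique (adj G) S K" using K by (auto simp: max_clique_def)
    then show False using hit K(1) by blast
  qed
  moreover have "induce H P = induce G P" "induce H (S - P) = induce G (S - P)"
    unfolding S(2) using P(1) by (auto intro!: induce_induce)
  moreover have "perfect (induce G P)" using P S perfect_induce[OF G, of P] by simp
  moreover have "verts H = S" "clique_number H = clique_num (adj G) S" using S(2) by
    (simp_all add: clique_number_induce)
  ultimately show "\<exists>A B. A \<union> B = verts H \<and> A \<inter> B = {} \<and> perfect (induce H A) \<and>
      clique_number (induce H B) < clique_number H"
    using P(1) by (intro exI[of _ P] exI[of _ "S - P"]) (auto simp: clique_number_induce)
qed

text \<open>As \<omega> \<le> 2, the part \<open>B\<close> is stable. A maximal clique avoiding
  \<open>A\<close> and \<open>I\<close> would be a single vertex of \<open>B\<close> with a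
  neighbour, which is not maximal.\<close>

lemma transversal_if_triangle_free:
  assumes G: "simple_graph G" and S: "S \<subseteq> verts G" "S \<noteq> {}"
    and no: "\<And>a b c. a \<in> S \<Longrightarrow> b \<in> S \<Longrightarrow> c \<in> S \<Longrightarrow> adj G a b \<Longrightarrow> adj G a c \<Longrightarrow> adj G b c \<Longrightarrow> False"
    and pd: "perfectly_divisible (induce G S)"
  shows "transversal (adj G) S"
proof -
  interpret finite_graph "verts G" "adj G" by (rule finite_graph_adj[OF G])
  have finS: "finite S" using S fin finite_subset by blast
  have "induced_subgraph (induce G S) (induce G S)" by (auto simp: induced_subgraph_induce)
  then obtain A B where AB: "A \<union> B = S" "A \<inter> B = {}" "perfect (induce (induce G S) A)"
    "clique_number (induce (induce G S) B) < clique_number (induce G S)"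
    using pd S(2) unfolding perfectly_divisible_def by (metis verts_induce)
  have A: "perfect_on (adj G) A" "A \<subseteq> verts G" "finite B"
    using AB S perfect_induce[OF G, of A] induce_induce[of A S G] finS by (auto intro: finite_subset)
  obtain K where K: "K \<subseteq> S" "clique (adj G) K" "card K = clique_num (adj G) S" using
    clique_num_clique[OF finS] .
  have "card K \<le> 2"
  proof (rule ccontr)
    assume "\<not> card K \<le> 2"
    then obtain L where "L \<subseteq> K" "card L = 3" using obtain_subset_with_card_n[of 3 K] by auto
    then obtain a b c where "{a, b, c} \<subseteq> K" "a \<noteq> b" "a \<noteq> c" "b \<noteq> c" by
      (auto simp: card_3_iff)
    then show False using no[of a b c] cliqueD[OF K(2)] K(1) by auto
  qed
  moreover have "induce (induce G S) B = induce G B" using AB(1) by (intro induce_induce) blast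
  then have "clique_num (adj G) B < clique_num (adj G) S" using AB(4) by (simp only: clique_number_induce)
  ultimately have cnB: "clique_num (adj G) B \<le> 1" using K by simp
  have stB: "\<not> adj G x y" if "x \<in> B" "y \<in> B" for x y
  proof
    assume "adj G x y"
    then have "clique (adj G) {x, y}" "x \<noteq> y" using E_comm[of x y] by (auto simp: clique_def)
    then show False using clique_num_ge[OF A(3), of "{x, y}" "adj G"] that cnB by simp
  qed
  define I where "I = {b \<in> B. \<forall>x\<in>S. \<not> adj G b x}"
  have "finite I" "I \<subseteq> I" using A(3) by (auto simp: I_def)
  then have "perfect_on (adj G) (A \<union> I)"
  proof (induction rule: finite_subset_induct')
    case (insert b F)
    have "perfect_on (adj G) (insert b (A \<union> F))"
    proof (rule perfect_on_simplicial[OF insert.IH])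
      have e: "{x \<in> A \<union> F. adj G b x} = {}" using insert.hyps AB(1) by (auto simp: I_def)
      show "clique (adj G) {x \<in> A \<union> F. adj G b x}" unfolding e by (simp add: clique_def)
    qed (use insert.hyps AB S in \<open>auto simp: I_def\<close>)
    then show ?case by simp
  qed (use A in simp)
  moreover have "K \<inter> (A \<union> I) \<noteq> {}" if K: "max_clique (adj G) S K" for K
  proof
    assume e: "K \<inter> (A \<union> I) = {}"
    have KS: "K \<subseteq> S" "clique (adj G) K" and mx:
      "\<And>v. v \<in> S \<Longrightarrow> v \<notin> K \<Longrightarrow> \<exists>c\<in>K. \<not> adj G v c"
      using K by (auto simp: max_clique_def)
    obtain k where k: "k \<in> K" using mx S(2) by blast
    then have kB: "k \<in> B" "k \<notin> I" using e KS AB(1) by auto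
    then obtain x where x: "x \<in> S" "adj G k x" by (auto simp: I_def)
    have only: "k' = k" if "k' \<in> K" for k'
      using that k e KS AB(1) stB[of k' k] cliqueD[OF KS(2), of k' k] by blast
    have "x \<noteq> k" using x by auto
    then have "x \<notin> K" using only by blast
    then show False using mx[OF x(1)] only x(2) E_comm[of k x] by blast
  qed
  moreover have "A \<union> I \<subseteq> S" using AB(1) by (auto simp: I_def)
  ultimately show ?thesis unfolding transversal_def by blast
qed

section \<open>From forbidden induced subgraphs to adjacency patterns\<close>

lemma not_free_of:
  assumes "inj_on f (verts F)" "f ` verts F \<subseteq> verts G"
    and "\<And>u v. u \<in> verts F \<Longrightarrow> v \<in> verts F \<Longrightarrow> {u, v} \<in> edges F \<longleftrightarrow> adj G (f u) (f v)"
  shows "\<not> free_of F G"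
proof -
  have "induced_subgraph (induce G (f ` verts F)) G" using assms(2) by (auto simp: induced_subgraph_def)
  moreover have "graph_iso F (induce G (f ` verts F))"
    unfolding graph_iso_def
  proof (intro exI conjI ballI)
    show "bij_betw f (verts F) (verts (induce G (f ` verts F)))" using assms(1) by (simp add: bij_betw_def)
    show "{u, v} \<in> edges F \<longleftrightarrow> {f u, f v} \<in> edges (induce G (f ` verts F))"
      if "u \<in> verts F" "v \<in> verts F" for u v
      using assms(3)[OF that] that by (simp add: induce_def adj_def)
  qed
  ultimately show ?thesis unfolding free_of_def by blast
qed

lemma free_of_if_triangle_free:
  assumes no: "\<And>a b c. adj G a b \<Longrightarrow> adj G a c \<Longrightarrow> adj G b c \<Longrightarrow> False"
    and xyz: "x \<in> verts F" "y \<in> verts F" "z \<in> verts F" "{x, y} \<in> edges F"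
      "{x, z} \<in> edges F" "{y, z} \<in> edges F"
  shows "free_of F G"
  unfolding free_of_def
proof
  assume "\<exists>H. induced_subgraph H G \<and> graph_iso F H"
  then obtain S f where f:
    "\<forall>u\<in>verts F. \<forall>v\<in>verts F. {u, v} \<in> edges F \<longleftrightarrow> {f u, f v} \<in> edges (induce G S)"
    unfolding induced_subgraph_def graph_iso_def by blast
  then have "adj G (f x) (f y)" "adj G (f x) (f z)" "adj G (f y) (f z)"
    using xyz by (simp_all add: adj_def induce_def)
  then show False using no by blast
qed

lemma complete_graph_edges:
  "{u, v} \<in> edges (complete_graph n) \<longleftrightarrow> u < n \<and> v < n \<and> u \<noteq> v"
  by (auto simp: complete_graph_def doubleton_eq_iff)

lemma complete_graph_no_loop: "{u} \<notin> edges (complete_graph n)"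
  using complete_graph_edges[of u u n] by simp

lemma house_edges: "{u, v} \<in> edges house \<longleftrightarrow> u < 5 \<and> v < 5 \<and> u \<noteq> v \<and> v \<noteq> Suc u \<and> u \<noteq> Suc v"
  by (auto simp: house_def complement_graph_def path_graph_def doubleton_eq_iff)

lemma pattern_verts:
  "verts bull = {0, 1, 2, 3, 4}" "verts house = {0, 1, 2, 3, 4}" "verts hammer = {0, 1, 2, 3, 4}"
  "verts diamond = {0, 1, 2, 3}" "verts triangle = {0, 1, 2}"
  by (auto simp: bull_def house_def hammer_def diamond_def complement_graph_def path_graph_def complete_graph_def)

lemma triangle_free_iff:
  assumes G: "simple_graph G"
  shows "free_of triangle G \<longleftrightarrow> (\<forall>a b c. adj G a b \<longrightarrow> adj G a c \<longrightarrow> \<not> adj G b c)"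
proof
  interpret finite_graph "verts G" "adj G" by (rule finite_graph_adj[OF G])
  show "\<forall>a b c. adj G a b \<longrightarrow> adj G a c \<longrightarrow> \<not> adj G b c" if free:
    "free_of triangle G"
  proof (intro allI impI notI)
    fix a b c assume h: "adj G a b" "adj G a c" "adj G b c"
    have h': "adj G b a" "adj G c a" "adj G c b"

      using h E_sym by blast+
    have "\<not> free_of triangle G"
    proof (rule not_free_of[of "\<lambda>i. [a, b, c] ! i"])
      show "inj_on (\<lambda>i. [a, b, c] ! i) (verts triangle)" using h by
        (auto simp: pattern_verts inj_on_def)
      show "(\<lambda>i. [a, b, c] ! i) ` verts triangle \<subseteq> verts G" using h E_in E_in2 by
        (auto simp: pattern_verts)
      show "{u, v} \<in> edges triangle \<longleftrightarrow> adj G ([a, b, c] ! u) ([a, b, c] ! v)"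
        if "u \<in> verts triangle" "v \<in> verts triangle" for u v
        using that unfolding pattern_verts complete_graph_edges
        by (elim insertE emptyE) (simp_all add: h h')
    qed
    then show False using free by blast
  qed
  show "free_of triangle G" if no:
    "\<forall>a b c. adj G a b \<longrightarrow> adj G a c \<longrightarrow> \<not> adj G b c"
  proof (rule free_of_if_triangle_free[of G 0 triangle 1 2])
    show False if "adj G a b" "adj G a c" "adj G b c" for a b c using that no by blast
  qed (simp_all add: pattern_verts complete_graph_edges)
qed

lemma bull_free_adj:
  assumes G: "simple_graph G" and free: "free_of bull G"
  shows "bull_free (adj G)"
proof -
  interpret finite_graph "verts G" "adj G" by (rule finite_graph_adj[OF G])
  have no: False if h: "adj G a b" "adj G a c" "adj G b c" "adj G a d" "adj G b e"
     "\<not> adj G b d" "\<not> adj G c d" "\<not> adj G a e" "\<not> adj G c e" "\<not> adj G d e" for a b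
     c d e
  proof -
    have h': "adj G b a" "adj G c a" "adj G c b" "adj G d a" "adj G e b"
      "\<not> adj G d b" "\<not> adj G d c" "\<not> adj G e a" "\<not> adj G e c" "\<not> adj G e d"
      using h E_sym by blast+
    have ne: "a \<noteq> b" "a \<noteq> c" "a \<noteq> d" "a \<noteq> e" "b \<noteq> c" "b \<noteq> d"
      "b \<noteq> e" "c \<noteq> d" "c \<noteq> e" "d \<noteq> e"
      using h E_comm by auto
    have "\<not> free_of bull G"
    proof (rule not_free_of[of "\<lambda>i. [a, b, c, d, e] ! i"])
      show "inj_on (\<lambda>i. [a, b, c, d, e] ! i) (verts bull)" using ne by
        (auto simp: pattern_verts inj_on_def)
      show "(\<lambda>i. [a, b, c, d, e] ! i) ` verts bull \<subseteq> verts G" using h E_in E_in2 by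
        (auto simp: pattern_verts)
      show "{u, v} \<in> edges bull \<longleftrightarrow> adj G ([a, b, c, d, e] ! u) ([a, b, c, d, e] ! v)"
        if "u \<in> verts bull" "v \<in> verts bull" for u v
        using that unfolding pattern_verts
        by (elim insertE emptyE) (simp_all add: bull_def doubleton_eq_iff h h')
    qed
    then show False using free by blast
  qed
  show ?thesis unfolding bull_free_def by (intro notI, elim exE conjE) (rule no)
qed

lemma house_free_adj:
  assumes G: "simple_graph G" and free: "free_of house G"
  shows "house_free (adj G)"
proof -
  interpret finite_graph "verts G" "adj G" by (rule finite_graph_adj[OF G])
  have no: False if h: "adj G p q" "adj G q r" "adj G r s" "adj G s p" "adj G t p" "adj G t q"
     "\<not> adj G p r" "\<not> adj G q s" "\<not> adj G t r" "\<not> adj G t s" for p q r s t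
  proof -
    have h': "adj G q p" "adj G r q" "adj G s r" "adj G p s" "adj G p t" "adj G q t"
      "\<not> adj G r p" "\<not> adj G s q" "\<not> adj G r t" "\<not> adj G s t"
      using h E_sym by blast+
    have ne: "p \<noteq> q" "p \<noteq> r" "p \<noteq> s" "p \<noteq> t" "q \<noteq> r" "q \<noteq> s"
      "q \<noteq> t" "r \<noteq> s" "r \<noteq> t" "s \<noteq> t"
      using h E_comm by auto
    \<comment> \<open>The list \<open>p r t s q\<close> follows the \<open>P5\<close> of nonedges,
      matching the definition of \<open>house\<close> as a complement.\<close>
    have "\<not> free_of house G"
    proof (rule not_free_of[of "\<lambda>i. [p, r, t, s, q] ! i"])
      show "inj_on (\<lambda>i. [p, r, t, s, q] ! i) (verts house)" using ne by
        (auto simp: pattern_verts inj_on_def)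
      show "(\<lambda>i. [p, r, t, s, q] ! i) ` verts house \<subseteq> verts G" using h E_in E_in2 by
        (auto simp: pattern_verts)
      show "{u, v} \<in> edges house \<longleftrightarrow> adj G ([p, r, t, s, q] ! u) ([p, r, t, s, q] ! v)"
        if "u \<in> verts house" "v \<in> verts house" for u v
        using that unfolding pattern_verts house_edges
        by (elim insertE emptyE) (simp_all add: h h')
    qed
    then show False using free by blast
  qed
  show ?thesis unfolding house_free_def by (intro notI, elim exE conjE) (rule no)
qed

lemma hammer_free_adj:
  assumes G: "simple_graph G" and free: "free_of hammer G"
  shows "hammer_free (adj G)"
proof -
  interpret finite_graph "verts G" "adj G" by (rule finite_graph_adj[OF G])
  have no: False if h: "adj G a b" "adj G a c" "adj G b c" "adj G c d" "adj G d e"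
     "\<not> adj G a d" "\<not> adj G b d" "\<not> adj G a e" "\<not> adj G b e" "\<not> adj G c e" for a b
     c d e
  proof -
    have h': "adj G b a" "adj G c a" "adj G c b" "adj G d c" "adj G e d"
      "\<not> adj G d a" "\<not> adj G d b" "\<not> adj G e a" "\<not> adj G e b" "\<not> adj G e c"
      using h E_sym by blast+
    have ne: "a \<noteq> b" "a \<noteq> c" "a \<noteq> d" "a \<noteq> e" "b \<noteq> c" "b \<noteq> d"
      "b \<noteq> e" "c \<noteq> d" "c \<noteq> e" "d \<noteq> e"
      using h E_comm by auto
    have "\<not> free_of hammer G"
    proof (rule not_free_of[of "\<lambda>i. [a, b, c, d, e] ! i"])
      show "inj_on (\<lambda>i. [a, b, c, d, e] ! i) (verts hammer)" using ne by
        (auto simp: pattern_verts inj_on_def)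
      show "(\<lambda>i. [a, b, c, d, e] ! i) ` verts hammer \<subseteq> verts G" using h E_in E_in2 by
        (auto simp: pattern_verts)
      show "{u, v} \<in> edges hammer \<longleftrightarrow> adj G ([a, b, c, d, e] ! u) ([a, b, c, d, e] ! v)"
        if "u \<in> verts hammer" "v \<in> verts hammer" for u v
        using that unfolding pattern_verts
        by (elim insertE emptyE) (simp_all add: hammer_def doubleton_eq_iff h h')
    qed
    then show False using free by blast
  qed
  show ?thesis unfolding hammer_free_def by (intro notI, elim exE conjE) (rule no)
qed

lemma diamond_free_adj:
  assumes G: "simple_graph G" and free: "free_of diamond G"
  shows "diamond_free (adj G)"
proof -
  interpret finite_graph "verts G" "adj G" by (rule finite_graph_adj[OF G])
  have no: False if h: "adj G a c" "adj G a d" "adj G b c" "adj G b d" "adj G c d" "a \<noteq> b"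
    "\<not> adj G a b" for a b c d
  proof -
    have h': "adj G c a" "adj G d a" "adj G c b" "adj G d b" "adj G d c"
      "\<not> adj G b a"
      using h E_sym by blast+
    have ne: "a \<noteq> b" "a \<noteq> c" "a \<noteq> d" "b \<noteq> c" "b \<noteq> d" "c \<noteq> d" using
      h by auto
    have "\<not> free_of diamond G"
    proof (rule not_free_of[of "\<lambda>i. [a, b, c, d] ! i"])
      show "inj_on (\<lambda>i. [a, b, c, d] ! i) (verts diamond)" using ne by
        (auto simp: pattern_verts inj_on_def)
      show "(\<lambda>i. [a, b, c, d] ! i) ` verts diamond \<subseteq> verts G" using h E_in E_in2 by
        (auto simp: pattern_verts)
      show "{u, v} \<in> edges diamond \<longleftrightarrow> adj G ([a, b, c, d] ! u) ([a, b, c, d] ! v)"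
        if "u \<in> verts diamond" "v \<in> verts diamond" for u v
        using that unfolding pattern_verts
        by (elim insertE emptyE)
          (simp_all add: diamond_def complete_graph_edges complete_graph_no_loop doubleton_eq_iff h h')
    qed
    then show False using free by blast
  qed
  show ?thesis unfolding diamond_free_def by (intro notI, elim exE conjE) (rule no)
qed

lemma bull_free_restrict: "bull_free E \<Longrightarrow> bull_free (restrict S E)"
  unfolding bull_free_def restrict_def by blast

lemma house_free_restrict: "house_free E \<Longrightarrow> house_free (restrict S E)"
  unfolding house_free_def restrict_def by blast

lemma diamond_free_restrict: "diamond_free E \<Longrightarrow> diamond_free (restrict S E)"
  unfolding diamond_free_def restrict_def by blast

text \<open>Complementing the 4-cycle \<open>p q r s\<close> with pendant \<open>t\<close> gives the
  triangle \<open>q s t\<close> with the tail \<open>t r p\<close>, a hammer.\<close>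

lemma banner_free_co_restrict:
  assumes "finite_graph V E" "hammer_free E"
  shows "banner_free (co S (restrict S E))"
proof -
  interpret finite_graph V E by fact
  have no: False if h: "co S (restrict S E) p q" "co S (restrict S E) q r" "co S (restrict S E) r s"
     "co S (restrict S E) s p" "co S (restrict S E) p t" "q \<noteq> s"
     "\<not> co S (restrict S E) p r" "\<not> co S (restrict S E) q s" "\<not> co S (restrict S E) q t"
     "\<not> co S (restrict S E) r t" "\<not> co S (restrict S E) s t" for p q r s t
  proof -
    have i: "p \<in> S" "q \<in> S" "r \<in> S" "s \<in> S" "t \<in> S" using h by (auto simp: co_def)
    have ne: "p \<noteq> r" "q \<noteq> t" "r \<noteq> t" "s \<noteq> t" using h E_comm by
      (auto simp: co_def restrict_def)
    have "E p r" "E q s" "E q t" "E r t" "E s t" "\<not> E p q" "\<not> E q r" "\<not> E r s" "\<not> E s p"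
      "\<not> E p t"
      using h ne i by (auto simp: co_def restrict_def)
    then have "E s q" "E s t" "E q t" "E t r" "E r p" "\<not> E s r" "\<not> E q r" "\<not> E s p"
      "\<not> E q p" "\<not> E t p"
      using E_comm by blast+
    then show False using assms(2) unfolding hammer_free_def by blast
  qed
  show ?thesis unfolding banner_free_def by (intro notI, elim exE conjE) (rule no)
qed

lemma prime_triangle_stable_False:
  assumes G: "simple_graph G" and bull: "free_of bull G" and H: "free_of H G"
    "H \<in> {house, hammer, diamond}"
    and S: "S \<subseteq> verts G" "prime_graph S (restrict S (adj G))"
    and no_simplicial: "\<And>s. s \<in> S \<Longrightarrow> \<not> clique (adj G) {x \<in> S. adj G s x}"
    and tri: "a \<in> S" "b \<in> S" "c \<in> S" "adj G a b" "adj G a c" "adj G b c"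
    and st: "x \<in> S" "y \<in> S" "z \<in> S" "co (verts G) (adj G) x y" "co (verts G) (adj G) x z"
      "co (verts G) (adj G) y z"
  shows False
proof -
  interpret g: finite_graph "verts G" "adj G" by (rule finite_graph_adj[OF G])
  let ?R = "restrict S (adj G)"
  have R: "finite_graph S ?R" by (rule g.finite_graph_restrict[OF S(1)])
  have bull: "bull_free ?R" by (rule bull_free_restrict[OF bull_free_adj[OF G bull]])
  have pb: "prime_bull_free S ?R" by (intro prime_bull_free.intro prime_bull_free_axioms.intro R S bull)
  have triR: "?R a b" "?R a c" "?R b c" using tri by (auto simp: restrict_def)
  have stR: "co S ?R x y" "co S ?R x z" "co S ?R y z" using st by (auto simp: co_def restrict_def)
  consider "H = house" | "H = hammer" | "H = diamond" using H by blast
  then show False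
  proof cases
    case 1
    then have "house_free ?R" using house_free_restrict house_free_adj[OF G] H by blast
    then have "house_graph S ?R" by (intro house_graph.intro house_graph_axioms.intro pb)
    then show ?thesis using house_graph.triangle_stable_False triR stR by metis
  next
    case 2
    interpret R: finite_graph S ?R by (rule R)
    interpret c: finite_graph S "co S ?R" by (rule R.finite_graph_co)
    have "banner_free (co S ?R)"
      using banner_free_co_restrict[OF finite_graph_adj[OF G] hammer_free_adj[OF G]] H(1)[unfolded 2] by
        blast
    then have "banner_graph S (co S ?R)"
      by (intro banner_graph.intro banner_graph_axioms.intro prime_bull_free.intro prime_bull_free_axioms.intro
          c.finite_graph_axioms R.prime_co S bull_free_co R bull)
    moreover have "co S (co S ?R) a b" "co S (co S ?R) a c" "co S (co S ?R) b c"
      using triR tri R.E_irr by (auto simp: co_def)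
    ultimately show ?thesis using banner_graph.triangle_stable_False stR by metis
  next
    case 3
    then have "diamond_free ?R" using diamond_free_restrict diamond_free_adj[OF G] H by blast
    then interpret R: diamond_graph S ?R by (intro diamond_graph.intro diamond_graph_axioms.intro pb)
    have "\<not> clique ?R (R.N s)" if s: "s \<in> S" for s
    proof -
      have "R.N s = {x \<in> S. adj G s x}" using s by (auto simp: restrict_def)
      then show ?thesis using no_simplicial[OF s] by (auto simp: clique_def restrict_def)
    qed
    then show ?thesis using R.triangle_stable_False[OF triR _ stR] by blast
  qed
qed

theorem theorem6:
  fixes \<G> \<C> \<H> :: "'a graph set" and H :: "nat graph"
  assumes "H \<in> {house, hammer, diamond}"
    and "\<C> = {G. simple_graph G \<and> free_of bull G \<and> free_of H G}"
    and "hereditary \<G>"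
    and "\<H> = {G. simple_graph G \<and> free_of triangle G}"
  shows "(\<forall>G \<in> \<G> \<inter> \<C>. perfectly_divisible G) \<longleftrightarrow> (\<forall>G \<in> \<G> \<inter> \<H>. perfectly_divisible G)"
proof
  assume C: "\<forall>G \<in> \<G> \<inter> \<C>. perfectly_divisible G"
  show "\<forall>G \<in> \<G> \<inter> \<H>. perfectly_divisible G"
  proof
    fix G assume G: "G \<in> \<G> \<inter> \<H>"
    then have simple: "simple_graph G" and "free_of triangle G" using assms(4) by auto
    then have no: False if "adj G a b" "adj G a c" "adj G b c" for a b c
      using triangle_free_iff that by blast
    have "free_of bull G"
      by (rule free_of_if_triangle_free[of G 0 bull 1 2]) (use no in \<open>auto simp: bull_def\<close>)
    moreover have "free_of house G"
    \<comment> \<open>The vertices 0, 2, 4 are stable in the path, hence a triangle in its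
      complement.\<close>
    proof (rule free_of_if_triangle_free[of G 0 house 2 4])
      show "{0, 2} \<in> edges house" "{0, 4} \<in> edges house" "{2, 4} \<in> edges house"
        unfolding house_edges by simp_all
    qed (use no in \<open>auto simp: pattern_verts\<close>)
    moreover have "free_of hammer G"
      by (rule free_of_if_triangle_free[of G 0 hammer 1 2]) (use no in \<open>auto simp: hammer_def\<close>)
    moreover have "free_of diamond G"
    proof (rule free_of_if_triangle_free[of G 0 diamond 2 3])
      show "{0, 2} \<in> edges diamond" "{0, 3} \<in> edges diamond" "{2, 3} \<in> edges diamond"
        unfolding diamond_def by (simp_all add: complete_graph_edges doubleton_eq_iff)
    qed (use no in \<open>auto simp: pattern_verts\<close>)
    ultimately have "G \<in> \<C>" using simple assms(1,2) by auto
    then show "perfectly_divisible G" using C G by blast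
  qed
next
  assume T: "\<forall>G \<in> \<G> \<inter> \<H>. perfectly_divisible G"
  show "\<forall>G \<in> \<G> \<inter> \<C>. perfectly_divisible G"
  proof
    fix G assume G: "G \<in> \<G> \<inter> \<C>"
    then have simple: "simple_graph G" and free: "free_of bull G" "free_of H G" using assms(2) by auto
    interpret finite_graph "verts G" "adj G" by (rule finite_graph_adj[OF simple])
    show "perfectly_divisible G"
    proof (rule perfectly_divisible_if_transversal[OF simple], rule transversal_induct)
      fix S assume S: "S \<subseteq> verts G" "S \<noteq> {}"
        and no: "\<And>a b c. a \<in> S \<Longrightarrow> b \<in> S \<Longrightarrow> c \<in> S \<Longrightarrow> adj G a b \<Longrightarrow> adj G a c \<Longrightarrow> adj G b c \<Longrightarrow> False"
      \<comment> \<open>Heredity places the triangle-free graph induced by \<open>S\<close> in the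
        class, so the assumption on triangle-free members applies to it.\<close>
      have "induced_subgraph (induce G S) G" using S by (auto simp: induced_subgraph_def)
      then have GS: "induce G S \<in> \<G>" using G assms(3) unfolding hereditary_def by blast
      then have simpleS: "simple_graph (induce G S)" using assms(3) by (simp add: hereditary_def)
      interpret S: finite_graph "verts (induce G S)" "adj (induce G S)" by
        (rule finite_graph_adj[OF simpleS])
      have "\<not> adj (induce G S) b c" if "adj (induce G S) a b" "adj (induce G S) a c" for a b c
        using no[of a b c] that S.E_in[of a b] S.E_in2[of a b] S.E_in2[of a c]
        by (auto simp: adj_induce)
      then have "free_of triangle (induce G S)" using triangle_free_iff[OF simpleS] by blast
      then have "perfectly_divisible (induce G S)" using T GS simpleS assms(4) by blast
      from transversal_if_triangle_free[OF simple S no this] show "transversal (adj G) S" .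
    qed (use prime_triangle_stable_False[OF simple free assms(1)] in blast)+
  qed
qed

end
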